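(* Let $X$ be a non-empty, locally compact space with Borel $\sigma$-algebra $\mathfrak B$, let $\mu$ be a positive regular Borel measure on $X$, and let $1\le p<\infty$. For $g\in\mathrm{L}^p(X,\mathfrak B,\mu,\mathbb R)$, set $$\langle\varphi_g,f\rangle:=\int_X fg\,d\mu$$ for $f\in\mathrm{C}_{\mathrm c}(X,\mathbb R)$. Then $\varphi_g\in\mathrm{C}_{\mathrm c}(X,\mathbb R)^\sim$, and the map $\Phi:g\mapsto\varphi_g$ defines an injective lattice homomorphism $\Phi:\mathrm{L}^p(X,\mathfrak B,\mu,\mathbb R)\to\mathrm{C}_{\mathrm c}(X,\mathbb R)^\sim$. Suppose that $h$ is a bounded Borel measurable function on $X$. Then $\varphi_{hg}=h\varphi_g$. For $g\in\mathrm{L}^p(X,\mathfrak B,\mu,\mathbb R)$, set $\|\varphi_g\|:=\|g\|_p$, thus making $\Phi(\mathrm{L}^p(X,\mathfrak B,\mu,\mathbb R))$ into a Dedekind complete Banach lattice. Then the set $$\{\varphi_g: g\in\mathrm{C}_{\mathrm c}(X,\mathbb R),\ \operatorname{supp}g^+\cap\operatorname{supp}g^-=\emptyset\}$$ is a dense subset of the Banach lattice $\Phi(\mathrm{L}^p(X,\mathfrak B,\mu,\mathbb R))$. Consequently, the set $$\{\varphi\in\Phi(\mathrm{L}^p(X,\mathfrak B,\mu,\mathbb R)): \operatorname{supp}\varphi\text{ is compact and }\operatorname{supp}\varphi^+\cap\operatorname{supp}\varphi^-=\emptyset\}$$ is a dense subset of the Banach lattice $\Phi(\mathrm{L}^p(X,\mathfrak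 B,\mu,\mathbb R))$.
   Context: All topological spaces are Hausdorff; functions are real-valued. A positive regular Borel measure on $X$ is a measure $\mu:\mathfrak B\to[0,\infty]$ on the Borel $\sigma$-algebra that is finite on compact sets, outer regular on all Borel sets ($\mu(A)=\inf\{\mu(V):V\text{ open},A\subseteq V\}$), and inner regular on all open sets ($\mu(V)=\sup\{\mu(K):K\text{ compact},K\subseteq V\}$). $\mathrm{L}^p$ carries the pointwise $\mu$-almost everywhere ordering. $\mathrm{C}_{\mathrm c}(X,\mathbb R)$ is the vector lattice of continuous, real-valued functions on $X$ with compact support, with pointwise ordering. Its order dual $\mathrm{C}_{\mathrm c}(X,\mathbb R)^\sim$ is the space of linear functionals on it that map order bounded sets to bounded sets (equivalently, differences of two positive functionals), with $\varphi\ge\psi$ iff $\langle\varphi,f\rangle\ge\langle\psi,f\rangle$ for all $f\ge0$; it is a Dedekind complete vector lattice. In a vector lattice, $x^+=x\vee0$, $x^-=(-x)\vee0$, $|x|=x\vee(-x)$; a linear map $L$ between vector lattices is a lattice homomorphism if $|Lx|=L|x|$ for all $x$. A Banach lattice is a vector lattice with a complete norm such that $|x|\le|y|$ implies $\|x\|\le\|y\|$. Support: $\varphi\in\mathrm{C}_{\mathrm c}(X,\mathbb R)^\sim$ vanishes on an open set $U\subseteq X$ if $\langle\varphi,f\rangle=0$ for all $f\in \mathrm{C}_{\mathrm c}(X,\mathbb R)$ with $\operatorname{supp} f\subseteq U$; $\operatorname{supp}\varphi$ is the complement of the union of all open sets on which $\varphi$ vanishes. Product with bounded Borel functions: for $\varphi\in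 \mathrm{C}_{\mathrm c}(X,\mathbb R)^\sim$ and a non-empty, open, relatively compact $U\subseteq X$, there is a unique finite signed regular Borel measure $\mu_U$ on $U$ with $\langle\varphi,k\rangle=\int_U k\,d\mu_U$ for all $k\in\mathrm{C}_{\mathrm c}(X,\mathbb R)$ with $\operatorname{supp}k\subseteq U$. For a bounded Borel measurable $h:X\to\mathbb R$, the element $h\varphi$ of $\mathrm{C}_{\mathrm c}(X,\mathbb R)^\sim$ is defined by $\langle h\varphi,f\rangle:=\int_U fh\,d\mu_U$, where $U$ is any open relatively compact neighbourhood of $\operatorname{supp}f$ (this is independent of $U$). *)

theory Defs
  imports "HOL-Analysis.Analysis"
begin

section \<open>Vector lattices on a carrier\<close>

text \<open>
  The spaces \<open>L^p\<close> (which depends on a measure and an exponent) and the image of the embedding below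
  are not types, so ordered vector spaces are given here by an explicit carrier and operations.
\<close>

record 'v ovs =
  vcarrier :: "'v set"
  vzero :: 'v
  vadd :: "'v \<Rightarrow> 'v \<Rightarrow> 'v"
  vscale :: "real \<Rightarrow> 'v \<Rightarrow> 'v"
  vle :: "'v \<Rightarrow> 'v \<Rightarrow> bool"

definition vminus :: "('v, 'm) ovs_scheme \<Rightarrow> 'v \<Rightarrow> 'v" where
  "vminus V x = vscale V (- 1) x"

definition vdiff :: "('v, 'm) ovs_scheme \<Rightarrow> 'v \<Rightarrow> 'v \<Rightarrow> 'v" where
  "vdiff V x y = vadd V x (vminus V y)"

definition is_sup_in :: "('v, 'm) ovs_scheme \<Rightarrow> 'v set \<Rightarrow> 'v \<Rightarrow> bool" where
  "is_sup_in V A s \<longleftrightarrow> s \<in> vcarrier V \<and> (\<forall>a\<in>A. vle V a s) \<and>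
     (\<forall>u\<in>vcarrier V. (\<forall>a\<in>A. vle V a u) \<longrightarrow> vle V s u)"

definition is_inf_in :: "('v, 'm) ovs_scheme \<Rightarrow> 'v set \<Rightarrow> 'v \<Rightarrow> bool" where
  "is_inf_in V A s \<longleftrightarrow> s \<in> vcarrier V \<and> (\<forall>a\<in>A. vle V s a) \<and>
     (\<forall>u\<in>vcarrier V. (\<forall>a\<in>A. vle V u a) \<longrightarrow> vle V u s)"

definition vsup :: "('v, 'm) ovs_scheme \<Rightarrow> 'v \<Rightarrow> 'v \<Rightarrow> 'v" where
  "vsup V x y = (THE s. is_sup_in V {x, y} s)"

definition vabs :: "('v, 'm) ovs_scheme \<Rightarrow> 'v \<Rightarrow> 'v" where
  "vabs V x = vsup V x (vminus V x)"

definition pos_part :: "('v, 'm) ovs_scheme \<Rightarrow> 'v \<Rightarrow> 'v" where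
  "pos_part V x = vsup V x (vzero V)"

definition neg_part :: "('v, 'm) ovs_scheme \<Rightarrow> 'v \<Rightarrow> 'v" where
  "neg_part V x = vsup V (vminus V x) (vzero V)"

locale ordered_vector_space =
  fixes V :: "('v, 'm) ovs_scheme"
  assumes zero_closed: "vzero V \<in> vcarrier V"
    and add_closed: "\<lbrakk>x \<in> vcarrier V; y \<in> vcarrier V\<rbrakk> \<Longrightarrow> vadd V x y \<in> vcarrier V"
    and scale_closed: "x \<in> vcarrier V \<Longrightarrow> vscale V a x \<in> vcarrier V"
    and add_assoc: "\<lbrakk>x \<in> vcarrier V; y \<in> vcarrier V; z \<in> vcarrier V\<rbrakk> \<Longrightarrow>
          vadd V (vadd V x y) z = vadd V x (vadd V y z)"
    and add_commute: "\<lbrakk>x \<in> vcarrier V; y \<in> vcarrier V\<rbrakk> \<Longrightarrow> vadd V x y = vadd V y x"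
    and add_zero: "x \<in> vcarrier V \<Longrightarrow> vadd V x (vzero V) = x"
    and add_minus: "x \<in> vcarrier V \<Longrightarrow> vadd V x (vminus V x) = vzero V"
    and scale_add_right: "\<lbrakk>x \<in> vcarrier V; y \<in> vcarrier V\<rbrakk> \<Longrightarrow>
          vscale V a (vadd V x y) = vadd V (vscale V a x) (vscale V a y)"
    and scale_add_left: "x \<in> vcarrier V \<Longrightarrow>
          vscale V (a + b) x = vadd V (vscale V a x) (vscale V b x)"
    and scale_scale: "x \<in> vcarrier V \<Longrightarrow> vscale V a (vscale V b x) = vscale V (a * b) x"
    and scale_one: "x \<in> vcarrier V \<Longrightarrow> vscale V 1 x = x"
    and le_refl: "x \<in> vcarrier V \<Longrightarrow> vle V x x"
    and le_antisym: "\<lbrakk>x \<in> vcarrier V; y \<in> vcarrier V; vle V x y; vle V y x\<rbrakk> \<Longrightarrow> x = y"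
    and le_trans: "\<lbrakk>x \<in> vcarrier V; y \<in> vcarrier V; z \<in> vcarrier V; vle V x y; vle V y z\<rbrakk> \<Longrightarrow>
          vle V x z"
    and add_right_mono: "\<lbrakk>x \<in> vcarrier V; y \<in> vcarrier V; z \<in> vcarrier V; vle V x y\<rbrakk> \<Longrightarrow>
          vle V (vadd V x z) (vadd V y z)"
    and scale_left_mono: "\<lbrakk>x \<in> vcarrier V; y \<in> vcarrier V; vle V x y; 0 \<le> a\<rbrakk> \<Longrightarrow>
          vle V (vscale V a x) (vscale V a y)"

locale vector_lattice = ordered_vector_space +
  assumes sup_exists: "\<lbrakk>x \<in> vcarrier V; y \<in> vcarrier V\<rbrakk> \<Longrightarrow> \<exists>s. is_sup_in V {x, y} s"
    and inf_exists: "\<lbrakk>x \<in> vcarrier V; y \<in> vcarrier V\<rbrakk> \<Longrightarrow> \<exists>s. is_inf_in V {x, y} s"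

definition dedekind_complete :: "('v, 'm) ovs_scheme \<Rightarrow> bool" where
  "dedekind_complete V \<longleftrightarrow>
     (\<forall>A. A \<subseteq> vcarrier V \<and> A \<noteq> {} \<and> (\<exists>u\<in>vcarrier V. \<forall>a\<in>A. vle V a u) \<longrightarrow> (\<exists>s. is_sup_in V A s))"

locale lattice_hom = dom: vector_lattice V + cod: vector_lattice W
  for V :: "('v, 'm) ovs_scheme" and W :: "('w, 'n) ovs_scheme" and L :: "'v \<Rightarrow> 'w" +
  assumes hom_closed: "x \<in> vcarrier V \<Longrightarrow> L x \<in> vcarrier W"
    and hom_add: "\<lbrakk>x \<in> vcarrier V; y \<in> vcarrier V\<rbrakk> \<Longrightarrow> L (vadd V x y) = vadd W (L x) (L y)"
    and hom_scale: "x \<in> vcarrier V \<Longrightarrow> L (vscale V a x) = vscale W a (L x)"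
    and hom_abs: "x \<in> vcarrier V \<Longrightarrow> vabs W (L x) = L (vabs V x)"

text \<open>
  The distance of the norm \<open>N\<close>. It is cut off outside the carrier because the locale
  \<^locale>\<open>Metric_space\<close> asks for symmetry and nonnegativity on the whole type.
\<close>

definition vdist :: "('v, 'm) ovs_scheme \<Rightarrow> ('v \<Rightarrow> real) \<Rightarrow> 'v \<Rightarrow> 'v \<Rightarrow> real" where
  "vdist V N x y = (if x \<in> vcarrier V \<and> y \<in> vcarrier V then N (vdiff V x y) else 0)"

locale banach_lattice = vector_lattice V
  for V :: "('v, 'm) ovs_scheme" and N :: "'v \<Rightarrow> real" +
  assumes norm_nonneg: "x \<in> vcarrier V \<Longrightarrow> 0 \<le> N x"
    and norm_eq_zero: "x \<in> vcarrier V \<Longrightarrow> N x = 0 \<longleftrightarrow> x = vzero V"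
    and norm_scale: "x \<in> vcarrier V \<Longrightarrow> N (vscale V a x) = \<bar>a\<bar> * N x"
    and norm_triangle: "\<lbrakk>x \<in> vcarrier V; y \<in> vcarrier V\<rbrakk> \<Longrightarrow> N (vadd V x y) \<le> N x + N y"
    and norm_mono: "\<lbrakk>x \<in> vcarrier V; y \<in> vcarrier V; vle V (vabs V x) (vabs V y)\<rbrakk> \<Longrightarrow> N x \<le> N y"
    and complete: "Metric_space.mcomplete (vcarrier V) (vdist V N)"

definition norm_dense :: "('v, 'm) ovs_scheme \<Rightarrow> ('v \<Rightarrow> real) \<Rightarrow> 'v set \<Rightarrow> bool" where
  "norm_dense V N D \<longleftrightarrow> D \<subseteq> vcarrier V \<and>
     Metric_space.mtopology (vcarrier V) (vdist V N) closure_of D = vcarrier V"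

definition order_bounded :: "('v, 'm) ovs_scheme \<Rightarrow> 'v set \<Rightarrow> bool" where
  "order_bounded V A \<longleftrightarrow>
     (\<exists>a\<in>vcarrier V. \<exists>b\<in>vcarrier V. A \<subseteq> {x \<in> vcarrier V. vle V a x \<and> vle V x b})"

text \<open>
  Functionals on the carrier are represented by extensional functions (\<^const>\<open>undefined\<close>
  off the carrier), so that equality of functionals is equality of functions.
\<close>

definition order_dual :: "('v, 'm) ovs_scheme \<Rightarrow> ('v \<Rightarrow> real) ovs" where
  "order_dual V =
     \<lparr>vcarrier = {\<phi> \<in> extensional (vcarrier V).
         (\<forall>f\<in>vcarrier V. \<forall>g\<in>vcarrier V. \<phi> (vadd V f g) = \<phi> f + \<phi> g) \<and>
         (\<forall>a. \<forall>f\<in>vcarrier V. \<phi> (vscale V a f) = a * \<phi> f) \<and>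
         (\<forall>A. order_bounded V A \<longrightarrow> (\<exists>a b. \<phi> ` A \<subseteq> {a..b}))},
      vzero = (\<lambda>f\<in>vcarrier V. 0),
      vadd = (\<lambda>\<phi> \<psi>. \<lambda>f\<in>vcarrier V. \<phi> f + \<psi> f),
      vscale = (\<lambda>a \<phi>. \<lambda>f\<in>vcarrier V. a * \<phi> f),
      vle = (\<lambda>\<phi> \<psi>. \<forall>f\<in>vcarrier V. vle V (vzero V) f \<longrightarrow> \<phi> f \<le> \<psi> f)\<rparr>"

section \<open>Continuous functions with compact support\<close>

definition fsupp :: "('a::topological_space \<Rightarrow> real) \<Rightarrow> 'a set" where
  "fsupp f = closure {x. f x \<noteq> 0}"

definition Cc :: "('a::topological_space \<Rightarrow> real) ovs" where
  "Cc = \<lparr>vcarrier = {f. continuous_on UNIV f \<and> compact (fsupp f)},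
         vzero = (\<lambda>x. 0),
         vadd = (\<lambda>f g x. f x + g x),
         vscale = (\<lambda>a f x. a * f x),
         vle = (\<lambda>f g. \<forall>x. f x \<le> g x)\<rparr>"

abbreviation Cc_dual :: "(('a::topological_space \<Rightarrow> real) \<Rightarrow> real) ovs" where
  "Cc_dual \<equiv> order_dual Cc"

definition vanishes_on :: "(('a::topological_space \<Rightarrow> real) \<Rightarrow> real) \<Rightarrow> 'a set \<Rightarrow> bool" where
  "vanishes_on \<phi> U \<longleftrightarrow> (\<forall>f\<in>vcarrier Cc. fsupp f \<subseteq> U \<longrightarrow> \<phi> f = 0)"

definition dsupp :: "(('a::topological_space \<Rightarrow> real) \<Rightarrow> real) \<Rightarrow> 'a set" where
  "dsupp \<phi> = - \<Union> {U. open U \<and> vanishes_on \<phi> U}"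

section \<open>Regular Borel measures, positive and signed\<close>

text \<open>
  The measures live on a subset \<open>S\<close> with its relative topology and Borel sets; the case
  \<open>S = UNIV\<close> gives measures on the whole space.
\<close>

abbreviation borel_sets_on :: "'a::topological_space set \<Rightarrow> 'a set set" where
  "borel_sets_on S \<equiv> sets (restrict_space borel S)"

definition regular_borel_measure :: "'a::topological_space set \<Rightarrow> 'a measure \<Rightarrow> bool" where
  "regular_borel_measure S M \<longleftrightarrow>
     sets M = borel_sets_on S \<and>
     (\<forall>K. compact K \<and> K \<subseteq> S \<longrightarrow> emeasure M K < \<infinity>) \<and>
     (\<forall>A\<in>borel_sets_on S.
        emeasure M A = (INF V\<in>{V. openin (top_of_set S) V \<and> A \<subseteq> V}. emeasure M V)) \<and>
     (\<forall>V. openin (top_of_set S) V \<longrightarrow>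
        emeasure M V = (SUP K\<in>{K. compact K \<and> K \<subseteq> V}. emeasure M K))"

text \<open>
  A finite signed measure is a real-valued countably additive set function \<open>\<nu>\<close>. In the
  supremum defining its positive variation, \<^const>\<open>ennreal\<close> sends negative values to \<open>0\<close>; this
  is harmless since the empty set competes.
\<close>

definition pos_variation :: "'a::topological_space set \<Rightarrow> ('a set \<Rightarrow> real) \<Rightarrow> 'a measure" where
  "pos_variation S \<nu> = measure_of S (borel_sets_on S)
     (\<lambda>A. SUP B\<in>{B \<in> borel_sets_on S. B \<subseteq> A}. ennreal (\<nu> B))"

definition neg_variation :: "'a::topological_space set \<Rightarrow> ('a set \<Rightarrow> real) \<Rightarrow> 'a measure" where
  "neg_variation S \<nu> = pos_variation S (\<lambda>A. - \<nu> A)"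

text \<open>
  Extensionality off the Borel sets makes the uniqueness of a signed measure meaningful as
  equality of functions. Finiteness of the variations is automatic for a real-valued \<open>\<nu>\<close>.
\<close>

definition finite_signed_regular_measure :: "'a::topological_space set \<Rightarrow> ('a set \<Rightarrow> real) \<Rightarrow> bool" where
  "finite_signed_regular_measure S \<nu> \<longleftrightarrow>
     \<nu> \<in> extensional (borel_sets_on S) \<and>
     \<nu> {} = 0 \<and>
     (\<forall>A :: nat \<Rightarrow> 'a set. range A \<subseteq> borel_sets_on S \<and> disjoint_family A \<longrightarrow>
        (\<lambda>n. \<nu> (A n)) sums \<nu> (\<Union>n. A n)) \<and>
     finite_measure (pos_variation S \<nu>) \<and> regular_borel_measure S (pos_variation S \<nu>) \<and>
     finite_measure (neg_variation S \<nu>) \<and> regular_borel_measure S (neg_variation S \<nu>)"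

definition signed_integral :: "'a::topological_space set \<Rightarrow> ('a set \<Rightarrow> real) \<Rightarrow> ('a \<Rightarrow> real) \<Rightarrow> real" where
  "signed_integral S \<nu> f =
     (\<integral>x. f x \<partial>pos_variation S \<nu>) - (\<integral>x. f x \<partial>neg_variation S \<nu>)"

section \<open>Product of a functional with a bounded Borel function\<close>

definition local_measure :: "(('a::topological_space \<Rightarrow> real) \<Rightarrow> real) \<Rightarrow> 'a set \<Rightarrow> 'a set \<Rightarrow> real" where
  "local_measure \<phi> U = (THE \<nu>. finite_signed_regular_measure U \<nu> \<and>
     (\<forall>k\<in>vcarrier Cc. fsupp k \<subseteq> U \<longrightarrow> \<phi> k = signed_integral U \<nu> k))"

definition bounded_mult ::
    "('a::topological_space \<Rightarrow> real) \<Rightarrow> (('a \<Rightarrow> real) \<Rightarrow> real) \<Rightarrow> (('a \<Rightarrow> real) \<Rightarrow> real)" where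
  "bounded_mult h \<phi> = (\<lambda>f\<in>vcarrier Cc.
     let U = (SOME U. U \<noteq> {} \<and> open U \<and> compact (closure U) \<and> fsupp f \<subseteq> U)
     in signed_integral U (local_measure \<phi> U) (\<lambda>x. f x * h x))"

section \<open>The spaces \<open>L^p\<close>\<close>

definition Lp_fun :: "'a measure \<Rightarrow> real \<Rightarrow> ('a \<Rightarrow> real) set" where
  "Lp_fun M p = {g \<in> borel_measurable M. integrable M (\<lambda>x. \<bar>g x\<bar> powr p)}"

definition Lp_class :: "'a measure \<Rightarrow> real \<Rightarrow> ('a \<Rightarrow> real) \<Rightarrow> ('a \<Rightarrow> real) set" where
  "Lp_class M p g = {g' \<in> Lp_fun M p. AE x in M. g' x = g x}"

definition Lp :: "'a measure \<Rightarrow> real \<Rightarrow> ('a \<Rightarrow> real) set ovs" where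
  "Lp M p =
     \<lparr>vcarrier = Lp_class M p ` Lp_fun M p,
      vzero = Lp_class M p (\<lambda>x. 0),
      vadd = (\<lambda>F G. {h \<in> Lp_fun M p. \<exists>f\<in>F. \<exists>g\<in>G. AE x in M. h x = f x + g x}),
      vscale = (\<lambda>a F. {h \<in> Lp_fun M p. \<exists>f\<in>F. AE x in M. h x = a * f x}),
      vle = (\<lambda>F G. \<exists>f\<in>F. \<exists>g\<in>G. AE x in M. f x \<le> g x)\<rparr>"

definition Lp_norm :: "'a measure \<Rightarrow> real \<Rightarrow> ('a \<Rightarrow> real) \<Rightarrow> real" where
  "Lp_norm M p g = (\<integral>x. \<bar>g x\<bar> powr p \<partial>M) powr (1 / p)"

section \<open>The embedding of \<open>L^p\<close> into the order dual\<close>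

definition phi :: "'a::topological_space measure \<Rightarrow> ('a \<Rightarrow> real) \<Rightarrow> (('a \<Rightarrow> real) \<Rightarrow> real)" where
  "phi M g = (\<lambda>f\<in>vcarrier Cc. \<integral>x. f x * g x \<partial>M)"

definition Phi :: "'a::topological_space measure \<Rightarrow> ('a \<Rightarrow> real) set \<Rightarrow> (('a \<Rightarrow> real) \<Rightarrow> real)" where
  "Phi M G = phi M (SOME g. g \<in> G)"

definition Phi_image :: "'a::topological_space measure \<Rightarrow> real \<Rightarrow> (('a \<Rightarrow> real) \<Rightarrow> real) ovs" where
  "Phi_image M p = Cc_dual \<lparr>vcarrier := Phi M ` vcarrier (Lp M p)\<rparr>"

definition Phi_norm :: "'a::topological_space measure \<Rightarrow> real \<Rightarrow> (('a \<Rightarrow> real) \<Rightarrow> real) \<Rightarrow> real" where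
  "Phi_norm M p \<phi> = Lp_norm M p (SOME g. g \<in> Lp_fun M p \<and> phi M g = \<phi>)"

section \<open>\<open>C\<^sub>c\<close> as a vector lattice\<close>

lemma Cc_simps [simp]:
  "f \<in> vcarrier Cc \<longleftrightarrow> continuous_on UNIV f \<and> compact (fsupp f)"
  "vzero Cc = (\<lambda>x. 0)"
  "vadd Cc f g = (\<lambda>x. f x + g x)"
  "vscale Cc a f = (\<lambda>x. a * f x)"
  "vle Cc f g \<longleftrightarrow> (\<forall>x. f x \<le> g x)"
  "vminus Cc f = (\<lambda>x. - f x)"
  by (auto simp: Cc_def vminus_def)

lemma compact_fsupp_combine:
  fixes f g h :: "'a::t2_space \<Rightarrow> real"
  assumes "compact (fsupp f)" "compact (fsupp g)"
    and "\<And>x. f x = 0 \<Longrightarrow> g x = 0 \<Longrightarrow> h x = 0"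
  shows "compact (fsupp h)"
proof -
  have "{x. h x \<noteq> 0} \<subseteq> {x. f x \<noteq> 0} \<union> {x. g x \<noteq> 0}"
    using assms(3) by blast
  then have "fsupp h \<subseteq> fsupp f \<union> fsupp g"
    unfolding fsupp_def closure_Un[symmetric] by (rule closure_mono)
  moreover have "compact (fsupp f \<union> fsupp g)"
    using assms by blast
  moreover have "closed (fsupp h)"
    by (simp add: fsupp_def)
  ultimately show ?thesis
    by (metis compact_Int_closed inf.absorb_iff2)
qed

lemma Cc_sup:
  fixes f g :: "'a::t2_space \<Rightarrow> real"
  assumes "f \<in> vcarrier Cc" "g \<in> vcarrier Cc"
  shows "is_sup_in Cc {f, g} (\<lambda>x. max (f x) (g x))"
  using assms
  by (auto simp: is_sup_in_def intro!: continuous_intros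
      intro: compact_fsupp_combine[of f g])

lemma Cc_inf:
  fixes f g :: "'a::t2_space \<Rightarrow> real"
  assumes "f \<in> vcarrier Cc" "g \<in> vcarrier Cc"
  shows "is_inf_in Cc {f, g} (\<lambda>x. min (f x) (g x))"
  using assms
  by (auto simp: is_inf_in_def intro!: continuous_intros
      intro: compact_fsupp_combine[of f g])

lemma vector_lattice_Cc: "vector_lattice (Cc :: ('a::t2_space \<Rightarrow> real) ovs)"
proof
  fix f g :: "'a \<Rightarrow> real"
  assume fg: "f \<in> vcarrier Cc" "g \<in> vcarrier Cc"
  show "vadd Cc f g \<in> vcarrier Cc"
    using fg by (auto intro!: continuous_intros intro: compact_fsupp_combine[of f g])
  show "\<exists>s. is_sup_in Cc {f, g} s" "\<exists>s. is_inf_in Cc {f, g} s"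
    using Cc_sup[OF fg] Cc_inf[OF fg] by blast+
next
  fix f :: "'a \<Rightarrow> real" and a
  assume "f \<in> vcarrier Cc"
  then show "vscale Cc a f \<in> vcarrier Cc"
    by (auto intro!: continuous_intros intro: compact_fsupp_combine[of f f])
qed (auto simp: fsupp_def algebra_simps fun_eq_iff intro: antisym order_trans mult_left_mono)

lemma vsup_Cc:
  fixes f g :: "'a::t2_space \<Rightarrow> real"
  assumes "f \<in> vcarrier Cc" "g \<in> vcarrier Cc"
  shows "vsup Cc f g = (\<lambda>x. max (f x) (g x))"
  unfolding vsup_def
proof (rule the_equality)
  show "is_sup_in Cc {f, g} (\<lambda>x. max (f x) (g x))"
    by (rule Cc_sup[OF assms])
next
  fix s
  assume s: "is_sup_in Cc {f, g} s"
  interpret vector_lattice "Cc :: ('a \<Rightarrow> real) ovs"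
    by (rule vector_lattice_Cc)
  show "s = (\<lambda>x. max (f x) (g x))"
    using s Cc_sup[OF assms] unfolding is_sup_in_def by (intro le_antisym) blast+
qed

end

theory Submission
  imports Defs
begin

text \<open>
  Everything about \<open>\<Phi>\<close> rests on one approximation: by regularity, the indicator of a Borel set of
  finite measure is the almost everywhere limit of functions in \<open>C\<^sub>c\<close> with values in \<open>[0, 1]\<close>.
  Splitting a positive test function \<open>k\<close> along such functions for the set \<open>{f > g}\<close> shows that every
  upper bound of \<open>\<phi>\<^sub>f\<close> and \<open>\<phi>\<^sub>g\<close> dominates \<open>\<phi>\<close> of \<open>max f g\<close>. Hence \<open>\<Phi>\<close> preserves suprema, and taking
  \<open>\<phi>\<^sub>g\<close> itself as the upper bound shows that \<open>\<Phi>\<close> reflects the order; in particular it is injective.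
  The image is therefore an isomorphic copy of \<open>L^p\<close> and inherits completeness. No
  \<open>\<sigma>\<close>-finiteness is available for Dedekind completeness; instead, among the functions
  below every upper bound of the given set one takes a sequence that increases to a function at minimal
  \<open>L^p\<close> distance from a fixed upper bound.
  The measure representing \<open>\<phi>\<^sub>g\<close> on an open relatively compact set is \<open>g \<mu>\<close>, by uniqueness. For density,
  a continuous \<open>g\<close> is replaced by its soft threshold \<open>(g - d)\<^sup>+ - (- g - d)\<^sup>+\<close>, whose positive and negative
  parts have disjoint supports.
\<close>

section \<open>\<open>L^p\<close> functions\<close>

text \<open>Inner regularity is assumed for open sets only, so approximation by compact sets from
  inside has to be earned for Borel sets of finite measure. It is applied only to such sets: level
  sets of p-integrable functions, subsets of a compact support, subsets of a relatively compact open
  set. A supremum in the order dual has to lie below every upper bound in the dual, not just below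
  those of the form \<open>phi M h\<close>. Therefore the splitting argument runs against an
  arbitrary upper bound, and the dual itself is shown to be a lattice. The product with a bounded
  Borel function goes through a description (\<open>THE\<close>) of a signed measure whose
  variations are suprema over Borel subsets. Computing it for \<open>phi M g\<close> takes three
  facts: these suprema are measures, their difference returns the signed measure, and for
  \<open>g \<mu>\<close> they are the measures with densities given by the positive and negative
  part of \<open>g\<close>. Uniqueness becomes a statement about positive measures once each
  negative variation is moved to the other side of the equation.\<close>

lemma powr_add_le:
  fixes a b p :: real
  assumes "0 \<le> a" "0 \<le> b" "0 \<le> p"
  shows "(a + b) powr p \<le> 2 powr p * (a powr p + b powr p)"
proof -
  have "(a + b) powr p \<le> (2 * max a b) powr p"
    using assms by (intro powr_mono2) auto
  also have "\<dots> = 2 powr p * max a b powr p"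
    using assms by (simp add: powr_mult)
  also have "\<dots> \<le> 2 powr p * (a powr p + b powr p)"
    by (intro mult_left_mono) (auto simp: max_def)
  finally show ?thesis .
qed

text \<open>For positive arguments this is convexity of the power. If one argument is 0, it reduces
  to \<open>c powr p \<le> c\<close> for c in [0, 1]; these cases occur because the functions in
  Minkowski's inequality may have zeros.\<close>

lemma powr_convex_nonneg:
  fixes x y s t p :: real
  assumes "0 \<le> x" "0 \<le> y" "0 \<le> s" "0 \<le> t" "s + t = 1" "1 \<le> p"
  shows "(s * x + t * y) powr p \<le> s * x powr p + t * y powr p"
proof -
  have le: "c powr p \<le> c" if "0 \<le> c" "c \<le> 1" for c :: real
    using powr_mono'[of 1 p c] that assms(6) by simp
  consider "x = 0" | "y = 0" | "0 < x" "0 < y"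
    using assms by fastforce
  then show ?thesis
  proof cases
    case 1
    then show ?thesis
      using assms le[of t] by (simp add: powr_mult mult_right_mono)
  next
    case 2
    then show ?thesis
      using assms le[of s] by (simp add: powr_mult mult_right_mono)
  next
    case 3
    then have "((1 - t) * x + t * y) powr p \<le> (1 - t) * x powr p + t * y powr p"
      using convex_onD[OF powr_convex[OF assms(6)], of t x y] assms by simp
    moreover have "1 - t = s"
      using assms by simp
    ultimately show ?thesis
      by simp
  qed
qed

section \<open>Linear and lattice operations on p-integrable functions\<close>

lemma Lp_funD:
  assumes "g \<in> Lp_fun M p"
  shows Lp_fun_measurable: "g \<in> borel_measurable M"
    and Lp_fun_integrable: "integrable M (\<lambda>x. \<bar>g x\<bar> powr p)"
  using assms by (auto simp: Lp_fun_def)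

lemma Lp_fun_bound:
  assumes g: "g \<in> Lp_fun M p" and f: "f \<in> borel_measurable M"
    and le: "AE x in M. \<bar>f x\<bar> \<le> \<bar>g x\<bar>" and p: "0 \<le> p"
  shows "f \<in> Lp_fun M p"
proof -
  note [measurable] = f
  have "integrable M (\<lambda>x. \<bar>f x\<bar> powr p)"
    using Lp_fun_integrable[OF g]
    by (rule Bochner_Integration.integrable_bound) (use le p in \<open>auto intro!: powr_mono2\<close>)
  then show ?thesis
    using f by (simp add: Lp_fun_def)
qed

lemma Lp_fun_zero: "(\<lambda>x. 0) \<in> Lp_fun M p"
  by (simp add: Lp_fun_def)

lemma Lp_fun_scale:
  assumes "g \<in> Lp_fun M p"
  shows "(\<lambda>x. a * g x) \<in> Lp_fun M p"
  using assms by (auto simp: Lp_fun_def abs_mult powr_mult)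

lemma Lp_fun_uminus: "g \<in> Lp_fun M p \<Longrightarrow> (\<lambda>x. - g x) \<in> Lp_fun M p"
  by (simp add: Lp_fun_def)

lemma Lp_fun_abs: "g \<in> Lp_fun M p \<Longrightarrow> (\<lambda>x. \<bar>g x\<bar>) \<in> Lp_fun M p"
  by (auto simp: Lp_fun_def)

lemma Lp_fun_add:
  assumes f: "f \<in> Lp_fun M p" and g: "g \<in> Lp_fun M p" and p: "0 \<le> p"
  shows "(\<lambda>x. f x + g x) \<in> Lp_fun M p"
proof -
  note [measurable] = Lp_fun_measurable[OF f] Lp_fun_measurable[OF g]
  have "integrable M (\<lambda>x. 2 powr p * (\<bar>f x\<bar> powr p + \<bar>g x\<bar> powr p))"
    using Lp_fun_integrable[OF f] Lp_fun_integrable[OF g] by simp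
  then have "integrable M (\<lambda>x. \<bar>f x + g x\<bar> powr p)"
  proof (rule Bochner_Integration.integrable_bound)
    show "AE x in M. norm (\<bar>f x + g x\<bar> powr p) \<le> norm (2 powr p * (\<bar>f x\<bar> powr p + \<bar>g x\<bar> powr p))"
    proof (rule AE_I2)
      fix x
      have "\<bar>f x + g x\<bar> powr p \<le> (\<bar>f x\<bar> + \<bar>g x\<bar>) powr p"
        using p by (intro powr_mono2) auto
      also have "\<dots> \<le> 2 powr p * (\<bar>f x\<bar> powr p + \<bar>g x\<bar> powr p)"
        using p by (intro powr_add_le) auto
      finally show "norm (\<bar>f x + g x\<bar> powr p) \<le> norm (2 powr p * (\<bar>f x\<bar> powr p + \<bar>g x\<bar> powr p))"
        by simp
    qed
  qed simp
  then show ?thesis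
    by (simp add: Lp_fun_def)
qed

lemma Lp_fun_diff:
  assumes "f \<in> Lp_fun M p" "g \<in> Lp_fun M p" "0 \<le> p"
  shows "(\<lambda>x. f x - g x) \<in> Lp_fun M p"
  using Lp_fun_add[OF assms(1) Lp_fun_uminus[OF assms(2)] assms(3)] by simp

lemma Lp_fun_max:
  assumes f: "f \<in> Lp_fun M p" and g: "g \<in> Lp_fun M p" and p: "0 \<le> p"
  shows "(\<lambda>x. max (f x) (g x)) \<in> Lp_fun M p"
proof (rule Lp_fun_bound[OF Lp_fun_add[OF Lp_fun_abs[OF f] Lp_fun_abs[OF g] p]])
  show "(\<lambda>x. max (f x) (g x)) \<in> borel_measurable M"
    using Lp_fun_measurable[OF f] Lp_fun_measurable[OF g] by simp
qed (use p in auto)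

lemma Lp_fun_min:
  assumes f: "f \<in> Lp_fun M p" and g: "g \<in> Lp_fun M p" and p: "0 \<le> p"
  shows "(\<lambda>x. min (f x) (g x)) \<in> Lp_fun M p"
proof (rule Lp_fun_bound[OF Lp_fun_add[OF Lp_fun_abs[OF f] Lp_fun_abs[OF g] p]])
  show "(\<lambda>x. min (f x) (g x)) \<in> borel_measurable M"
    using Lp_fun_measurable[OF f] Lp_fun_measurable[OF g] by simp
qed (use p in auto)

section \<open>The L^p seminorm, Minkowski's inequality and completeness\<close>

lemma Lp_norm_nonneg: "0 \<le> Lp_norm M p g"
  by (simp add: Lp_norm_def)

lemma Lp_norm_powr: "0 < p \<Longrightarrow> Lp_norm M p g powr p = (\<integral>x. \<bar>g x\<bar> powr p \<partial>M)"
  by (simp add: Lp_norm_def powr_powr)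

lemma Lp_norm_le_iff:
  assumes "0 < p" "0 \<le> c"
  shows "Lp_norm M p g \<le> c \<longleftrightarrow> (\<integral>x. \<bar>g x\<bar> powr p \<partial>M) \<le> c powr p"
  unfolding Lp_norm_powr[OF assms(1), symmetric]
  using assms powr_less_mono2[of p c "Lp_norm M p g"] powr_mono2[of p "Lp_norm M p g" c]
    Lp_norm_nonneg[of M p g] by fastforce

lemma Lp_norm_less_iff:
  assumes "0 < p" "0 \<le> c"
  shows "Lp_norm M p g < c \<longleftrightarrow> (\<integral>x. \<bar>g x\<bar> powr p \<partial>M) < c powr p"
  unfolding Lp_norm_powr[OF assms(1), symmetric]
  using assms powr_less_mono2[of p "Lp_norm M p g" c] powr_mono2[of p c "Lp_norm M p g"]
    Lp_norm_nonneg[of M p g] by fastforce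

lemma Lp_norm_cong_AE:
  assumes "f \<in> Lp_fun M p" "g \<in> Lp_fun M p" "AE x in M. f x = g x"
  shows "Lp_norm M p f = Lp_norm M p g"
  unfolding Lp_norm_def
  using assms by (intro arg_cong2[where f="(powr)"] integral_cong_AE) (auto simp: Lp_fun_def)

lemma Lp_norm_mono:
  assumes "f \<in> Lp_fun M p" "g \<in> Lp_fun M p" "AE x in M. \<bar>f x\<bar> \<le> \<bar>g x\<bar>" "0 < p"
  shows "Lp_norm M p f \<le> Lp_norm M p g"
  unfolding Lp_norm_def
  using assms
  by (intro powr_mono2 integral_mono_AE) (auto simp: Lp_fun_def intro!: powr_mono2)

lemma Lp_norm_eq_0_iff:
  assumes "g \<in> Lp_fun M p"
  shows "Lp_norm M p g = 0 \<longleftrightarrow> (AE x in M. g x = 0)"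
  unfolding Lp_norm_def
  using integral_nonneg_eq_0_iff_AE[OF Lp_fun_integrable[OF assms]] by auto

lemma Lp_norm_scale:
  assumes "0 < p"
  shows "Lp_norm M p (\<lambda>x. a * g x) = \<bar>a\<bar> * Lp_norm M p g"
  using assms by (simp add: Lp_norm_def abs_mult powr_mult powr_powr)

lemma Lp_norm_minus_commute: "Lp_norm M p (\<lambda>x. f x - g x) = Lp_norm M p (\<lambda>x. g x - f x)"
  by (simp add: Lp_norm_def abs_minus_commute)

text \<open>With both functions scaled to norm 1, |f| + |g| is \<open>a + b\<close> times a convex
  combination of |f| / a and |g| / b, and convexity of the p-th power can be integrated. A function
  of norm 0 vanishes almost everywhere and drops out.\<close>

theorem Minkowski_inequality:
  assumes f: "f \<in> Lp_fun M p" and g: "g \<in> Lp_fun M p" and p: "1 \<le> p"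
  shows "Lp_norm M p (\<lambda>x. f x + g x) \<le> Lp_norm M p f + Lp_norm M p g"
proof -
  define a b where "a = Lp_norm M p f" and "b = Lp_norm M p g"
  have nn: "0 \<le> a" "0 \<le> b"
    by (simp_all add: a_def b_def Lp_norm_nonneg)
  have fg: "(\<lambda>x. f x + g x) \<in> Lp_fun M p"
    using f g p by (simp add: Lp_fun_add)
  consider "a = 0" | "b = 0" | "0 < a" "0 < b"
    using nn by fastforce
  then show ?thesis
  proof cases
    case 1
    then have "AE x in M. f x = 0"
      using Lp_norm_eq_0_iff[OF f] by (simp add: a_def)
    then have "Lp_norm M p (\<lambda>x. f x + g x) = Lp_norm M p g"
      by (intro Lp_norm_cong_AE[OF fg g]) auto
    then show ?thesis
      using nn by (simp add: a_def)
  next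
    case 2
    then have "AE x in M. g x = 0"
      using Lp_norm_eq_0_iff[OF g] by (simp add: b_def)
    then have "Lp_norm M p (\<lambda>x. f x + g x) = Lp_norm M p f"
      by (intro Lp_norm_cong_AE[OF fg f]) auto
    then show ?thesis
      using nn by (simp add: b_def)
  next
    case 3
    define s t where "s = a / (a + b)" and "t = b / (a + b)"
    have st: "0 \<le> s" "0 \<le> t" "s + t = 1"
      using 3 by (auto simp: s_def t_def add_divide_distrib[symmetric])
    let ?h = "\<lambda>x. (a + b) powr p * (s * (\<bar>f x\<bar> powr p / a powr p) + t * (\<bar>g x\<bar> powr p / b powr p))"
    have pw: "\<bar>f x + g x\<bar> powr p \<le> ?h x" for x
    proof -
      have "(a + b) * s = a" "(a + b) * t = b"
        using 3 by (simp_all add: s_def t_def)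
      then have "\<bar>f x\<bar> + \<bar>g x\<bar> = (a + b) * (s * (\<bar>f x\<bar> / a) + t * (\<bar>g x\<bar> / b))"
        using 3 by (simp add: distrib_left mult.assoc[symmetric])
      then have "(\<bar>f x\<bar> + \<bar>g x\<bar>) powr p = (a + b) powr p * (s * (\<bar>f x\<bar> / a) + t * (\<bar>g x\<bar> / b)) powr p"
        using 3 st by (simp add: powr_mult)
      also have "(s * (\<bar>f x\<bar> / a) + t * (\<bar>g x\<bar> / b)) powr p
          \<le> s * (\<bar>f x\<bar> / a) powr p + t * (\<bar>g x\<bar> / b) powr p"
        using st 3 by (intro powr_convex_nonneg p) auto
      finally have "(\<bar>f x\<bar> + \<bar>g x\<bar>) powr p \<le> ?h x"
        using 3 by (simp add: powr_divide mult_left_mono)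
      moreover have "\<bar>f x + g x\<bar> powr p \<le> (\<bar>f x\<bar> + \<bar>g x\<bar>) powr p"
        using p by (intro powr_mono2) auto
      ultimately show ?thesis
        by linarith
    qed
    have "(\<integral>x. \<bar>f x + g x\<bar> powr p \<partial>M) \<le> (\<integral>x. ?h x \<partial>M)"
      using Lp_fun_integrable[OF fg] Lp_fun_integrable[OF f] Lp_fun_integrable[OF g] pw
      by (intro integral_mono) auto
    also have "\<dots> = (a + b) powr p * (s * (a powr p / a powr p) + t * (b powr p / b powr p))"
      using Lp_fun_integrable[OF f] Lp_fun_integrable[OF g] p
      by (simp add: a_def b_def Lp_norm_powr)
    also have "\<dots> = (a + b) powr p"
      using 3 st by simp
    finally have "Lp_norm M p (\<lambda>x. f x + g x) \<le> a + b"
      using nn p by (subst Lp_norm_le_iff) auto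
    then show ?thesis
      by (simp add: a_def b_def)
  qed
qed

lemma Lp_norm_diff_triangle:
  assumes "f \<in> Lp_fun M p" "g \<in> Lp_fun M p" "h \<in> Lp_fun M p" "1 \<le> p"
  shows "Lp_norm M p (\<lambda>x. f x - h x) \<le> Lp_norm M p (\<lambda>x. f x - g x) + Lp_norm M p (\<lambda>x. g x - h x)"
  using Minkowski_inequality[of "\<lambda>x. f x - g x" M p "\<lambda>x. g x - h x"] assms
  by (simp add: Lp_fun_diff)

lemma Lp_norm_dominated_convergence:
  assumes u: "u \<in> Lp_fun M p" and f: "\<And>n. f n \<in> borel_measurable M" "g \<in> borel_measurable M"
    and lim: "AE x in M. (\<lambda>n. f n x) \<longlonglongrightarrow> g x"
    and bd: "\<And>n. AE x in M. \<bar>f n x - g x\<bar> \<le> \<bar>u x\<bar>" and p: "0 < p"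
  shows "(\<lambda>n. \<integral>x. \<bar>f n x - g x\<bar> powr p \<partial>M) \<longlonglongrightarrow> 0"
proof -
  note [measurable] = f
  have "(\<lambda>n. \<integral>x. \<bar>f n x - g x\<bar> powr p \<partial>M) \<longlonglongrightarrow> (\<integral>x. 0 \<partial>M)"
  proof (rule integral_dominated_convergence[OF _ _ Lp_fun_integrable[OF u]])
    show "AE x in M. (\<lambda>n. \<bar>f n x - g x\<bar> powr p) \<longlonglongrightarrow> 0"
      using lim
    proof eventually_elim
      case (elim x)
      then have "(\<lambda>n. \<bar>f n x - g x\<bar>) \<longlonglongrightarrow> 0"
        by (simp add: LIM_zero tendsto_rabs_zero)
      then show ?case
        using p by (intro tendsto_zero_powrI[where b=p]) auto
    qed
    show "AE x in M. norm (\<bar>f n x - g x\<bar> powr p) \<le> \<bar>u x\<bar> powr p" for n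
      using bd[of n] p by (auto intro!: powr_mono2)
  qed auto
  then show ?thesis
    by simp
qed

text \<open>A subsequence with geometrically small gaps converges almost everywhere. Fatou's lemma
  turns the Cauchy bound into a bound on the distance to that limit, which gives convergence of the
  whole sequence.\<close>

theorem Riesz_Fischer:
  assumes f: "\<And>n. f n \<in> Lp_fun M p" and p: "1 \<le> p"
    and cauchy: "\<And>e. 0 < e \<Longrightarrow> \<exists>N. \<forall>m\<ge>N. \<forall>n\<ge>N. Lp_norm M p (\<lambda>x. f m x - f n x) < e"
  shows "\<exists>g\<in>Lp_fun M p. (\<lambda>n. Lp_norm M p (\<lambda>x. f n x - g x)) \<longlonglongrightarrow> 0"
proof -
  have [measurable]: "f n \<in> borel_measurable M" for n
    using f by (rule Lp_fun_measurable)
  have diff: "(\<lambda>x. f m x - f n x) \<in> Lp_fun M p" for m n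
    using f f p by (intro Lp_fun_diff) auto
  have nn_eq: "(\<integral>\<^sup>+x. ennreal (\<bar>f m x - f n x\<bar> powr p) \<partial>M)
      = ennreal (Lp_norm M p (\<lambda>x. f m x - f n x) powr p)" for m n
    using p Lp_fun_integrable[OF diff] by (simp add: Lp_norm_powr nn_integral_eq_integral)
  \<comment> \<open>The rate 1/4 leaves room for the weight \<open>2 ^ k\<close> below: the weighted
    gaps still decay like \<open>(1/2) ^ k\<close>.\<close>
  have "\<exists>N. \<forall>m\<ge>N. \<forall>n\<ge>N. Lp_norm M p (\<lambda>x. f m x - f n x) < (1/4) ^ k" for k :: nat
    by (rule cauchy) simp
  then obtain N where N: "\<And>k m n. N k \<le> m \<Longrightarrow> N k \<le> n \<Longrightarrow>
      Lp_norm M p (\<lambda>x. f m x - f n x) < (1/4) ^ k"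
    by metis
  \<comment> \<open>The sum makes \<open>r\<close> monotone and at least \<open>N k\<close>; the
    summand \<open>k\<close> makes it unbounded.\<close>
  define r where "r k = (\<Sum>i\<le>k. N i) + k" for k
  have r_ge: "N k \<le> r k" for k
    unfolding r_def by (rule trans_le_add1, rule member_le_sum) auto
  have r_mono: "r k \<le> r (Suc k)" for k
    by (simp add: r_def)
  have r_mono': "r k \<le> r l" if "k \<le> l" for k l
    using r_mono that by (rule lift_Suc_mono_le)
  define D where "D k x = \<bar>f (r (Suc k)) x - f (r k) x\<bar>" for k x
  have [measurable]: "D k \<in> borel_measurable M" for k
    unfolding D_def by measurable
  have "(\<integral>\<^sup>+x. ennreal ((2 ^ k * D k x) powr p) \<partial>M) \<le> ennreal ((1/2) ^ k)" for k
  proof -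
    have nN: "Lp_norm M p (\<lambda>x. f (r (Suc k)) x - f (r k) x) \<le> (1/4) ^ k"
      using N[of k "r (Suc k)" "r k"] r_ge[of k] r_mono[of k] by simp
    have "(\<integral>\<^sup>+x. ennreal ((2 ^ k * D k x) powr p) \<partial>M)
        = (\<integral>\<^sup>+x. ennreal ((2 ^ k) powr p) * ennreal (\<bar>f (r (Suc k)) x - f (r k) x\<bar> powr p) \<partial>M)"
      by (simp add: D_def powr_mult ennreal_mult)
    also have "\<dots> = ennreal ((2 ^ k) powr p * Lp_norm M p (\<lambda>x. f (r (Suc k)) x - f (r k) x) powr p)"
      by (subst nn_integral_cmult) (auto simp: nn_eq ennreal_mult)
    also have "\<dots> \<le> ennreal ((2 ^ k) powr p * ((1/4) ^ k) powr p)"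
      using p nN by (intro ennreal_leI mult_left_mono powr_mono2) (auto simp: Lp_norm_nonneg)
    also have "(2 ^ k) powr p * ((1/4) ^ k) powr p = ((1/2) ^ k) powr p"
      by (simp add: powr_mult[symmetric] power_mult_distrib[symmetric])
    also have "\<dots> \<le> ((1/2) ^ k) powr 1"
      using p by (intro powr_mono') (auto simp: power_le_one)
    finally show ?thesis
      by (simp add: ennreal_leI order_subst1)
  qed
  then have "(\<Sum>k. \<integral>\<^sup>+x. ennreal ((2 ^ k * D k x) powr p) \<partial>M) \<le> (\<Sum>k. ennreal ((1/2) ^ k))"
    by (intro suminf_le) auto
  also have "\<dots> < \<infinity>"
    by (subst suminf_ennreal2) (auto intro: summable_geometric)
  finally have "(\<integral>\<^sup>+x. (\<Sum>k. ennreal ((2 ^ k * D k x) powr p)) \<partial>M) < \<infinity>"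
    by (subst nn_integral_suminf) auto
  then have "AE x in M. (\<Sum>k. ennreal ((2 ^ k * D k x) powr p)) \<noteq> \<infinity>"
    by (intro nn_integral_PInf_AE) auto
  \<comment> \<open>Where the series is finite its terms tend to 0, so
    \<open>2 ^ k * D k x \<le> 1\<close> eventually, and the telescoping gaps are dominated by a
    geometric series.\<close>
  then have conv: "AE x in M. convergent (\<lambda>k. f (r k) x)"
  proof eventually_elim
    case (elim x)
    have "summable (\<lambda>k. (2 ^ k * D k x) powr p)"
      using elim by (intro summable_suminf_not_top) auto
    then have "(\<lambda>k. (2 ^ k * D k x) powr p) \<longlonglongrightarrow> 0"
      by (rule summable_LIMSEQ_zero)
    then have "\<forall>\<^sub>F k in sequentially. (2 ^ k * D k x) powr p < 1"
      by (rule order_tendstoD) simp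
    then have "\<forall>\<^sub>F k in sequentially. norm (f (r (Suc k)) x - f (r k) x) \<le> (1/2) ^ k"
    proof eventually_elim
      case (elim k)
      have "2 ^ k * D k x \<le> 1"
      proof (rule ccontr)
        assume "\<not> 2 ^ k * D k x \<le> 1"
        then have "1 powr p \<le> (2 ^ k * D k x) powr p"
          using p by (intro powr_mono2) auto
        then show False
          using elim by simp
      qed
      then show ?case
        by (simp add: D_def power_one_over field_simps)
    qed
    then have "summable (\<lambda>k. f (r (Suc k)) x - f (r k) x)"
      by (rule summable_comparison_test_ev) (simp add: summable_geometric)
    then have "convergent (\<lambda>n. (f (r n) x - f (r 0) x) + f (r 0) x)"
      by (intro convergent_add)
        (auto simp: summable_iff_convergent sum_lessThan_telescope[of "\<lambda>k. f (r k) x"] convergent_const)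
    then show ?case
      by simp
  qed
  define g where "g x = lim (\<lambda>k. f (r k) x)" for x
  have [measurable]: "g \<in> borel_measurable M"
    unfolding g_def by (rule borel_measurable_lim_metric) simp
  have lim: "AE x in M. (\<lambda>k. f (r k) x) \<longlonglongrightarrow> g x"
    using conv by (simp add: g_def convergent_LIMSEQ_iff)
  have fatou: "(\<integral>\<^sup>+x. ennreal (\<bar>f n x - g x\<bar> powr p) \<partial>M) \<le> ennreal (e powr p)"
    if "\<forall>m\<ge>K. Lp_norm M p (\<lambda>x. f n x - f m x) < e" for n K e
  proof -
    have "(\<integral>\<^sup>+x. ennreal (\<bar>f n x - g x\<bar> powr p) \<partial>M)
        = (\<integral>\<^sup>+x. liminf (\<lambda>k. ennreal (\<bar>f n x - f (r k) x\<bar> powr p)) \<partial>M)"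
    proof (rule nn_integral_cong_AE)
      show "AE x in M. ennreal (\<bar>f n x - g x\<bar> powr p)
          = liminf (\<lambda>k. ennreal (\<bar>f n x - f (r k) x\<bar> powr p))"
        using lim
      proof eventually_elim
        case (elim x)
        have "(\<lambda>k. ennreal (\<bar>f n x - f (r k) x\<bar> powr p)) \<longlonglongrightarrow> ennreal (\<bar>f n x - g x\<bar> powr p)"
          using elim p by (intro tendsto_intros tendsto_ennrealI tendsto_powr') auto
        then show ?case
          by (intro lim_imp_Liminf[symmetric]) auto
      qed
    qed
    also have "\<dots> \<le> liminf (\<lambda>k. \<integral>\<^sup>+x. ennreal (\<bar>f n x - f (r k) x\<bar> powr p) \<partial>M)"
      by (rule nn_integral_liminf) simp
    also have "\<dots> = liminf (\<lambda>k. ennreal (Lp_norm M p (\<lambda>x. f n x - f (r k) x) powr p))"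
      by (simp add: nn_eq)
    also have "\<dots> \<le> ennreal (e powr p)"
    proof (rule Liminf_le)
      obtain k0 where "K \<le> r k0"
        by (metis le_add2 r_def)
      then have "\<forall>k\<ge>k0. Lp_norm M p (\<lambda>x. f n x - f (r k) x) < e"
        using that r_mono' order_trans by blast
      then show "\<forall>\<^sub>F k in sequentially.
          ennreal (Lp_norm M p (\<lambda>x. f n x - f (r k) x) powr p) \<le> ennreal (e powr p)"
        using p unfolding eventually_sequentially
        by (intro exI[of _ k0] allI impI ennreal_leI powr_mono2) (auto simp: Lp_norm_nonneg intro: less_imp_le)
    qed simp
    finally show ?thesis .
  qed
  have Lp: "(\<lambda>x. f n x - g x) \<in> Lp_fun M p \<and> Lp_norm M p (\<lambda>x. f n x - g x) \<le> e"
    if "\<forall>m\<ge>K. Lp_norm M p (\<lambda>x. f n x - f m x) < e" for n K e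
  proof -
    have e: "0 \<le> e"
      using that Lp_norm_nonneg[of M p] by (meson le_refl less_imp_le order_trans)
    have int: "integrable M (\<lambda>x. \<bar>f n x - g x\<bar> powr p)"
      using fatou[OF that] by (intro integrableI_nonneg) (auto simp: le_less_trans)
    then have "(\<integral>x. \<bar>f n x - g x\<bar> powr p \<partial>M) \<le> e powr p"
      using fatou[OF that] by (simp add: nn_integral_eq_integral)
    then show ?thesis
      using int p e by (simp add: Lp_fun_def Lp_norm_le_iff)
  qed
  \<comment> \<open>The limit is recovered as \<open>f K - (f K - g)\<close>; the difference is
    p-integrable by the Fatou bound.\<close>
  have g: "g \<in> Lp_fun M p"
  proof -
    obtain K where "\<forall>m\<ge>K. \<forall>n\<ge>K. Lp_norm M p (\<lambda>x. f m x - f n x) < 1"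
      using cauchy[of 1] by auto
    then have "(\<lambda>x. f K x - g x) \<in> Lp_fun M p"
      using Lp[of K K 1] by auto
    from Lp_fun_diff[OF f[of K] this] show ?thesis
      using p by simp
  qed
  have "(\<lambda>n. Lp_norm M p (\<lambda>x. f n x - g x)) \<longlonglongrightarrow> 0"
  proof (rule LIMSEQ_I)
    fix e :: real assume "0 < e"
    then obtain K where "\<forall>m\<ge>K. \<forall>n\<ge>K. Lp_norm M p (\<lambda>x. f m x - f n x) < e / 2"
      using cauchy[of "e / 2"] by auto
    then have "\<forall>n\<ge>K. Lp_norm M p (\<lambda>x. f n x - g x) \<le> e / 2"
      using Lp[of K _ "e / 2"] by blast
    then show "\<exists>K. \<forall>n\<ge>K. norm (Lp_norm M p (\<lambda>x. f n x - g x) - 0) < e"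
      using \<open>0 < e\<close> by (intro exI[of _ K]) (auto simp: Lp_norm_nonneg le_less_trans)
  qed
  with g show ?thesis
    by blast
qed

section \<open>Ordered vector spaces modelled on \<open>L^p\<close>\<close>

text \<open>
  Both \<open>L^p\<close> itself and its image in the order dual are described by a surjection from
  \<open>p\<close>-integrable functions that identifies functions agreeing almost everywhere.
\<close>

locale Lp_model =
  fixes V :: "('v, 'm) ovs_scheme" and M :: "'x measure" and p :: real
    and R :: "('x \<Rightarrow> real) \<Rightarrow> 'v"
  assumes p: "1 \<le> p"
    and carrier: "vcarrier V = R ` Lp_fun M p"
    and R_zero: "vzero V = R (\<lambda>x. 0)"
    and R_add: "\<lbrakk>f \<in> Lp_fun M p; g \<in> Lp_fun M p\<rbrakk> \<Longrightarrow> vadd V (R f) (R g) = R (\<lambda>x. f x + g x)"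
    and R_scale: "f \<in> Lp_fun M p \<Longrightarrow> vscale V a (R f) = R (\<lambda>x. a * f x)"
    and R_le: "\<lbrakk>f \<in> Lp_fun M p; g \<in> Lp_fun M p\<rbrakk> \<Longrightarrow> vle V (R f) (R g) \<longleftrightarrow> (AE x in M. f x \<le> g x)"
    and R_eqI: "\<lbrakk>f \<in> Lp_fun M p; g \<in> Lp_fun M p; AE x in M. f x = g x\<rbrakk> \<Longrightarrow> R f = R g"
begin

lemma p0: "0 \<le> p" "0 < p"
  using p by auto

lemma R_carrier: "f \<in> Lp_fun M p \<Longrightarrow> R f \<in> vcarrier V"
  by (simp add: carrier)

lemma R_eq_iff:
  assumes "f \<in> Lp_fun M p" "g \<in> Lp_fun M p"
  shows "R f = R g \<longleftrightarrow> (AE x in M. f x = g x)"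
proof
  assume "R f = R g"
  then have "AE x in M. f x \<le> g x" "AE x in M. g x \<le> f x"
    using R_le assms by (metis (no_types, lifting) AE_I2 order_refl)+
  then show "AE x in M. f x = g x"
    by eventually_elim simp
qed (rule R_eqI[OF assms])

lemma R_uminus: "f \<in> Lp_fun M p \<Longrightarrow> vminus V (R f) = R (\<lambda>x. - f x)"
  by (simp add: vminus_def R_scale)

lemma R_diff:
  "\<lbrakk>f \<in> Lp_fun M p; g \<in> Lp_fun M p\<rbrakk> \<Longrightarrow> vdiff V (R f) (R g) = R (\<lambda>x. f x - g x)"
  by (simp add: vdiff_def R_uminus R_add Lp_fun_uminus)

lemmas Lp_intros = Lp_fun_zero Lp_fun_scale Lp_fun_uminus Lp_fun_abs
  Lp_fun_add[OF _ _ p0(1)] Lp_fun_diff[OF _ _ p0(1)] Lp_fun_max[OF _ _ p0(1)] Lp_fun_min[OF _ _ p0(1)]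

lemma R_sup:
  assumes "f \<in> Lp_fun M p" "g \<in> Lp_fun M p"
  shows "is_sup_in V {R f, R g} (R (\<lambda>x. max (f x) (g x)))"
  using assms by (auto simp: is_sup_in_def carrier R_le Lp_intros)

lemma R_inf:
  assumes "f \<in> Lp_fun M p" "g \<in> Lp_fun M p"
  shows "is_inf_in V {R f, R g} (R (\<lambda>x. min (f x) (g x)))"
  using assms by (auto simp: is_inf_in_def carrier R_le Lp_intros)

sublocale vector_lattice V
proof
  fix x y assume xy: "x \<in> vcarrier V" "y \<in> vcarrier V"
  then show "\<exists>s. is_sup_in V {x, y} s"
    using R_sup by (auto simp: carrier)
  show "\<exists>s. is_inf_in V {x, y} s"
    using xy R_inf by (auto simp: carrier)
  show "x = y" if "vle V x y" "vle V y x"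
    using xy that by (auto simp: carrier R_le R_eq_iff)
next
  fix x y and a :: real
  assume "x \<in> vcarrier V" "y \<in> vcarrier V" "vle V x y" "0 \<le> a"
  then show "vle V (vscale V a x) (vscale V a y)"
    by (auto simp: carrier R_le R_scale Lp_intros mult_left_mono)
next
  fix x y z
  assume "x \<in> vcarrier V" "y \<in> vcarrier V" "z \<in> vcarrier V" "vle V x y" "vle V y z"
  then show "vle V x z"
    by (auto simp: carrier R_le elim: AE_mp)
qed (auto simp: carrier R_zero R_add R_scale R_uminus R_le Lp_intros algebra_simps)

lemma vsup_eq:
  assumes "x \<in> vcarrier V" "y \<in> vcarrier V" "is_sup_in V {x, y} s"
  shows "vsup V x y = s"
  unfolding vsup_def
  using assms by (intro the_equality le_antisym) (auto simp: is_sup_in_def)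

lemma R_abs:
  assumes "f \<in> Lp_fun M p"
  shows "vabs V (R f) = R (\<lambda>x. \<bar>f x\<bar>)"
proof -
  have "(\<lambda>x. max (f x) (- f x)) = (\<lambda>x. \<bar>f x\<bar>)"
    by (auto simp: max_def)
  then show ?thesis
    using vsup_eq[OF _ _ R_sup[OF assms Lp_fun_uminus[OF assms]]] assms
    by (simp add: vabs_def R_uminus R_carrier Lp_intros)
qed

theorem dedekind_complete: "dedekind_complete V"
  unfolding dedekind_complete_def
proof (intro allI impI, elim conjE bexE)
  fix A u0
  assume A: "A \<subseteq> vcarrier V" "A \<noteq> {}" and u0: "u0 \<in> vcarrier V" "\<forall>a\<in>A. vle V a u0"
  obtain u where u: "u \<in> Lp_fun M p" "u0 = R u"
    using u0 by (auto simp: carrier)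
  \<comment> \<open>Minorants of all upper bounds: closed under finite suprema, so no induction over finite subsets is needed.\<close>
  define B where "B = {f \<in> Lp_fun M p. \<forall>v\<in>Lp_fun M p. (\<forall>a\<in>A. vle V a (R v)) \<longrightarrow> (AE x in M. f x \<le> v x)}"
  have B_Lp: "f \<in> Lp_fun M p" if "f \<in> B" for f
    using that by (simp add: B_def)
  have B_ub: "AE x in M. f x \<le> v x" if "f \<in> B" "v \<in> Lp_fun M p" "\<forall>a\<in>A. vle V a (R v)" for f v
    using that by (simp add: B_def)
  have B_le: "AE x in M. f x \<le> u x" if "f \<in> B" for f
    using that u u0 by (auto intro: B_ub)
  have B_A: "f \<in> B" if "f \<in> Lp_fun M p" "R f \<in> A" for f
    using that by (auto simp: B_def R_le)
  have B_max: "(\<lambda>x. max (f x) (g x)) \<in> B" if "f \<in> B" "g \<in> B" for f g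
    using that by (auto simp: B_def Lp_intros)
  define \<psi> where "\<psi> f = (\<integral>x. \<bar>u x - f x\<bar> powr p \<partial>M)" for f
  have bdd: "bdd_below (\<psi> ` B)"
    by (intro bdd_belowI[of _ 0]) (auto simp: \<psi>_def)
  define m where "m = Inf (\<psi> ` B)"
  have ne: "\<psi> ` B \<noteq> {}"
    using A B_A by (auto simp: carrier)
  have "\<exists>f\<in>B. \<psi> f < m + 1 / Suc n" for n
    using cInf_lessD[OF ne, of "m + 1 / Suc n"] by (auto simp: m_def)
  then obtain b where b: "\<And>n. b n \<in> B" "\<And>n. \<psi> (b n) < m + 1 / Suc n"
    by metis
  \<comment> \<open>Running maxima of the minimizing sequence: they remain in \<open>B\<close>, they
    increase, and being squeezed between \<open>b n\<close> and \<open>u\<close> they are at least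
    as close to \<open>u\<close>.\<close>
  define c where "c = rec_nat (b 0) (\<lambda>n h x. max (h x) (b (Suc n) x))"
  have c_simps: "c 0 = b 0" "c (Suc n) = (\<lambda>x. max (c n x) (b (Suc n) x))" for n
    by (simp_all add: c_def)
  have c_B: "c n \<in> B" for n
    by (induction n) (use b B_max in \<open>auto simp: c_simps\<close>)
  have c_mono: "incseq (\<lambda>n. c n x)" for x
    by (intro incseq_SucI) (simp add: c_simps)
  have c_ge: "b n x \<le> c n x" for n x
    by (cases n) (auto simp: c_simps)
  have c_le: "AE x in M. \<forall>n. c n x \<le> u x"
    using B_le[OF c_B] by (simp add: AE_all_countable)
  have [measurable]: "c n \<in> borel_measurable M" "b n \<in> borel_measurable M" for n
    using B_Lp[OF c_B] B_Lp[OF b(1)] by (auto intro: Lp_fun_measurable)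
  have [measurable]: "u \<in> borel_measurable M"
    using u by (auto intro: Lp_fun_measurable)
  define s where "s x = lim (\<lambda>n. c n x)" for x
  have [measurable]: "s \<in> borel_measurable M"
    unfolding s_def by (rule borel_measurable_lim_metric) simp
  have lim: "AE x in M. (\<lambda>n. c n x) \<longlonglongrightarrow> s x"
    using c_le
  proof eventually_elim
    case (elim x)
    then obtain l where "(\<lambda>n. c n x) \<longlonglongrightarrow> l"
      using incseq_convergent[OF c_mono] by metis
    then show ?case
      by (simp add: s_def limI)
  qed
  have c_le_s: "AE x in M. \<forall>n. c n x \<le> s x"
    using lim by eventually_elim (auto intro: incseq_le[OF c_mono])
  have s_le: "AE x in M. s x \<le> v x" if "v \<in> Lp_fun M p" "\<forall>a\<in>A. vle V a (R v)" for v
  proof -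
    have "AE x in M. \<forall>n. c n x \<le> v x"
      using B_ub[OF c_B that] by (simp add: AE_all_countable)
    with lim show ?thesis
      by eventually_elim (auto intro: LIMSEQ_le_const2)
  qed
  have s_le_u: "AE x in M. s x \<le> u x"
    using s_le u u0 by blast
  have s: "s \<in> Lp_fun M p"
  proof (rule Lp_fun_bound)
    show "(\<lambda>x. \<bar>b 0 x\<bar> + \<bar>u x\<bar>) \<in> Lp_fun M p"
      using u B_Lp[OF b(1)] by (intro Lp_intros)
    show "AE x in M. \<bar>s x\<bar> \<le> \<bar>\<bar>b 0 x\<bar> + \<bar>u x\<bar>\<bar>"
      using c_le_s s_le_u
    proof eventually_elim
      case (elim x)
      then have "b 0 x \<le> s x"
        by (metis c_simps(1))
      then show ?case
        using elim(2) by linarith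
    qed
  qed (use p in auto)
  have sB: "s \<in> B"
    using s s_le by (simp add: B_def)
  have \<psi>_mono: "\<psi> f \<le> \<psi> g" if fg: "f \<in> B" "g \<in> B" "AE x in M. g x \<le> f x" for f g
    unfolding \<psi>_def
  proof (rule integral_mono_AE)
    show "integrable M (\<lambda>x. \<bar>u x - f x\<bar> powr p)" "integrable M (\<lambda>x. \<bar>u x - g x\<bar> powr p)"
      using u B_Lp fg by (auto intro!: Lp_fun_integrable Lp_intros)
    show "AE x in M. \<bar>u x - f x\<bar> powr p \<le> \<bar>u x - g x\<bar> powr p"
      using fg(3) B_le[OF fg(1)] by eventually_elim (use p in \<open>auto intro!: powr_mono2\<close>)
  qed
  have \<psi>_ge: "m \<le> \<psi> f" if "f \<in> B" for f
    unfolding m_def using bdd that by (intro cInf_lower) auto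
  have \<psi>_le: "\<psi> s \<le> m + 1 / Suc n" for n
  proof -
    have "AE x in M. b n x \<le> s x"
      using c_le_s by eventually_elim (use c_ge order_trans in blast)
    then have "\<psi> s \<le> \<psi> (b n)"
      using \<psi>_mono sB b by blast
    then show ?thesis
      using b(2)[of n] by linarith
  qed
  have \<psi>_s: "\<psi> s \<le> m"
  proof (rule field_le_epsilon)
    fix e :: real assume "0 < e"
    then obtain n where "1 / Suc n < e"
      by (rule nat_approx_posE)
    then show "\<psi> s \<le> m + e"
      using \<psi>_le[of n] by linarith
  qed
  \<comment> \<open>If \<open>a\<close> exceeded \<open>s\<close> on a set of positive measure, the
    maximum of the two would lie in \<open>B\<close> strictly closer to \<open>u\<close> than
    \<open>s\<close>, against minimality.\<close>
  have A_le: "AE x in M. a x \<le> s x" if a: "a \<in> Lp_fun M p" "R a \<in> A" for a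
  proof -
    let ?t = "\<lambda>x. max (s x) (a x)"
    have t: "?t \<in> B"
      using B_max sB B_A[OF a] by blast
    have int: "integrable M (\<lambda>x. \<bar>u x - s x\<bar> powr p)" "integrable M (\<lambda>x. \<bar>u x - ?t x\<bar> powr p)"
      using u s B_Lp[OF t] by (auto intro!: Lp_fun_integrable Lp_intros)
    have le: "AE x in M. 0 \<le> \<bar>u x - s x\<bar> powr p - \<bar>u x - ?t x\<bar> powr p"
      using s_le_u B_le[OF t] by eventually_elim (use p in \<open>auto intro!: powr_mono2\<close>)
    have "(\<integral>x. \<bar>u x - s x\<bar> powr p - \<bar>u x - ?t x\<bar> powr p \<partial>M) = \<psi> s - \<psi> ?t"
      using int by (simp add: \<psi>_def)
    also have "\<dots> \<le> 0"
      using \<psi>_s \<psi>_ge[OF t] by simp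
    finally have "(\<integral>x. \<bar>u x - s x\<bar> powr p - \<bar>u x - ?t x\<bar> powr p \<partial>M) = 0"
      using integral_nonneg_AE[OF le] by linarith
    then have "AE x in M. \<bar>u x - s x\<bar> powr p - \<bar>u x - ?t x\<bar> powr p = 0"
      using integral_nonneg_eq_0_iff_AE[OF _ le] int by simp
    then show ?thesis
      using s_le_u B_le[OF t]
    proof eventually_elim
      case (elim x)
      show ?case
      proof (rule ccontr)
        assume "\<not> a x \<le> s x"
        then have "\<bar>u x - ?t x\<bar> powr p < \<bar>u x - s x\<bar> powr p"
          using elim p by (intro powr_less_mono2) auto
        then show False
          using elim by simp
      qed
    qed
  qed
  have "is_sup_in V A (R s)"
    unfolding is_sup_in_def
  proof (intro conjI ballI impI)
    show "R s \<in> vcarrier V"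
      by (rule R_carrier[OF s])
    show "vle V a (R s)" if "a \<in> A" for a
      using that A A_le s by (auto simp: carrier R_le)
    show "vle V (R s) v" if "v \<in> vcarrier V" "\<forall>a\<in>A. vle V a v" for v
      using that s s_le by (auto simp: carrier R_le)
  qed
  then show "\<exists>s. is_sup_in V A s" ..
qed

end

locale Lp_normed_model = Lp_model +
  fixes N
  assumes R_norm: "f \<in> Lp_fun M p \<Longrightarrow> N (R f) = Lp_norm M p f"
begin

lemma R_dist:
  "\<lbrakk>f \<in> Lp_fun M p; g \<in> Lp_fun M p\<rbrakk> \<Longrightarrow> vdist V N (R f) (R g) = Lp_norm M p (\<lambda>x. f x - g x)"
  by (simp add: vdist_def R_carrier R_diff R_norm Lp_intros)

lemma Metric_space_vdist: "Metric_space (vcarrier V) (vdist V N)"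
proof
  show "0 \<le> vdist V N x y" for x y
    by (auto simp: vdist_def carrier R_diff R_norm Lp_norm_nonneg Lp_intros)
  show "vdist V N x y = vdist V N y x" for x y
    by (auto simp: vdist_def carrier R_diff R_norm Lp_intros intro: Lp_norm_minus_commute)
  show "vdist V N x y = 0 \<longleftrightarrow> x = y" if "x \<in> vcarrier V" "y \<in> vcarrier V" for x y
    using that by (auto simp: carrier R_dist R_eq_iff Lp_norm_eq_0_iff Lp_intros)
  show "vdist V N x z \<le> vdist V N x y + vdist V N y z"
    if "x \<in> vcarrier V" "y \<in> vcarrier V" "z \<in> vcarrier V" for x y z
    using that p by (auto simp: carrier R_dist Lp_norm_diff_triangle)
qed

lemma mcomplete: "Metric_space.mcomplete (vcarrier V) (vdist V N)"
proof -
  interpret Metric_space "vcarrier V" "vdist V N"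
    by (rule Metric_space_vdist)
  show ?thesis
    unfolding mcomplete_def
  proof (intro allI impI)
    fix \<sigma> assume \<sigma>: "MCauchy \<sigma>"
    then have "range \<sigma> \<subseteq> vcarrier V"
      unfolding MCauchy_def by blast
    then have "\<forall>n. \<exists>f. f \<in> Lp_fun M p \<and> \<sigma> n = R f"
      by (auto simp: carrier)
    then obtain f where f: "\<And>n. f n \<in> Lp_fun M p" "\<And>n. \<sigma> n = R (f n)"
      by metis
    have "\<exists>K. \<forall>m\<ge>K. \<forall>n\<ge>K. Lp_norm M p (\<lambda>x. f m x - f n x) < e" if "0 < e" for e
      using \<sigma> that by (simp add: MCauchy_def f R_dist)
    from Riesz_Fischer[OF f(1) p this] obtain g
      where g: "g \<in> Lp_fun M p" "(\<lambda>n. Lp_norm M p (\<lambda>x. f n x - g x)) \<longlonglongrightarrow> 0"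
      by blast
    then have "limitin mtopology \<sigma> (R g) sequentially"
      by (simp add: limitin_metric_dist_null f R_dist R_carrier)
    then show "\<exists>x. limitin mtopology \<sigma> x sequentially" ..
  qed
qed

sublocale banach_lattice V N
proof
  fix x assume "x \<in> vcarrier V"
  then obtain f where f: "f \<in> Lp_fun M p" "x = R f"
    by (auto simp: carrier)
  show "0 \<le> N x"
    using f by (simp add: R_norm Lp_norm_nonneg)
  show "N x = 0 \<longleftrightarrow> x = vzero V"
    using f by (simp add: R_norm R_zero R_eq_iff Lp_norm_eq_0_iff Lp_intros)
  show "N (vscale V a x) = \<bar>a\<bar> * N x" for a
    using f p0 by (simp add: R_norm R_scale Lp_norm_scale Lp_intros)
  fix y assume "y \<in> vcarrier V"
  then obtain g where g: "g \<in> Lp_fun M p" "y = R g"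
    by (auto simp: carrier)
  show "N (vadd V x y) \<le> N x + N y"
    using f g p by (simp add: R_norm R_add Minkowski_inequality Lp_intros)
  show "N x \<le> N y" if "vle V (vabs V x) (vabs V y)"
    using that f g p0 by (simp add: R_norm R_abs R_le Lp_norm_mono Lp_intros)
qed (rule mcomplete)

lemma norm_denseI:
  assumes D: "D \<subseteq> vcarrier V"
    and approx: "\<And>f e. \<lbrakk>f \<in> Lp_fun M p; 0 < e\<rbrakk> \<Longrightarrow>
      \<exists>g\<in>Lp_fun M p. R g \<in> D \<and> Lp_norm M p (\<lambda>x. f x - g x) < e"
  shows "norm_dense V N D"
proof -
  interpret Metric_space "vcarrier V" "vdist V N"
    by (rule Metric_space_vdist)
  show ?thesis
    unfolding norm_dense_def metric_closure_of
  proof (intro conjI D equalityI subsetI CollectI allI impI)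
    fix x and r :: real assume x: "x \<in> vcarrier V" "0 < r"
    then obtain f where f: "f \<in> Lp_fun M p" "x = R f"
      by (auto simp: carrier)
    then show "\<exists>y\<in>D. y \<in> mball x r"
      using approx[OF f(1) x(2)] x(1) by (auto intro!: bexI simp: R_dist R_carrier)
  qed auto
qed

lemma norm_dense_mono:
  assumes D: "norm_dense V N D" and "D \<subseteq> D'" "D' \<subseteq> vcarrier V"
  shows "norm_dense V N D'"
proof -
  interpret Metric_space "vcarrier V" "vdist V N"
    by (rule Metric_space_vdist)
  have "vcarrier V \<subseteq> mtopology closure_of D'"
    using D closure_of_mono[OF assms(2), of mtopology] by (simp add: norm_dense_def)
  then show ?thesis
    using assms(3) closure_of_subset_topspace[of mtopology D'] by (auto simp: norm_dense_def)
qed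

end

section \<open>Regular Borel measures on locally compact spaces\<close>

lemma Hausdorff_space_euclidean_t2: "Hausdorff_space (euclidean :: 'a::t2_space topology)"
  unfolding Hausdorff_space_def disjnt_def using hausdorff by fastforce

lemma compact_closed_subset:
  fixes K S :: "'a::t2_space set"
  assumes "compact K" "closed S" "S \<subseteq> K"
  shows "compact S"
  using assms by (metis compact_Int_closed inf.absorb_iff2)

lemma CcD:
  assumes "f \<in> vcarrier Cc"
  shows Cc_continuous: "continuous_on UNIV f" and Cc_compact: "compact (fsupp f)"
  using assms by auto

lemma fsupp_zero: "x \<notin> fsupp f \<Longrightarrow> f x = 0"
  unfolding fsupp_def using closure_subset[of "{x. f x \<noteq> 0}"] by blast

lemma Cc_bounded:
  fixes f :: "'a::t2_space \<Rightarrow> real"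
  assumes "f \<in> vcarrier Cc"
  obtains C where "0 \<le> C" "\<And>x. \<bar>f x\<bar> \<le> C"
proof -
  have "compact (f ` fsupp f)"
    using CcD[OF assms] by (auto intro: compact_continuous_image continuous_on_subset)
  then obtain C where "\<And>x. x \<in> fsupp f \<Longrightarrow> \<bar>f x\<bar> \<le> C"
    by (metis bounded_iff compact_imp_bounded image_eqI real_norm_def)
  then have "\<bar>f x\<bar> \<le> max 0 C" for x
    using fsupp_zero[of x f] by (cases "x \<in> fsupp f") (force simp: le_max_iff_disj)+
  then show ?thesis
    by (intro that[of "max 0 C"]) auto
qed

lemma Cc_measurable:
  assumes "f \<in> vcarrier Cc"
  shows "f \<in> borel_measurable borel"
  using assms by (auto intro: borel_measurable_continuous_onI)

lemma Cc_combine: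
  fixes f g h :: "'a::t2_space \<Rightarrow> real"
  assumes "f \<in> vcarrier Cc" "g \<in> vcarrier Cc" "continuous_on UNIV h"
    and "\<And>x. f x = 0 \<Longrightarrow> g x = 0 \<Longrightarrow> h x = 0"
  shows "h \<in> vcarrier Cc"
  using assms compact_fsupp_combine[of f g h] by auto

lemma Cc_mult:
  fixes f g :: "'a::t2_space \<Rightarrow> real"
  assumes "f \<in> vcarrier Cc" "continuous_on UNIV g"
  shows "(\<lambda>x. f x * g x) \<in> vcarrier Cc"
  by (rule Cc_combine[OF assms(1,1)]) (use assms in \<open>auto intro: continuous_on_mult\<close>)

lemma Cc_closed:
  fixes f g :: "'a::t2_space \<Rightarrow> real"
  assumes "f \<in> vcarrier Cc" "g \<in> vcarrier Cc"
  shows Cc_add: "(\<lambda>x. f x + g x) \<in> vcarrier Cc"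
    and Cc_diff: "(\<lambda>x. f x - g x) \<in> vcarrier Cc"
    and Cc_min: "(\<lambda>x. min (f x) (g x)) \<in> vcarrier Cc"
  by (rule Cc_combine[OF assms];
      use assms in \<open>auto intro: continuous_on_add continuous_on_diff continuous_on_min\<close>)+

lemma Cc_closed1:
  fixes f :: "'a::t2_space \<Rightarrow> real"
  assumes "f \<in> vcarrier Cc"
  shows Cc_scale: "(\<lambda>x. a * f x) \<in> vcarrier Cc"
    and Cc_uminus: "(\<lambda>x. - f x) \<in> vcarrier Cc"
    and Cc_abs: "(\<lambda>x. \<bar>f x\<bar>) \<in> vcarrier Cc"
    and Cc_max0: "(\<lambda>x. max (f x) 0) \<in> vcarrier Cc"
    and Cc_neg0: "(\<lambda>x. max (- f x) 0) \<in> vcarrier Cc"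
  by (rule Cc_combine[OF assms assms];
      use assms in \<open>auto intro: continuous_on_mult_left continuous_on_minus continuous_on_rabs
        continuous_on_max\<close>)+

lemma Cc_zero: "(\<lambda>x. 0 :: real) \<in> vcarrier Cc"
  by (simp add: fsupp_def)

lemmas Cc_intros = Cc_closed Cc_closed1 Cc_zero

section \<open>Urysohn functions with compact support\<close>

context
  assumes lc: "locally_compact_space (euclidean :: 'a::t2_space topology)"
begin

text \<open>Every point of \<open>K\<close> has an open neighbourhood inside a compact set contained
  in \<open>V\<close>, and finitely many of them cover \<open>K\<close>. The finite union of the
  compact sets is closed, so it contains the closure of the union of the open ones.\<close>

lemma open_relatively_compact_between:
  fixes K V :: "'a set"
  assumes K: "compact K" and V: "open V" "K \<subseteq> V"
  obtains W where "open W" "compact (closure W)" "K \<subseteq> W" "closure W \<subseteq> V"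
proof -
  have "neighbourhood_base_of (\<lambda>C. compactin euclidean C \<and> closedin euclidean C) (euclidean :: 'a topology)"
    using lc Hausdorff_space_euclidean_t2 locally_compact_space_neighbourhood_base_closedin by blast
  then have "\<forall>x\<in>K. \<exists>U C. open U \<and> compact C \<and> x \<in> U \<and> U \<subseteq> C \<and> C \<subseteq> V"
    using V unfolding neighbourhood_base_of by (metis compactin_euclidean_iff open_openin subsetD)
  then obtain U C where UC: "\<And>x. x \<in> K \<Longrightarrow> open (U x) \<and> compact (C x) \<and> x \<in> U x \<and> U x \<subseteq> C x \<and> C x \<subseteq> V"
    by metis
  obtain D where D: "D \<subseteq> K" "finite D" "K \<subseteq> (\<Union>x\<in>D. U x)"
    using UC by (auto intro: compactE_image[OF K, of K U])
  have C: "compact (\<Union>x\<in>D. C x)"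
    using D UC by (intro compact_UN) auto
  moreover have "(\<Union>x\<in>D. U x) \<subseteq> (\<Union>x\<in>D. C x)" "(\<Union>x\<in>D. C x) \<subseteq> V"
    using D UC by blast+
  ultimately have "closure (\<Union>x\<in>D. U x) \<subseteq> (\<Union>x\<in>D. C x)"
    by (simp add: closure_minimal compact_imp_closed)
  then show ?thesis
    using D UC C \<open>(\<Union>x\<in>D. C x) \<subseteq> V\<close>
    by (intro that[of "\<Union>x\<in>D. U x"])
      (auto intro: compact_closed_subset[OF C] intro!: open_UN)
qed

text \<open>The separating function comes from complete regularity. Separating \<open>K\<close> from
  the complement of a relatively compact \<open>W\<close>, rather than from that of
  \<open>V\<close>, is what makes the support compact and keeps it inside \<open>V\<close>.\<close>

lemma Urysohn_Cc:
  fixes K V :: "'a set"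
  assumes K: "compact K" and V: "open V" "K \<subseteq> V"
  obtains f where "f \<in> vcarrier Cc" "\<And>x. 0 \<le> f x" "\<And>x. f x \<le> 1" "\<And>x. x \<in> K \<Longrightarrow> f x = 1" "fsupp f \<subseteq> V"
proof -
  obtain W where W: "open W" "compact (closure W)" "K \<subseteq> W" "closure W \<subseteq> V"
    using open_relatively_compact_between[OF assms] by blast
  have "completely_regular_space (euclidean :: 'a topology)"
    using lc Hausdorff_space_euclidean_t2 completely_regular_eq_regular_space
      locally_compact_Hausdorff_or_regular by blast
  then obtain f where f: "continuous_map (euclidean :: 'a topology) (top_of_set {0..1}) f"
      "f ` (- W) \<subseteq> {0::real}" "f ` K \<subseteq> {1}"
    using Urysohn_completely_regular_compact_closed[of 0 1 "euclidean :: 'a topology" K "- W"] K W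
    by (auto simp: disjnt_def)
  have "continuous_on UNIV f" "\<And>x. f x \<in> {0..1}"
    using f(1) by (auto simp: continuous_map_in_subtopology)
  moreover have "fsupp f \<subseteq> closure W"
    unfolding fsupp_def using f(2) by (intro closure_mono) auto
  moreover from this have "compact (fsupp f)"
    by (intro compact_closed_subset[OF W(2)]) (auto simp: fsupp_def)
  ultimately show ?thesis
    using f(3) W by (intro that[of f]) auto
qed

end

section \<open>Approximation of sets of finite measure\<close>

locale radon_measure =
  fixes M :: "'a::t2_space measure"
  assumes lc: "locally_compact_space (euclidean :: 'a topology)"
    and regular: "regular_borel_measure UNIV M"
begin

lemma sets_M [measurable_cong, simp]: "sets M = sets borel"
  using regular by (simp add: regular_borel_measure_def)

lemma space_M [simp]: "space M = UNIV"
  using sets_eq_imp_space_eq[OF sets_M] by simp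

lemma Cc_measurable_M: "f \<in> vcarrier Cc \<Longrightarrow> f \<in> borel_measurable M"
  using Cc_measurable measurable_cong_sets[OF sets_M refl] by blast

lemma compact_sets: "compact K \<Longrightarrow> K \<in> sets M"
  by (simp add: borel_compact)

lemma emeasure_compact_finite: "compact K \<Longrightarrow> emeasure M K < \<infinity>"
  using regular by (simp add: regular_borel_measure_def)

lemma outer_regular:
  assumes "A \<in> sets M" "emeasure M A < c"
  obtains V where "open V" "A \<subseteq> V" "emeasure M V < c"
proof -
  have "emeasure M A = (INF V\<in>{V. open V \<and> A \<subseteq> V}. emeasure M V)"
    using regular assms(1) by (simp add: regular_borel_measure_def)
  with assms(2) show ?thesis
    using that by (auto simp: INF_less_iff)
qed

lemma inner_regular_open:
  assumes "open V" "c < emeasure M V"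
  obtains K where "compact K" "K \<subseteq> V" "c < emeasure M K"
proof -
  have "emeasure M V = (SUP K\<in>{K. compact K \<and> K \<subseteq> V}. emeasure M K)"
  proof -
    have "\<forall>V. openin (top_of_set UNIV) V \<longrightarrow> emeasure M V = (SUP K\<in>{K. compact K \<and> K \<subseteq> V}. emeasure M K)"
      using regular unfolding regular_borel_measure_def by blast
    then show ?thesis
      using assms(1) by simp
  qed
  with assms(2) show ?thesis
    using that by (auto simp: less_SUP_iff)
qed

text \<open>Inner regularity is transferred from open sets to \<open>A\<close>: take an open
  \<open>V\<close> around \<open>A\<close>, a small open \<open>W\<close> around
  \<open>V - A\<close>, and a compact \<open>L\<close> filling most of \<open>V\<close>. Then
  \<open>L - W\<close> is compact and lies in \<open>A\<close>, and \<open>V - (L - W)\<close> is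
  covered by \<open>V - L\<close> and \<open>W\<close>.\<close>

lemma compact_open_sandwich:
  assumes A: "A \<in> sets M" "emeasure M A < \<infinity>" and e: "0 < e"
  obtains K V where "compact K" "open V" "K \<subseteq> A" "A \<subseteq> V" "emeasure M (V - K) < ennreal e"
proof -
  \<comment> \<open>The sets \<open>V - L\<close> and \<open>W\<close> cost \<open>d\<close> each; 2
    d = e / 2 keeps the final inequality strict.\<close>
  define d where "d = e / 4"
  have d: "0 < d" "0 < ennreal d"
    using e by (auto simp: d_def)
  have add_pos: "x < x + ennreal d" if "x < \<infinity>" for x
    using d that by (cases x) (auto simp: ennreal_plus[symmetric] ennreal_less_iff simp del: ennreal_plus)
  obtain V where V: "open V" "A \<subseteq> V" "emeasure M V < emeasure M A + ennreal d"
    using outer_regular[OF A(1) add_pos[OF A(2)]] by blast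
  have Vfin: "emeasure M V < \<infinity>"
    by (rule order_less_trans[OF V(3)])
      (use A(2) in \<open>cases "emeasure M A"; auto simp: ennreal_plus[symmetric] simp del: ennreal_plus\<close>)
  have sets: "V \<in> sets M"
    using V by simp
  have VA: "emeasure M (V - A) < ennreal d"
  proof -
    have "emeasure M (V - A) = emeasure M V - emeasure M A"
      using V A sets by (intro emeasure_Diff) auto
    also have "\<dots> < ennreal d"
    proof (cases "emeasure M V"; cases "emeasure M A")
      fix r s assume rs: "emeasure M V = ennreal r" "0 \<le> r" "emeasure M A = ennreal s" "0 \<le> s"
      then have "r < s + d"
        using V(3) d by (simp add: ennreal_plus[symmetric] ennreal_less_iff del: ennreal_plus)
      then show ?thesis
        using rs d by (auto simp: ennreal_minus intro: ennreal_lessI)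
    qed (use Vfin A(2) in auto)
    finally show ?thesis .
  qed
  obtain W where W: "open W" "V - A \<subseteq> W" "emeasure M W < ennreal d"
    using outer_regular[OF _ VA] A V by auto
  \<comment> \<open>Inner regularity is used through a bound strictly below the measure of
    \<open>V\<close>, and there is no such bound when \<open>V\<close> is null; the empty set serves
    then.\<close>
  obtain L where L: "compact L" "L \<subseteq> V" "emeasure M (V - L) \<le> ennreal d"
  proof (cases "emeasure M V = 0")
    case True
    then show ?thesis
      by (intro that[of "{}"]) auto
  next
    case False
    then have "emeasure M V - ennreal d < emeasure M V"
    proof (cases "emeasure M V")
      case (real r)
      then have "0 < r"
        using False by (cases "r = 0") auto
      then show ?thesis
        using real d by (auto simp: ennreal_minus intro: ennreal_lessI)
    qed (use Vfin in auto)
    then obtain L where L: "compact L" "L \<subseteq> V" "emeasure M V - ennreal d < emeasure M L"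
      using inner_regular_open[OF V(1)] by blast
    have "emeasure M (V - L) = emeasure M V - emeasure M L"
      using L V emeasure_compact_finite[OF L(1)] by (intro emeasure_Diff) (auto simp: borel_compact)
    also have "\<dots> \<le> ennreal d"
      using L(3) Vfin emeasure_compact_finite[OF L(1)] d
    proof (cases "emeasure M V"; cases "emeasure M L")
      fix r s assume rs: "emeasure M V = ennreal r" "0 \<le> r" "emeasure M L = ennreal s" "0 \<le> s"
      then have "ennreal (r - d) < ennreal s"
        using L(3) d by (simp add: ennreal_minus)
      then have "r - d < s"
        using ennreal_leI[of s "r - d"] by (meson linorder_not_less)
      then show ?thesis
        using rs by (simp add: ennreal_minus ennreal_leI)
    qed (use Vfin emeasure_compact_finite[OF L(1)] in auto)
    finally show ?thesis
      using L that by blast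
  qed
  have "emeasure M (V - (L - W)) \<le> emeasure M ((V - L) \<union> W)"
    using V L W by (intro emeasure_mono) (auto simp: borel_compact intro!: sets.Un sets.Diff)
  also have "\<dots> \<le> emeasure M (V - L) + emeasure M W"
    using V L W by (intro emeasure_subadditive) (auto simp: borel_compact)
  also have "\<dots> \<le> ennreal d + ennreal d"
    using L W by (intro add_mono) auto
  also have "\<dots> < ennreal e"
    using d e by (simp add: ennreal_plus[symmetric] d_def ennreal_less_iff del: ennreal_plus)
  finally have "emeasure M (V - (L - W)) < ennreal e" .
  moreover have "compact (L - W)"
    using L W by (simp add: compact_diff)
  ultimately show ?thesis
    using L W V by (intro that[of "L - W" V]) auto
qed

text \<open>A Urysohn function that is 1 on \<open>K\<close> and supported in \<open>V\<close>
  agrees with the indicator exactly, except on the small set \<open>V - K\<close>. Exact agreement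
  off a small set serves both for norm estimates and for convergence almost everywhere.\<close>

lemma indicator_approx:
  assumes A: "A \<in> sets M" "emeasure M A < \<infinity>" and e: "0 < e"
  obtains f D where "f \<in> vcarrier Cc" "\<And>x. 0 \<le> f x" "\<And>x. f x \<le> 1"
    "D \<in> sets M" "emeasure M D < ennreal e" "\<And>x. x \<notin> D \<Longrightarrow> f x = indicator A x"
proof -
  obtain K V where KV: "compact K" "open V" "K \<subseteq> A" "A \<subseteq> V" "emeasure M (V - K) < ennreal e"
    using compact_open_sandwich[OF assms] by blast
  obtain f where f: "f \<in> vcarrier Cc" "\<And>x. 0 \<le> f x" "\<And>x. f x \<le> 1" "\<And>x. x \<in> K \<Longrightarrow> f x = 1" "fsupp f \<subseteq> V"
    using Urysohn_Cc[OF lc KV(1,2)] KV by blast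
  have "f x = indicator A x" if "x \<notin> V - K" for x
    using that f(4)[of x] fsupp_zero[of x f] f(5) KV by (auto simp: indicator_def)
  then show ?thesis
    using f(1-3) KV by (intro that[of f "V - K"]) (simp_all add: borel_compact sets.Diff del: Cc_simps)
qed

text \<open>With exceptional sets of measure below \<open>(1/2) ^ n\<close>, Borel-Cantelli puts
  almost every point in only finitely many of them, so the approximations are eventually equal to
  the indicator there.\<close>

lemma indicator_approx_AE:
  assumes A: "A \<in> sets M" "emeasure M A < \<infinity>"
  obtains s where "\<And>n. s n \<in> vcarrier Cc" "\<And>n x. 0 \<le> s n x" "\<And>n x. s n x \<le> 1"
    "AE x in M. (\<lambda>n. s n x) \<longlonglongrightarrow> (indicator A x :: real)"
proof -
  have "\<exists>f D. f \<in> vcarrier Cc \<and> (\<forall>x. 0 \<le> f x \<and> f x \<le> 1) \<and>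
      D \<in> sets M \<and> emeasure M D < ennreal ((1/2) ^ n) \<and> (\<forall>x. x \<notin> D \<longrightarrow> f x = indicator A x)" for n :: nat
    using indicator_approx[OF A, of "(1/2) ^ n"] by (metis half_gt_zero_iff zero_less_one zero_less_power)
  then obtain s D where s: "\<And>n. s n \<in> vcarrier Cc" "\<And>n x. 0 \<le> s n x \<and> s n x \<le> 1"
    and D: "\<And>n. D n \<in> sets M" "\<And>n. emeasure M (D n) < ennreal ((1/2) ^ n)"
      "\<And>n x. x \<notin> D n \<Longrightarrow> s n x = indicator A x"
    by metis
  have "AE x in M. eventually (\<lambda>n. x \<in> space M - D n) sequentially"
  proof (rule borel_cantelli_AE1)
    show "emeasure M (D n) < \<infinity>" for n
      using D(2)[of n] by (metis ennreal_less_top infinity_ennreal_def order_less_trans)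
    have mle: "measure M (D n) \<le> (1/2) ^ n" for n
      unfolding measure_def by (intro enn2real_leI less_imp_le[OF D(2)]) simp
    show "summable (\<lambda>n. measure M (D n))"
    proof (rule summable_comparison_test')
      show "summable (\<lambda>n. (1/2 :: real) ^ n)"
        by (simp add: summable_geometric)
      show "norm (measure M (D n)) \<le> (1/2) ^ n" if "0 \<le> n" for n
        using mle by simp
    qed
  qed (use D in auto)
  then have "AE x in M. (\<lambda>n. s n x) \<longlonglongrightarrow> (indicator A x :: real)"
  proof eventually_elim
    case (elim x)
    then have "\<forall>\<^sub>F n in sequentially. s n x = indicator A x"
      by eventually_elim (use D in auto)
    then show ?case
      by (rule tendsto_eventually)
  qed
  then show ?thesis
    using s that by blast
qed

section \<open>Test functions and L^p: integrability, density, localization\<close>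

lemma Cc_Lp_fun:
  assumes f: "f \<in> vcarrier Cc" and p: "0 \<le> p"
  shows "f \<in> Lp_fun M p"
proof -
  note [measurable] = Cc_measurable_M[OF f]
  obtain C where C: "0 \<le> C" "\<And>x. \<bar>f x\<bar> \<le> C"
    using Cc_bounded[OF f] by blast
  have c: "compact (fsupp f)" "fsupp f \<in> sets M"
    using Cc_compact[OF f] compact_sets by auto
  have "integrable M (\<lambda>x. C powr p * indicator (fsupp f) x)"
    using c emeasure_compact_finite[OF c(1)] by (simp add: integrable_indicator_iff)
  then have "integrable M (\<lambda>x. \<bar>f x\<bar> powr p)"
  proof (rule Bochner_Integration.integrable_bound)
    have "\<bar>f x\<bar> powr p \<le> C powr p * indicator (fsupp f) x" for x
      using C p fsupp_zero[of x f] by (cases "x \<in> fsupp f") (auto intro: powr_mono2)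
    then show "AE x in M. norm (\<bar>f x\<bar> powr p) \<le> norm (C powr p * indicator (fsupp f) x)"
      by simp
  qed simp
  then show ?thesis
    by (simp add: Lp_fun_def)
qed

text \<open>Distinguishing whether |g| is at most 1 gives |f g| \<le> |f| + C |g|^p, a bound that
  holds uniformly for all p from 1 on.\<close>

lemma integrable_Cc_mult:
  assumes f: "f \<in> vcarrier Cc" and g: "g \<in> Lp_fun M p" and p: "1 \<le> p"
  shows "integrable M (\<lambda>x. f x * g x)"
proof -
  note [measurable] = Cc_measurable_M[OF f] Lp_fun_measurable[OF g]
  obtain C where C: "0 \<le> C" "\<And>x. \<bar>f x\<bar> \<le> C"
    using Cc_bounded[OF f] by blast
  have "integrable M (\<lambda>x. \<bar>f x\<bar> powr 1)"
    by (rule Lp_fun_integrable[OF Cc_Lp_fun[OF f]]) simp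
  then have "integrable M (\<lambda>x. \<bar>f x\<bar> + C * \<bar>g x\<bar> powr p)"
    using Lp_fun_integrable[OF g] by simp
  then show ?thesis
  proof (rule Bochner_Integration.integrable_bound)
    show "AE x in M. norm (f x * g x) \<le> norm (\<bar>f x\<bar> + C * \<bar>g x\<bar> powr p)"
    proof (rule AE_I2)
      fix x
      have "\<bar>f x\<bar> * \<bar>g x\<bar> \<le> \<bar>f x\<bar> + C * \<bar>g x\<bar> powr p"
      proof (cases "\<bar>g x\<bar> \<le> 1")
        case True
        then have "\<bar>f x\<bar> * \<bar>g x\<bar> \<le> \<bar>f x\<bar>"
          by (simp add: mult_left_le)
        then show ?thesis
          using C by (simp add: add_increasing2)
      next
        case False
        then have "\<bar>g x\<bar> \<le> \<bar>g x\<bar> powr p"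
          using powr_mono[of 1 p "\<bar>g x\<bar>"] p by simp
        then have "\<bar>f x\<bar> * \<bar>g x\<bar> \<le> C * \<bar>g x\<bar> powr p"
          using C by (intro mult_mono) auto
        then show ?thesis
          by simp
      qed
      then show "norm (f x * g x) \<le> norm (\<bar>f x\<bar> + C * \<bar>g x\<bar> powr p)"
        by (simp add: abs_mult)
    qed
  qed simp
qed

text \<open>Approximability, called \<open>P\<close>, passes to sums and to L^p limits. Multiples of
  indicators of sets of finite measure have it by regularity, hence so do the p-integrable simple
  functions and then all of L^p.\<close>

lemma Cc_dense_Lp:
  assumes g: "g \<in> Lp_fun M p" and p: "1 \<le> p" and e: "0 < e"
  shows "\<exists>f\<in>vcarrier Cc. Lp_norm M p (\<lambda>x. g x - f x) < e"
proof -
  have p0: "0 < p" "0 \<le> p"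
    using p by auto
  define P where "P g \<longleftrightarrow> g \<in> Lp_fun M p \<and> (\<forall>e>0. \<exists>f\<in>vcarrier Cc. Lp_norm M p (\<lambda>x. g x - f x) < e)" for g
  have P_close: "P g" if g: "g \<in> Lp_fun M p" and h: "\<And>e. 0 < e \<Longrightarrow> \<exists>h. P h \<and> Lp_norm M p (\<lambda>x. g x - h x) < e" for g
    unfolding P_def
  proof (intro conjI g allI impI)
    fix e :: real assume "0 < e"
    then obtain h where h: "P h" "Lp_norm M p (\<lambda>x. g x - h x) < e / 2"
      using h[of "e / 2"] by auto
    then obtain f where f: "f \<in> vcarrier Cc" "Lp_norm M p (\<lambda>x. h x - f x) < e / 2"
      using \<open>0 < e\<close> unfolding P_def by (meson half_gt_zero)
    have "Lp_norm M p (\<lambda>x. g x - f x) < e"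
      using Lp_norm_diff_triangle[OF g _ Cc_Lp_fun[OF f(1) p0(2)] p, of h] h f by (simp add: P_def)
    then show "\<exists>f\<in>vcarrier Cc. Lp_norm M p (\<lambda>x. g x - f x) < e"
      using f by blast
  qed
  have P_zero: "P (\<lambda>x. 0)"
    unfolding P_def using Cc_zero p0 by (auto simp: Lp_fun_zero Lp_norm_def intro!: bexI[of _ "\<lambda>x. 0"])
  have P_add: "P (\<lambda>x. g x + h x)" if gh: "P g" "P h" for g h
    unfolding P_def
  proof (intro conjI allI impI)
    show "(\<lambda>x. g x + h x) \<in> Lp_fun M p"
      using gh p0 by (simp add: P_def Lp_fun_add)
    fix e :: real assume "0 < e"
    then have "0 < e / 2" by simp
    then obtain f k where f: "f \<in> vcarrier Cc" "Lp_norm M p (\<lambda>x. g x - f x) < e / 2"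
      and k: "k \<in> vcarrier Cc" "Lp_norm M p (\<lambda>x. h x - k x) < e / 2"
      using gh unfolding P_def by meson
    have "(\<lambda>x. g x + h x - (f x + k x)) = (\<lambda>x. (g x - f x) + (h x - k x))"
      by auto
    then have "Lp_norm M p (\<lambda>x. g x + h x - (f x + k x)) < e"
      using Minkowski_inequality[of "\<lambda>x. g x - f x" M p "\<lambda>x. h x - k x"] f k gh p
      by (simp add: P_def Lp_fun_diff Cc_Lp_fun del: Cc_simps)
    then show "\<exists>f\<in>vcarrier Cc. Lp_norm M p (\<lambda>x. g x + h x - f x) < e"
      using Cc_add[OF f(1) k(1)] by (intro bexI[of _ "\<lambda>x. f x + k x"])
  qed
  have P_indicator: "P (\<lambda>x. y * indicator A x)" if A: "A \<in> sets M" "emeasure M A < \<infinity>" for y A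
    unfolding P_def
  proof (intro conjI allI impI)
    note [measurable] = A(1)
    have "integrable M (\<lambda>x. \<bar>y\<bar> powr p * indicator A x)"
      using A by (simp add: integrable_indicator_iff)
    also have "(\<lambda>x. \<bar>y\<bar> powr p * indicator A x) = (\<lambda>x. \<bar>y * indicator A x\<bar> powr p)"
      by (auto simp: indicator_def)
    finally show Lp: "(\<lambda>x. y * indicator A x) \<in> Lp_fun M p"
      by (simp add: Lp_fun_def)
    fix e :: real assume e: "0 < e"
    \<comment> \<open>Chosen so that |y|^p d is the p-th power of e |y| / (|y| + 1), which is below
      e; the + 1 also covers y = 0.\<close>
    define d where "d = (e / (\<bar>y\<bar> + 1)) powr p"
    have d: "0 < d"
      using e by (simp add: d_def)
    obtain f D where f: "f \<in> vcarrier Cc" "\<And>x. 0 \<le> f x" "\<And>x. f x \<le> 1"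
      and D: "D \<in> sets M" "emeasure M D < ennreal d" "\<And>x. x \<notin> D \<Longrightarrow> f x = indicator A x"
      using indicator_approx[OF A d] by blast
    have Df: "emeasure M D < \<infinity>"
      using D(2) by (metis ennreal_less_top infinity_ennreal_def order_less_trans)
    have "(\<integral>x. \<bar>y * indicator A x - y * f x\<bar> powr p \<partial>M) \<le> (\<integral>x. \<bar>y\<bar> powr p * indicator D x \<partial>M)"
    proof (rule integral_mono)
      show "integrable M (\<lambda>x. \<bar>y * indicator A x - y * f x\<bar> powr p)"
        using Lp Lp_fun_scale[OF Cc_Lp_fun[OF f(1) p0(2)]] p0 by (intro Lp_fun_integrable Lp_fun_diff)
      show "integrable M (\<lambda>x. \<bar>y\<bar> powr p * indicator D x)"
        using D Df by simp
      show "\<bar>y * indicator A x - y * f x\<bar> powr p \<le> \<bar>y\<bar> powr p * indicator D x" for x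
      proof (cases "x \<in> D")
        case True
        have "\<bar>y * indicator A x - y * f x\<bar> = \<bar>y\<bar> * \<bar>indicator A x - f x\<bar>"
          by (simp add: abs_mult[symmetric] right_diff_distrib)
        also have "\<dots> \<le> \<bar>y\<bar> * 1"
          using f(2,3)[of x] by (intro mult_left_mono) (auto simp: indicator_def)
        finally show ?thesis
          using True p0 by (auto intro: powr_mono2)
      qed (simp add: D)
    qed
    also have "\<dots> = \<bar>y\<bar> powr p * measure M D"
      using D Df by simp
    also have "\<dots> \<le> \<bar>y\<bar> powr p * d"
      using d unfolding measure_def by (intro mult_left_mono enn2real_leI less_imp_le[OF D(2)]) auto
    also have "\<dots> = (\<bar>y\<bar> * (e / (\<bar>y\<bar> + 1))) powr p"
      using powr_mult[of "\<bar>y\<bar>" "e / (\<bar>y\<bar> + 1)" p] by (simp add: d_def)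
    also have "\<dots> < e powr p"
      using e p0 by (intro powr_less_mono2) (auto simp: field_simps)
    finally have "Lp_norm M p (\<lambda>x. y * indicator A x - y * f x) < e"
      using e p0 by (simp add: Lp_norm_less_iff)
    then show "\<exists>f\<in>vcarrier Cc. Lp_norm M p (\<lambda>x. y * indicator A x - f x) < e"
      using Cc_scale[OF f(1)] by (intro bexI[of _ "\<lambda>x. y * f x"])
  qed
  have P_simple: "P s" if s: "simple_function M s" "s \<in> Lp_fun M p" for s
  proof -
    have [measurable]: "s \<in> borel_measurable M"
      using s by (rule_tac Lp_fun_measurable)
    have fin: "finite (range s)"
      using s by (simp add: simple_function_def)
    \<comment> \<open>The level set of 0 may have infinite measure, but its term is the zero
      function. On any other level set |s|^p is the positive constant |y|^p, so integrability forces
      finite measure.\<close>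
    have ind: "P (\<lambda>x. y * indicator (s -` {y}) x)" for y
    proof (cases "y = 0")
      case False
      have A: "s -` {y} \<in> sets M"
        using measurable_sets[of s M borel "{y}"] by simp
      have "integrable M (\<lambda>x. \<bar>y\<bar> powr p * indicator (s -` {y}) x)"
        using Lp_fun_integrable[OF s(2)] A
        by (elim Bochner_Integration.integrable_bound) (auto simp: indicator_def)
      then have "emeasure M (s -` {y}) < \<infinity>"
        using False A by (simp add: integrable_indicator_iff)
      with A show ?thesis
        by (rule P_indicator)
    qed (simp add: P_zero)
    have "P (\<lambda>x. \<Sum>y\<in>F. y * indicator (s -` {y}) x)" if "finite F" for F
      using that
    proof (induction F)
      case (insert y F)
      show ?case
        unfolding sum.insert[OF insert.hyps] by (rule P_add[OF ind insert.IH])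
    qed (simp add: P_zero)
    from this[OF fin] show ?thesis
      using fin by (simp add: indicator_def of_bool_def if_distrib sum.delta' cong: if_cong)
  qed
  have "P g"
  proof (rule P_close[OF g])
    fix e :: real assume e: "0 < e"
    note [measurable] = Lp_fun_measurable[OF g]
    obtain s where s: "\<And>i. simple_function M (s i)" "\<And>x. (\<lambda>i. s i x) \<longlonglongrightarrow> g x"
        "\<And>i x. \<bar>s i x\<bar> \<le> 2 * \<bar>g x\<bar>"
      using borel_measurable_implies_sequence_metric[of g M 0] by (auto simp: dist_real_def)
    have sLp: "s i \<in> Lp_fun M p" for i
      using Lp_fun_scale[OF g, of 2] by (rule Lp_fun_bound)
        (use s p0 in \<open>auto intro: borel_measurable_simple_function simp: abs_mult\<close>)
    \<comment> \<open>The dominating function 3 |g| is 2 |g| for \<open>s i\<close> plus |g| for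
      \<open>g\<close>.\<close>
    have "(\<lambda>i. \<integral>x. \<bar>s i x - g x\<bar> powr p \<partial>M) \<longlonglongrightarrow> 0"
    proof (rule Lp_norm_dominated_convergence[OF Lp_fun_scale[OF g, of 3]])
      show "AE x in M. \<bar>s n x - g x\<bar> \<le> \<bar>3 * g x\<bar>" for n
        using s(3)[of n] by (intro AE_I2) (smt (verit) abs_mult)
    qed (use s p0 in \<open>auto intro: borel_measurable_simple_function\<close>)
    then have "\<forall>\<^sub>F i in sequentially. (\<integral>x. \<bar>s i x - g x\<bar> powr p \<partial>M) < e powr p"
      by (rule order_tendstoD(2)) (use e in simp)
    then obtain i where "(\<integral>x. \<bar>s i x - g x\<bar> powr p \<partial>M) < e powr p"
      by (auto simp: eventually_sequentially)
    then have "Lp_norm M p (\<lambda>x. g x - s i x) < e"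
      using e p0 by (simp add: Lp_norm_less_iff abs_minus_commute)
    then show "\<exists>h. P h \<and> Lp_norm M p (\<lambda>x. g x - h x) < e"
      using P_simple[OF s(1) sLp] by blast
  qed
  then show ?thesis
    using e by (simp add: P_def)
qed

text \<open>Null sets on all compact sets need not add up to a null set, as there may be uncountably
  many of them. For p-integrable \<open>g\<close>, however, the set where \<open>g\<close> is
  nonzero is a countable union of sets \<open>A n\<close> of finite measure, and each
  \<open>A n\<close> is filled up to any \<open>e\<close> by a compact subset, which is null by
  hypothesis.\<close>

lemma AE_eq_0I:
  assumes g: "g \<in> Lp_fun M p" and p: "0 < p"
    and K: "\<And>K. compact K \<Longrightarrow> AE x in M. x \<in> K \<longrightarrow> g x = 0"
  shows "AE x in M. g x = 0"
proof -
  note [measurable] = Lp_fun_measurable[OF g]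
  define A where "A n = {x. 1 / Suc n \<le> \<bar>g x\<bar>}" for n
  have A: "A n \<in> sets M" for n
  proof -
    have "{x \<in> space M. 1 / Suc n \<le> \<bar>g x\<bar>} \<in> sets M"
      by measurable
    then show ?thesis
      by (simp add: A_def)
  qed
  have "emeasure M (A n) = 0" for n
  proof -
    have "integrable M (\<lambda>x. (1 / Suc n) powr p * indicator (A n) x)"
      using Lp_fun_integrable[OF g] A p
      by (elim Bochner_Integration.integrable_bound) (auto simp: A_def indicator_def intro!: powr_mono2)
    then have fin: "emeasure M (A n) < \<infinity>"
      using A by (simp add: integrable_indicator_iff)
    have "emeasure M (A n) \<le> 0 + ennreal e" if e: "0 < e" for e
    proof -
      obtain K V where KV: "compact K" "open V" "K \<subseteq> A n" "A n \<subseteq> V" "emeasure M (V - K) < ennreal e"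
        using compact_open_sandwich[OF A fin e] by blast
      have "AE x in M. x \<notin> K"
        using K[OF KV(1)] by eventually_elim (use KV(3) in \<open>auto simp: A_def\<close>)
      then have K0: "emeasure M K = 0"
        using compact_sets[OF KV(1)] by (simp add: AE_iff_measurable[OF _ refl])
      have "emeasure M (A n) \<le> emeasure M (K \<union> (V - K))"
        using KV by (intro emeasure_mono) (auto simp: borel_compact intro!: sets.Un sets.Diff)
      also have "\<dots> \<le> emeasure M K + emeasure M (V - K)"
        using KV by (intro emeasure_subadditive) (auto simp: borel_compact)
      finally show ?thesis
        using K0 KV(5) by simp
    qed
    then show ?thesis
      by (metis ennreal_le_epsilon le_zero_eq)
  qed
  then have "AE x in M. \<forall>n. x \<notin> A n"
    using A by (simp add: AE_all_countable AE_iff_measurable[OF _ refl])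
  then show ?thesis
  proof eventually_elim
    case (elim x)
    show ?case
    proof (rule ccontr)
      assume "g x \<noteq> 0"
      then obtain n where "1 / Suc n < \<bar>g x\<bar>"
        using nat_approx_posE[of "\<bar>g x\<bar>"] by auto
      then have "x \<in> A n"
        by (simp add: A_def)
      then show False
        using elim by blast
    qed
  qed
qed

end

section \<open>The order dual of \<open>C\<^sub>c\<close>\<close>

lemma Cc_dual_simps:
  "vzero Cc_dual = (\<lambda>f\<in>vcarrier Cc. 0)"
  "vadd Cc_dual \<phi> \<psi> = (\<lambda>f\<in>vcarrier Cc. \<phi> f + \<psi> f)"
  "vscale Cc_dual a \<phi> = (\<lambda>f\<in>vcarrier Cc. a * \<phi> f)"
  "vminus Cc_dual \<phi> = (\<lambda>f\<in>vcarrier Cc. - \<phi> f)"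
  "vle Cc_dual \<phi> \<psi> \<longleftrightarrow> (\<forall>f\<in>vcarrier Cc. (\<forall>x. 0 \<le> f x) \<longrightarrow> \<phi> f \<le> \<psi> f)"
  unfolding order_dual_def vminus_def ovs.simps Cc_simps(2,5) by simp_all

lemma Cc_dualD:
  fixes \<phi> :: "('a::t2_space \<Rightarrow> real) \<Rightarrow> real"
  assumes \<phi>: "\<phi> \<in> vcarrier Cc_dual"
  shows Cc_dual_extensional: "\<phi> \<in> extensional (vcarrier Cc)"
    and Cc_dual_add: "\<lbrakk>f \<in> vcarrier Cc; g \<in> vcarrier Cc\<rbrakk> \<Longrightarrow> \<phi> (\<lambda>x. f x + g x) = \<phi> f + \<phi> g"
    and Cc_dual_scale: "f \<in> vcarrier Cc \<Longrightarrow> \<phi> (\<lambda>x. c * f x) = c * \<phi> f"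
    and Cc_dual_bounded: "a \<in> vcarrier Cc \<Longrightarrow> b \<in> vcarrier Cc \<Longrightarrow>
      \<exists>C. \<forall>f\<in>vcarrier Cc. (\<forall>x. a x \<le> f x \<and> f x \<le> b x) \<longrightarrow> \<bar>\<phi> f\<bar> \<le> C"
proof -
  show "\<phi> \<in> extensional (vcarrier Cc)"
    "\<lbrakk>f \<in> vcarrier Cc; g \<in> vcarrier Cc\<rbrakk> \<Longrightarrow> \<phi> (\<lambda>x. f x + g x) = \<phi> f + \<phi> g"
    "f \<in> vcarrier Cc \<Longrightarrow> \<phi> (\<lambda>x. c * f x) = c * \<phi> f"
    using \<phi> by (simp_all add: order_dual_def)
  assume ab: "a \<in> vcarrier Cc" "b \<in> vcarrier Cc"
  let ?A = "{f \<in> vcarrier Cc. vle Cc a f \<and> vle Cc f b}"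
  have "order_bounded Cc ?A"
    unfolding order_bounded_def using ab by blast
  then obtain l u where "\<phi> ` ?A \<subseteq> {l..u}"
    using \<phi> unfolding order_dual_def by auto
  then have "\<forall>f\<in>?A. \<bar>\<phi> f\<bar> \<le> max \<bar>l\<bar> \<bar>u\<bar>"
    by (force simp: image_subset_iff)
  then show "\<exists>C. \<forall>f\<in>vcarrier Cc. (\<forall>x. a x \<le> f x \<and> f x \<le> b x) \<longrightarrow> \<bar>\<phi> f\<bar> \<le> C"
    by (intro exI[of _ "max \<bar>l\<bar> \<bar>u\<bar>"]) auto
qed

lemma Cc_dualI:
  fixes \<phi> :: "('a::t2_space \<Rightarrow> real) \<Rightarrow> real"
  assumes "\<phi> \<in> extensional (vcarrier Cc)"
    and "\<And>f g. \<lbrakk>f \<in> vcarrier Cc; g \<in> vcarrier Cc\<rbrakk> \<Longrightarrow> \<phi> (\<lambda>x. f x + g x) = \<phi> f + \<phi> g"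
    and "\<And>f a. f \<in> vcarrier Cc \<Longrightarrow> \<phi> (\<lambda>x. a * f x) = a * \<phi> f"
    and bd: "\<And>a b. a \<in> vcarrier Cc \<Longrightarrow> b \<in> vcarrier Cc \<Longrightarrow>
      \<exists>C. \<forall>f\<in>vcarrier Cc. (\<forall>x. a x \<le> f x \<and> f x \<le> b x) \<longrightarrow> \<bar>\<phi> f\<bar> \<le> C"
  shows "\<phi> \<in> vcarrier Cc_dual"
proof -
  have "\<exists>l u. \<phi> ` A \<subseteq> {l..u}" if "order_bounded Cc A" for A
  proof -
    from that obtain a b where ab: "a \<in> vcarrier Cc" "b \<in> vcarrier Cc"
      and A: "A \<subseteq> {f \<in> vcarrier Cc. vle Cc a f \<and> vle Cc f b}"
      unfolding order_bounded_def by blast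
    obtain C where "\<forall>f\<in>vcarrier Cc. (\<forall>x. a x \<le> f x \<and> f x \<le> b x) \<longrightarrow> \<bar>\<phi> f\<bar> \<le> C"
      using bd[OF ab] by blast
    then have "\<forall>f\<in>A. \<bar>\<phi> f\<bar> \<le> C"
      using A by fastforce
    then have "\<phi> ` A \<subseteq> {-C..C}"
      by (auto simp: abs_le_iff minus_le_iff)
    then show ?thesis
      by blast
  qed
  then show ?thesis
    using assms(1-3) by (simp add: order_dual_def)
qed

lemma Cc_dual_diff:
  fixes \<phi> :: "('a::t2_space \<Rightarrow> real) \<Rightarrow> real"
  assumes \<phi>: "\<phi> \<in> vcarrier Cc_dual" and "f \<in> vcarrier Cc" "g \<in> vcarrier Cc"
  shows "\<phi> (\<lambda>x. f x - g x) = \<phi> f - \<phi> g"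
  using Cc_dual_add[OF \<phi> assms(2) Cc_scale[OF assms(3), of "-1"]] Cc_dual_scale[OF \<phi> assms(3), of "-1"]
  by simp

lemma Cc_dual_zero:
  fixes \<phi> :: "('a::t2_space \<Rightarrow> real) \<Rightarrow> real"
  assumes "\<phi> \<in> vcarrier Cc_dual"
  shows "\<phi> (\<lambda>x. 0) = 0"
  using Cc_dual_diff[OF assms Cc_zero Cc_zero] by simp

lemma Cc_dual_eqI:
  fixes \<phi> \<psi> :: "('a::t2_space \<Rightarrow> real) \<Rightarrow> real"
  assumes \<phi>: "\<phi> \<in> vcarrier Cc_dual" and \<psi>: "\<psi> \<in> vcarrier Cc_dual"
    and eq: "\<And>f. \<lbrakk>f \<in> vcarrier Cc; \<And>x. 0 \<le> f x\<rbrakk> \<Longrightarrow> \<phi> f = \<psi> f"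
  shows "\<phi> = \<psi>"
proof (rule extensionalityI[OF Cc_dual_extensional[OF \<phi>] Cc_dual_extensional[OF \<psi>]])
  fix f :: "'a \<Rightarrow> real" assume f: "f \<in> vcarrier Cc"
  have "f = (\<lambda>x. max (f x) 0 - max (- f x) 0)"
    by auto
  then show "\<phi> f = \<psi> f"
    using Cc_dual_diff[OF \<phi> Cc_max0[OF f] Cc_neg0[OF f]] Cc_dual_diff[OF \<psi> Cc_max0[OF f] Cc_neg0[OF f]]
      eq[OF Cc_max0[OF f]] eq[OF Cc_neg0[OF f]] by simp
qed

text \<open>Kantorovich's extension: an additive, positively homogeneous function on the positive
  cone extends linearly through \<open>f = f\<^sup>+ - f\<^sup>-\<close>. Nonnegativity makes the
  extension monotone, which gives order boundedness.\<close>

lemma Cc_dual_extend: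
  fixes s :: "('a::t2_space \<Rightarrow> real) \<Rightarrow> real"
  assumes nonneg: "\<And>f. \<lbrakk>f \<in> vcarrier Cc; \<And>x. 0 \<le> f x\<rbrakk> \<Longrightarrow> 0 \<le> s f"
    and add: "\<And>f g. \<lbrakk>f \<in> vcarrier Cc; \<And>x. 0 \<le> f x; g \<in> vcarrier Cc; \<And>x. 0 \<le> g x\<rbrakk> \<Longrightarrow>
      s (\<lambda>x. f x + g x) = s f + s g"
    and scale: "\<And>f c. \<lbrakk>f \<in> vcarrier Cc; \<And>x. 0 \<le> f x; 0 < c\<rbrakk> \<Longrightarrow> s (\<lambda>x. c * f x) = c * s f"
  obtains T where "T \<in> vcarrier Cc_dual" "\<And>f. \<lbrakk>f \<in> vcarrier Cc; \<And>x. 0 \<le> f x\<rbrakk> \<Longrightarrow> T f = s f"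
proof -
  define T where "T = (\<lambda>f\<in>vcarrier Cc. s (\<lambda>x. max (f x) 0) - s (\<lambda>x. max (- f x) 0))"
  have s0: "s (\<lambda>x. 0) = 0"
    using add[of "\<lambda>x. 0" "\<lambda>x. 0"] Cc_zero by simp
  \<comment> \<open>The value of \<open>T\<close> does not depend on how a function is written as a
    difference of positive ones, because \<open>f\<^sup>+ + b = f\<^sup>- + a\<close> for
    \<open>f = a - b\<close>. Linearity follows by choosing convenient representations.\<close>
  have T_diff: "T (\<lambda>x. a x - b x) = s a - s b"
    if a: "a \<in> vcarrier Cc" "\<And>x. 0 \<le> a x" and b: "b \<in> vcarrier Cc" "\<And>x. 0 \<le> b x" for a b
  proof -
    let ?f = "\<lambda>x. a x - b x"
    have f: "?f \<in> vcarrier Cc"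
      using a b by (intro Cc_intros)
    have "s (\<lambda>x. max (?f x) 0) + s b = s (\<lambda>x. max (?f x) 0 + b x)"
      using add[OF Cc_max0[OF f] _ b] by simp
    also have "(\<lambda>x. max (?f x) 0 + b x) = (\<lambda>x. max (- ?f x) 0 + a x)"
      by auto
    also have "s \<dots> = s (\<lambda>x. max (- ?f x) 0) + s a"
      using add[OF Cc_neg0[OF f] _ a] by simp
    finally show ?thesis
      using f unfolding T_def restrict_apply'[OF f] by linarith
  qed
  have T_pos: "T f = s f" if f: "f \<in> vcarrier Cc" "\<And>x. 0 \<le> f x" for f
    using T_diff[OF f Cc_zero] s0 by simp
  have T_eq: "T f = s (\<lambda>x. max (f x) 0) - s (\<lambda>x. max (- f x) 0)" if "f \<in> vcarrier Cc" for f
    using that unfolding T_def by (rule restrict_apply')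
  have T_add: "T (\<lambda>x. f x + g x) = T f + T g" if f: "f \<in> vcarrier Cc" and g: "g \<in> vcarrier Cc" for f g
  proof -
    let ?a = "\<lambda>x. max (f x) 0 + max (g x) 0" and ?b = "\<lambda>x. max (- f x) 0 + max (- g x) 0"
    have "T (\<lambda>x. ?a x - ?b x) = s ?a - s ?b"
      using f g by (intro T_diff Cc_intros) auto
    also have "(\<lambda>x. ?a x - ?b x) = (\<lambda>x. f x + g x)"
      by auto
    also have "s ?a = s (\<lambda>x. max (f x) 0) + s (\<lambda>x. max (g x) 0)"
      using f g by (intro add Cc_intros) auto
    also have "s ?b = s (\<lambda>x. max (- f x) 0) + s (\<lambda>x. max (- g x) 0)"
      using f g by (intro add Cc_intros) auto
    finally show ?thesis
      using T_eq[OF f] T_eq[OF g] by simp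
  qed
  have T_scale: "T (\<lambda>x. c * f x) = c * T f" if f: "f \<in> vcarrier Cc" for f c
  proof -
    have pos: "T (\<lambda>x. c * g x) = c * T g" if c: "0 < c" and g: "g \<in> vcarrier Cc" for c g
    proof -
      let ?a = "\<lambda>x. c * max (g x) 0" and ?b = "\<lambda>x. c * max (- g x) 0"
      have "T (\<lambda>x. ?a x - ?b x) = s ?a - s ?b"
        using c g by (intro T_diff Cc_intros) auto
      also have "(\<lambda>x. ?a x - ?b x) = (\<lambda>x. c * g x)"
        by (auto simp: max_def)
      also have "s ?a = c * s (\<lambda>x. max (g x) 0)"
        using c g by (intro scale Cc_intros) auto
      also have "s ?b = c * s (\<lambda>x. max (- g x) 0)"
        using c g by (intro scale Cc_intros) auto
      finally show ?thesis
        using T_eq[OF g] by (simp add: right_diff_distrib)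
    qed
    have T0: "T (\<lambda>x. 0) = 0"
      using T_pos[OF Cc_zero] s0 by simp
    have neg: "T (\<lambda>x. - g x) = - T g" if g: "g \<in> vcarrier Cc" for g
      using T_add[OF g Cc_uminus[OF g]] T0 by simp
    consider "0 < c" | "c = 0" | "0 < - c"
      by linarith
    then show ?thesis
    proof cases
      case 1
      then show ?thesis
        by (rule pos[OF _ f])
    next
      case 2
      then show ?thesis
        using T0 by simp
    next
      case 3
      then show ?thesis
        using pos[OF 3 Cc_uminus[OF f]] neg[OF f] by simp
    qed
  qed
  have "T \<in> vcarrier Cc_dual"
  proof (rule Cc_dualI)
    fix a b :: "'a \<Rightarrow> real" assume a: "a \<in> vcarrier Cc" and b: "b \<in> vcarrier Cc"
    have mono: "T f \<le> T g" if fg: "f \<in> vcarrier Cc" "g \<in> vcarrier Cc" "\<And>x. f x \<le> g x" for f g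
    proof -
      have "0 \<le> s (\<lambda>x. g x - f x)"
        using fg by (intro nonneg Cc_intros) auto
      also have "\<dots> = T (\<lambda>x. g x - f x)"
        using fg by (intro T_pos[symmetric] Cc_intros) auto
      finally show ?thesis
        using T_add[OF fg(1) Cc_diff[OF fg(2,1)]] by simp
    qed
    show "\<exists>C. \<forall>f\<in>vcarrier Cc. (\<forall>x. a x \<le> f x \<and> f x \<le> b x) \<longrightarrow> \<bar>T f\<bar> \<le> C"
    proof (intro exI[of _ "max \<bar>T a\<bar> \<bar>T b\<bar>"] ballI impI)
      fix f :: "'a \<Rightarrow> real" assume f: "f \<in> vcarrier Cc" "\<forall>x. a x \<le> f x \<and> f x \<le> b x"
      have "T a \<le> T f" "T f \<le> T b"
        using f by (auto intro!: mono a b simp del: Cc_simps)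
      then show "\<bar>T f\<bar> \<le> max \<bar>T a\<bar> \<bar>T b\<bar>"
        by linarith
    qed
  next
    show "T \<in> extensional (vcarrier Cc)"
      by (simp add: T_def)
  qed (fact T_add T_scale)+
  then show ?thesis
    using T_pos that by blast
qed

lemma ordered_vector_space_Cc_dual:
  "ordered_vector_space (Cc_dual :: (('a::t2_space \<Rightarrow> real) \<Rightarrow> real) ovs)"
proof
  show "vzero Cc_dual \<in> vcarrier (Cc_dual :: (('a \<Rightarrow> real) \<Rightarrow> real) ovs)"
    unfolding Cc_dual_simps by (rule Cc_dualI) (auto simp del: Cc_simps simp: Cc_intros)
next
  fix \<phi> \<psi> :: "('a \<Rightarrow> real) \<Rightarrow> real"
  assume \<phi>: "\<phi> \<in> vcarrier Cc_dual" and \<psi>: "\<psi> \<in> vcarrier Cc_dual"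
  show "vadd Cc_dual \<phi> \<psi> \<in> vcarrier Cc_dual"
    unfolding Cc_dual_simps
  proof (rule Cc_dualI)
    fix a b :: "'a \<Rightarrow> real" assume ab: "a \<in> vcarrier Cc" "b \<in> vcarrier Cc"
    obtain C D where "\<forall>f\<in>vcarrier Cc. (\<forall>x. a x \<le> f x \<and> f x \<le> b x) \<longrightarrow> \<bar>\<phi> f\<bar> \<le> C"
      "\<forall>f\<in>vcarrier Cc. (\<forall>x. a x \<le> f x \<and> f x \<le> b x) \<longrightarrow> \<bar>\<psi> f\<bar> \<le> D"
      using Cc_dual_bounded[OF \<phi> ab] Cc_dual_bounded[OF \<psi> ab] by blast
    then show "\<exists>C. \<forall>f\<in>vcarrier Cc. (\<forall>x. a x \<le> f x \<and> f x \<le> b x) \<longrightarrow>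
        \<bar>(\<lambda>f\<in>vcarrier Cc. \<phi> f + \<psi> f) f\<bar> \<le> C"
      by (intro exI[of _ "C + D"]) (fastforce simp del: Cc_simps)
  qed (auto simp del: Cc_simps simp: Cc_intros Cc_dual_add[OF \<phi>] Cc_dual_add[OF \<psi>]
      Cc_dual_scale[OF \<phi>] Cc_dual_scale[OF \<psi>] distrib_left)
next
  fix \<phi> :: "('a \<Rightarrow> real) \<Rightarrow> real" and c
  assume \<phi>: "\<phi> \<in> vcarrier Cc_dual"
  show "vscale Cc_dual c \<phi> \<in> vcarrier Cc_dual"
    unfolding Cc_dual_simps
  proof (rule Cc_dualI)
    fix a b :: "'a \<Rightarrow> real" assume ab: "a \<in> vcarrier Cc" "b \<in> vcarrier Cc"
    obtain C where "\<forall>f\<in>vcarrier Cc. (\<forall>x. a x \<le> f x \<and> f x \<le> b x) \<longrightarrow> \<bar>\<phi> f\<bar> \<le> C"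
      using Cc_dual_bounded[OF \<phi> ab] by blast
    then show "\<exists>C. \<forall>f\<in>vcarrier Cc. (\<forall>x. a x \<le> f x \<and> f x \<le> b x) \<longrightarrow>
        \<bar>(\<lambda>f\<in>vcarrier Cc. c * \<phi> f) f\<bar> \<le> C"
      by (intro exI[of _ "\<bar>c\<bar> * C"]) (auto simp del: Cc_simps simp: abs_mult intro!: mult_left_mono)
  qed (auto simp del: Cc_simps simp: Cc_intros Cc_dual_add[OF \<phi>]
      Cc_dual_scale[OF \<phi>] distrib_left)
  show "vadd Cc_dual \<phi> (vzero Cc_dual) = \<phi>" "vscale Cc_dual 1 \<phi> = \<phi>"
    using Cc_dual_extensional[OF \<phi>]
    by (auto simp del: Cc_simps simp: Cc_dual_simps restrict_def extensional_def fun_eq_iff)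
next
  fix \<phi> \<psi> :: "('a \<Rightarrow> real) \<Rightarrow> real"
  assume "\<phi> \<in> vcarrier Cc_dual" "\<psi> \<in> vcarrier Cc_dual" "vle Cc_dual \<phi> \<psi>" "vle Cc_dual \<psi> \<phi>"
  then show "\<phi> = \<psi>"
    by (intro Cc_dual_eqI) (auto simp del: Cc_simps simp: Cc_dual_simps intro: antisym)
next
  fix \<phi> \<psi> \<theta> :: "('a \<Rightarrow> real) \<Rightarrow> real"
  assume "vle Cc_dual \<phi> \<psi>" "vle Cc_dual \<psi> \<theta>"
  then show "vle Cc_dual \<phi> \<theta>"
    by (auto simp del: Cc_simps simp: Cc_dual_simps intro: order_trans)
qed (auto simp del: Cc_simps simp: Cc_dual_simps restrict_def fun_eq_iff algebra_simps mult_left_mono)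

text \<open>Riesz--Kantorovich: the positive part at \<open>f \<ge> 0\<close> is the supremum of \<open>\<phi>\<close> over \<open>[0, f]\<close>.\<close>

lemma Cc_dual_sup_zero:
  fixes \<phi> :: "('a::t2_space \<Rightarrow> real) \<Rightarrow> real"
  assumes \<phi>: "\<phi> \<in> vcarrier Cc_dual"
  shows "\<exists>\<sigma>. is_sup_in Cc_dual {\<phi>, vzero Cc_dual} \<sigma>"
proof -
  define I where "I f = {g \<in> vcarrier Cc. \<forall>x. 0 \<le> g x \<and> g x \<le> f x}" for f :: "'a \<Rightarrow> real"
  define s where "s f = Sup (\<phi> ` I f)" for f
  have bdd: "bdd_above (\<phi> ` I f)" if "f \<in> vcarrier Cc" for f
  proof -
    obtain C where "\<forall>g\<in>vcarrier Cc. (\<forall>x. 0 \<le> g x \<and> g x \<le> f x) \<longrightarrow> \<bar>\<phi> g\<bar> \<le> C"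
      using Cc_dual_bounded[OF \<phi> Cc_zero \<open>f \<in> vcarrier Cc\<close>] by blast
    then show ?thesis
      by (intro bdd_aboveI[of _ C]) (fastforce simp: I_def simp del: Cc_simps)
  qed
  have le_s: "\<phi> g \<le> s f" if "f \<in> vcarrier Cc" "g \<in> I f" for f g
    unfolding s_def using bdd[OF that(1)] that(2) by (intro cSup_upper) auto
  have s_le: "s f \<le> c" if "\<And>x. 0 \<le> f x" "\<And>g. g \<in> I f \<Longrightarrow> \<phi> g \<le> c" for f c
    unfolding s_def using that Cc_zero by (intro cSup_least) (auto simp: I_def simp del: Cc_simps)
  have I0: "(\<lambda>x. 0) \<in> I f" if "\<And>x. 0 \<le> f x" for f
    using that Cc_zero by (simp add: I_def del: Cc_simps)
  have s_nonneg: "0 \<le> s f" if "f \<in> vcarrier Cc" "\<And>x. 0 \<le> f x" for f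
    using le_s[OF that(1) I0[OF that(2)]] Cc_dual_zero[OF \<phi>] by simp
  have s_add: "s (\<lambda>x. f x + g x) = s f + s g"
    if f: "f \<in> vcarrier Cc" "\<And>x. 0 \<le> f x" and g: "g \<in> vcarrier Cc" "\<And>x. 0 \<le> g x" for f g
  proof (rule antisym)
    show "s (\<lambda>x. f x + g x) \<le> s f + s g"
    proof (rule s_le)
      fix k assume k: "k \<in> I (\<lambda>x. f x + g x)"
      \<comment> \<open>Riesz decomposition: an element of the interval [0, f + g] splits into one
        of [0, f] and one of [0, g].\<close>
      let ?k1 = "\<lambda>x. min (k x) (f x)" and ?k2 = "\<lambda>x. k x - min (k x) (f x)"
      have kC: "k \<in> vcarrier Cc" and k0: "\<And>x. 0 \<le> k x" "\<And>x. k x \<le> f x + g x"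
        using k by (auto simp: I_def simp del: Cc_simps)
      have k1: "?k1 \<in> I f" "?k2 \<in> I g"
      proof -
        have "0 \<le> ?k1 x \<and> ?k1 x \<le> f x \<and> 0 \<le> ?k2 x \<and> ?k2 x \<le> g x" for x
          using k0[of x] f(2)[of x] g(2)[of x] by linarith
        then show "?k1 \<in> I f" "?k2 \<in> I g"
          using kC f g by (simp_all add: I_def Cc_intros del: Cc_simps)
      qed
      then have "\<phi> k = \<phi> ?k1 + \<phi> ?k2"
        using Cc_dual_add[OF \<phi>, of ?k1 ?k2] by (simp add: I_def del: Cc_simps)
      also have "\<dots> \<le> s f + s g"
        using k1 f g by (intro add_mono le_s)
      finally show "\<phi> k \<le> s f + s g" .
    qed (use f g in auto)
    \<comment> \<open>Superadditivity: fix a competitor for \<open>f\<close>, take the supremum over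
      those for \<open>g\<close>, then let the first one vary.\<close>
    have "s f \<le> s (\<lambda>x. f x + g x) - s g"
    proof (rule s_le)
      fix k assume k: "k \<in> I f"
      have "s g \<le> s (\<lambda>x. f x + g x) - \<phi> k"
      proof (rule s_le)
        fix l assume l: "l \<in> I g"
        have "(\<lambda>x. k x + l x) \<in> I (\<lambda>x. f x + g x)"
          using k l by (auto simp: I_def Cc_intros intro: add_mono simp del: Cc_simps)
        then have "\<phi> (\<lambda>x. k x + l x) \<le> s (\<lambda>x. f x + g x)"
          using f g by (intro le_s Cc_intros)
        then show "\<phi> l \<le> s (\<lambda>x. f x + g x) - \<phi> k"
          using k l Cc_dual_add[OF \<phi>, of k l] by (simp add: I_def del: Cc_simps)
      qed (fact g)
      then show "\<phi> k \<le> s (\<lambda>x. f x + g x) - s g"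
        by simp
    qed (fact f)
    then show "s f + s g \<le> s (\<lambda>x. f x + g x)"
      by simp
  qed
  have s_scale_le: "c * s f \<le> s (\<lambda>x. c * f x)"
    if f: "f \<in> vcarrier Cc" "\<And>x. 0 \<le> f x" and c: "0 < c" for f c
  proof -
    have "s f \<le> s (\<lambda>x. c * f x) / c"
    proof (rule s_le[OF f(2)])
      fix g assume g: "g \<in> I f"
      then have "(\<lambda>x. c * g x) \<in> I (\<lambda>x. c * f x)"
        using c by (auto simp: I_def Cc_intros simp del: Cc_simps)
      then have "\<phi> (\<lambda>x. c * g x) \<le> s (\<lambda>x. c * f x)"
        using f by (intro le_s Cc_intros)
      then show "\<phi> g \<le> s (\<lambda>x. c * f x) / c"
        using g c Cc_dual_scale[OF \<phi>, of g c] by (simp add: I_def field_simps del: Cc_simps)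
    qed
    then show ?thesis
      using c by (simp add: field_simps)
  qed
  have s_scale: "s (\<lambda>x. c * f x) = c * s f"
    if f: "f \<in> vcarrier Cc" "\<And>x. 0 \<le> f x" and c: "0 < c" for f c
  proof -
    \<comment> \<open>The inequality just proved, applied to \<open>c * f\<close> with factor
      \<open>1 / c\<close>, is the missing converse.\<close>
    have "(1 / c) * s (\<lambda>x. c * f x) \<le> s (\<lambda>x. (1 / c) * (c * f x))"
      using f c by (intro s_scale_le Cc_intros) auto
    then show ?thesis
      using s_scale_le[OF f c] c by (simp add: field_simps)
  qed
  obtain T where T: "T \<in> vcarrier Cc_dual" "\<And>f. \<lbrakk>f \<in> vcarrier Cc; \<And>x. 0 \<le> f x\<rbrakk> \<Longrightarrow> T f = s f"
    using Cc_dual_extend[of s, OF s_nonneg s_add s_scale] by blast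
  have "is_sup_in Cc_dual {\<phi>, vzero Cc_dual} T"
    unfolding is_sup_in_def
  proof (intro conjI ballI impI)
    show "T \<in> vcarrier Cc_dual" by fact
    show "vle Cc_dual a T" if "a \<in> {\<phi>, vzero Cc_dual}" for a
      using that T(2) s_nonneg le_s
      by (auto simp: Cc_dual_simps I_def simp del: Cc_simps)
    show "vle Cc_dual T u" if u: "u \<in> vcarrier Cc_dual" "\<forall>a\<in>{\<phi>, vzero Cc_dual}. vle Cc_dual a u" for u
      unfolding Cc_dual_simps
    proof (intro ballI impI)
      fix f :: "'a \<Rightarrow> real" assume f: "f \<in> vcarrier Cc" "\<forall>x. 0 \<le> f x"
      have "s f \<le> u f"
      proof (rule s_le)
        fix g assume g: "g \<in> I f"
        have "\<phi> g \<le> u g"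
          using u g by (auto simp: Cc_dual_simps I_def simp del: Cc_simps)
        moreover have "(\<lambda>x. f x - g x) \<in> vcarrier Cc" "\<forall>x. 0 \<le> f x - g x"
          using f g by (auto simp: I_def Cc_intros simp del: Cc_simps)
        then have "0 \<le> u (\<lambda>x. f x - g x)"
          using u by (force simp: Cc_dual_simps simp del: Cc_simps)
        moreover have "u (\<lambda>x. f x - g x) = u f - u g"
          using g f by (intro Cc_dual_diff[OF u(1)]) (auto simp: I_def simp del: Cc_simps)
        ultimately show "\<phi> g \<le> u f"
          by simp
      qed (use f in auto)
      then show "T f \<le> u f"
        using T(2) f by simp
    qed
  qed
  then show ?thesis
    by blast
qed

text \<open>Suprema reduce to positive parts by translation, \<phi> \<or> \<psi> = (\<phi> - \<psi>)
  \<or> 0 + \<psi>, and infima reduce to suprema by changing sign.\<close>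

lemma vector_lattice_Cc_dual:
  "vector_lattice (Cc_dual :: (('a::t2_space \<Rightarrow> real) \<Rightarrow> real) ovs)"
proof -
  let ?D = "Cc_dual :: (('a \<Rightarrow> real) \<Rightarrow> real) ovs"
  interpret ordered_vector_space ?D
    by (rule ordered_vector_space_Cc_dual)
  have sup: "\<exists>\<sigma>. is_sup_in ?D {\<phi>, \<psi>} \<sigma>" if \<phi>: "\<phi> \<in> vcarrier ?D" and \<psi>: "\<psi> \<in> vcarrier ?D" for \<phi> \<psi>
  proof -
    have d: "vdiff ?D \<phi> \<psi> \<in> vcarrier ?D"
      unfolding vdiff_def vminus_def by (intro add_closed scale_closed \<phi> \<psi>)
    obtain \<sigma> where "is_sup_in ?D {vdiff ?D \<phi> \<psi>, vzero ?D} \<sigma>"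
      using Cc_dual_sup_zero[OF d] by blast
    then have \<sigma>: "\<sigma> \<in> vcarrier ?D" "vle ?D (vdiff ?D \<phi> \<psi>) \<sigma>" "vle ?D (vzero ?D) \<sigma>"
      and least: "\<And>u. \<lbrakk>u \<in> vcarrier ?D; vle ?D (vdiff ?D \<phi> \<psi>) u; vle ?D (vzero ?D) u\<rbrakk> \<Longrightarrow> vle ?D \<sigma> u"
      by (auto simp: is_sup_in_def)
    have "is_sup_in ?D {\<phi>, \<psi>} (vadd ?D \<sigma> \<psi>)"
      unfolding is_sup_in_def
    proof (intro conjI ballI impI)
      show "vadd ?D \<sigma> \<psi> \<in> vcarrier ?D"
        by (intro add_closed \<sigma> \<psi>)
      show "vle ?D a (vadd ?D \<sigma> \<psi>)" if "a \<in> {\<phi>, \<psi>}" for a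
        using that \<sigma>(2,3) by (auto simp: Cc_dual_simps vdiff_def simp del: Cc_simps)
      fix u assume u: "u \<in> vcarrier ?D" "\<forall>a\<in>{\<phi>, \<psi>}. vle ?D a u"
      have "vle ?D \<sigma> (vdiff ?D u \<psi>)"
      proof (rule least)
        show "vdiff ?D u \<psi> \<in> vcarrier ?D"
          unfolding vdiff_def vminus_def by (intro add_closed scale_closed u \<psi>)
      qed (use u in \<open>auto simp: Cc_dual_simps vdiff_def simp del: Cc_simps\<close>)
      then show "vle ?D (vadd ?D \<sigma> \<psi>) u"
        by (auto simp: Cc_dual_simps vdiff_def simp del: Cc_simps)
    qed
    then show ?thesis by (rule exI[of _ "vadd ?D \<sigma> \<psi>"])
  qed
  have inf: "\<exists>\<sigma>. is_inf_in ?D {\<phi>, \<psi>} \<sigma>" if \<phi>: "\<phi> \<in> vcarrier ?D" and \<psi>: "\<psi> \<in> vcarrier ?D" for \<phi> \<psi>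
  proof -
    have m: "vminus ?D x \<in> vcarrier ?D" if "x \<in> vcarrier ?D" for x
      using that unfolding vminus_def by (rule scale_closed)
    obtain \<sigma> where "is_sup_in ?D {vminus ?D \<phi>, vminus ?D \<psi>} \<sigma>"
      using sup[OF m[OF \<phi>] m[OF \<psi>]] by blast
    then have \<sigma>: "\<sigma> \<in> vcarrier ?D" "vle ?D (vminus ?D \<phi>) \<sigma>" "vle ?D (vminus ?D \<psi>) \<sigma>"
      and least: "\<And>u. \<lbrakk>u \<in> vcarrier ?D; vle ?D (vminus ?D \<phi>) u; vle ?D (vminus ?D \<psi>) u\<rbrakk> \<Longrightarrow> vle ?D \<sigma> u"
      by (auto simp: is_sup_in_def)
    have "is_inf_in ?D {\<phi>, \<psi>} (vminus ?D \<sigma>)"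
      unfolding is_inf_in_def
    proof (intro conjI ballI impI)
      show "vminus ?D \<sigma> \<in> vcarrier ?D"
        by (rule m[OF \<sigma>(1)])
      show "vle ?D (vminus ?D \<sigma>) a" if "a \<in> {\<phi>, \<psi>}" for a
        using that \<sigma>(2,3) by (force simp: Cc_dual_simps simp del: Cc_simps)
      fix u assume u: "u \<in> vcarrier ?D" "\<forall>a\<in>{\<phi>, \<psi>}. vle ?D u a"
      have "vle ?D \<sigma> (vminus ?D u)"
        using u by (intro least m) (auto simp: Cc_dual_simps simp del: Cc_simps)
      then show "vle ?D u (vminus ?D \<sigma>)"
        by (force simp: Cc_dual_simps simp del: Cc_simps)
    qed
    then show ?thesis by (rule exI[of _ "vminus ?D \<sigma>"])
  qed
  show ?thesis
    by unfold_locales (fact sup inf)+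
qed

section \<open>\<open>L^p\<close> as a vector lattice of classes\<close>

lemma Lp_class_self: "g \<in> Lp_fun M p \<Longrightarrow> g \<in> Lp_class M p g"
  by (simp add: Lp_class_def)

lemma Lp_classD:
  assumes "h \<in> Lp_class M p g"
  shows "h \<in> Lp_fun M p" "AE x in M. h x = g x"
  using assms by (auto simp: Lp_class_def)

lemma Lp_class_cong:
  assumes "AE x in M. f x = g x"
  shows "Lp_class M p f = Lp_class M p g"
proof -
  have "(AE x in M. h x = f x) \<longleftrightarrow> (AE x in M. h x = g x)" for h
    using assms by (intro eventually_subst) (auto elim: eventually_mono)
  then show ?thesis
    by (simp add: Lp_class_def)
qed

lemma Lp_ops:
  "vadd (Lp M p) F G = {h \<in> Lp_fun M p. \<exists>f\<in>F. \<exists>g\<in>G. AE x in M. h x = f x + g x}"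
  "vscale (Lp M p) a F = {h \<in> Lp_fun M p. \<exists>f\<in>F. AE x in M. h x = a * f x}"
  "vle (Lp M p) F G \<longleftrightarrow> (\<exists>f\<in>F. \<exists>g\<in>G. AE x in M. f x \<le> g x)"
  by (simp_all add: Lp_def)

lemma Lp_model_Lp:
  assumes p: "1 \<le> p"
  shows "Lp_model (Lp M p) M p (Lp_class M p)"
proof
  show "1 \<le> p" by fact
  show "vcarrier (Lp M p) = Lp_class M p ` Lp_fun M p" "vzero (Lp M p) = Lp_class M p (\<lambda>x. 0)"
    by (simp_all add: Lp_def)
next
  fix f g assume fg: "f \<in> Lp_fun M p" "g \<in> Lp_fun M p"
  show "vadd (Lp M p) (Lp_class M p f) (Lp_class M p g) = Lp_class M p (\<lambda>x. f x + g x)"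
  proof (intro equalityI subsetI)
    fix h assume "h \<in> vadd (Lp M p) (Lp_class M p f) (Lp_class M p g)"
    then obtain f' g' where h: "h \<in> Lp_fun M p" "AE x in M. h x = f' x + g' x"
      and f'g': "f' \<in> Lp_class M p f" "g' \<in> Lp_class M p g"
      by (auto simp: Lp_ops)
    from h(2) Lp_classD(2)[OF f'g'(1)] Lp_classD(2)[OF f'g'(2)]
    have "AE x in M. h x = f x + g x"
      by eventually_elim simp
    with h show "h \<in> Lp_class M p (\<lambda>x. f x + g x)"
      by (simp add: Lp_class_def)
  next
    fix h assume "h \<in> Lp_class M p (\<lambda>x. f x + g x)"
    note h = Lp_classD[OF this]
    show "h \<in> vadd (Lp M p) (Lp_class M p f) (Lp_class M p g)"
      unfolding Lp_ops
      by (intro CollectI conjI bexI[OF _ Lp_class_self[OF fg(1)]] bexI[OF _ Lp_class_self[OF fg(2)]])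
        (rule h)+
  qed
  show "vle (Lp M p) (Lp_class M p f) (Lp_class M p g) \<longleftrightarrow> (AE x in M. f x \<le> g x)"
  proof
    assume "vle (Lp M p) (Lp_class M p f) (Lp_class M p g)"
    then obtain f' g' where h: "AE x in M. f' x \<le> g' x"
      and f'g': "f' \<in> Lp_class M p f" "g' \<in> Lp_class M p g"
      by (auto simp: Lp_ops)
    from h Lp_classD(2)[OF f'g'(1)] Lp_classD(2)[OF f'g'(2)]
    show "AE x in M. f x \<le> g x"
      by eventually_elim simp
  next
    assume "AE x in M. f x \<le> g x"
    then show "vle (Lp M p) (Lp_class M p f) (Lp_class M p g)"
      unfolding Lp_ops by (intro bexI[OF _ Lp_class_self[OF fg(1)]] bexI[OF _ Lp_class_self[OF fg(2)]])
  qed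
  show "Lp_class M p f = Lp_class M p g" if "AE x in M. f x = g x"
    using that by (rule Lp_class_cong)
next
  fix f a assume f: "f \<in> Lp_fun M p"
  show "vscale (Lp M p) a (Lp_class M p f) = Lp_class M p (\<lambda>x. a * f x)"
  proof (intro equalityI subsetI)
    fix h assume "h \<in> vscale (Lp M p) a (Lp_class M p f)"
    then obtain f' where h: "h \<in> Lp_fun M p" "AE x in M. h x = a * f' x" "f' \<in> Lp_class M p f"
      by (auto simp: Lp_ops)
    from h(2) Lp_classD(2)[OF h(3)] have "AE x in M. h x = a * f x"
      by eventually_elim simp
    with h show "h \<in> Lp_class M p (\<lambda>x. a * f x)"
      by (simp add: Lp_class_def)
  next
    fix h assume "h \<in> Lp_class M p (\<lambda>x. a * f x)"
    note h = Lp_classD[OF this]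
    show "h \<in> vscale (Lp M p) a (Lp_class M p f)"
      unfolding Lp_ops by (intro CollectI conjI bexI[OF _ Lp_class_self[OF f]]) (rule h)+
  qed
qed

section \<open>The embedding\<close>

locale radon_Lp = radon_measure M for M :: "'a::t2_space measure" +
  fixes p :: real
  assumes p: "1 \<le> p"
begin

lemma p0: "0 \<le> p" "0 < p"
  using p by auto

lemmas Lp_intros = Lp_fun_zero Lp_fun_scale Lp_fun_uminus Lp_fun_abs
  Lp_fun_add[OF _ _ p0(1)] Lp_fun_diff[OF _ _ p0(1)] Lp_fun_max[OF _ _ p0(1)] Lp_fun_min[OF _ _ p0(1)]

section \<open>\<open>phi\<close> as a linear map into the order dual\<close>

lemma phi_apply: "f \<in> vcarrier Cc \<Longrightarrow> phi M g f = (\<integral>x. f x * g x \<partial>M)"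
  unfolding phi_def by (rule restrict_apply')

lemma phi_in_dual:
  assumes g: "g \<in> Lp_fun M p"
  shows "phi M g \<in> vcarrier Cc_dual"
proof (rule Cc_dualI)
  show "phi M g \<in> extensional (vcarrier Cc)"
    by (simp add: phi_def)
next
  fix f k :: "'a \<Rightarrow> real" assume f: "f \<in> vcarrier Cc" and k: "k \<in> vcarrier Cc"
  show "phi M g (\<lambda>x. f x + k x) = phi M g f + phi M g k"
    using integrable_Cc_mult[OF f g p] integrable_Cc_mult[OF k g p]
    by (simp only: phi_apply f k Cc_add distrib_right Bochner_Integration.integral_add)
next
  fix f :: "'a \<Rightarrow> real" and a assume f: "f \<in> vcarrier Cc"
  show "phi M g (\<lambda>x. a * f x) = a * phi M g f"
    by (simp add: phi_apply f Cc_scale mult.assoc del: Cc_simps)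
next
  fix a b :: "'a \<Rightarrow> real" assume a: "a \<in> vcarrier Cc" and b: "b \<in> vcarrier Cc"
  let ?c = "\<lambda>x. \<bar>a x\<bar> + \<bar>b x\<bar>"
  have c: "?c \<in> vcarrier Cc"
    using a b by (intro Cc_intros)
  show "\<exists>C. \<forall>f\<in>vcarrier Cc. (\<forall>x. a x \<le> f x \<and> f x \<le> b x) \<longrightarrow> \<bar>phi M g f\<bar> \<le> C"
  proof (intro exI[of _ "\<integral>x. ?c x * \<bar>g x\<bar> \<partial>M"] ballI impI)
    fix f :: "'a \<Rightarrow> real" assume f: "f \<in> vcarrier Cc" "\<forall>x. a x \<le> f x \<and> f x \<le> b x"
    have "\<bar>phi M g f\<bar> \<le> (\<integral>x. \<bar>f x * g x\<bar> \<partial>M)"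
      unfolding phi_apply[OF f(1)] by (rule integral_abs_bound)
    also have "\<dots> \<le> (\<integral>x. ?c x * \<bar>g x\<bar> \<partial>M)"
    proof (rule integral_mono)
      show "integrable M (\<lambda>x. \<bar>f x * g x\<bar>)"
        using integrable_Cc_mult[OF f(1) g p] by (rule integrable_abs)
      show "integrable M (\<lambda>x. ?c x * \<bar>g x\<bar>)"
        by (rule integrable_Cc_mult[OF c Lp_fun_abs[OF g] p])
      show "\<bar>f x * g x\<bar> \<le> ?c x * \<bar>g x\<bar>" for x
      proof -
        have "\<bar>f x\<bar> \<le> ?c x"
          using f(2)[rule_format, of x] by linarith
        then show ?thesis
          unfolding abs_mult by (rule mult_right_mono) simp
      qed
    qed
    finally show "\<bar>phi M g f\<bar> \<le> (\<integral>x. ?c x * \<bar>g x\<bar> \<partial>M)" .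
  qed
qed

lemma phi_add:
  assumes f: "f \<in> Lp_fun M p" and g: "g \<in> Lp_fun M p"
  shows "vadd Cc_dual (phi M f) (phi M g) = phi M (\<lambda>x. f x + g x)"
  unfolding Cc_dual_simps
proof (subst phi_def, rule restrict_ext)
  fix k :: "'a \<Rightarrow> real" assume k: "k \<in> vcarrier Cc"
  show "phi M f k + phi M g k = (\<integral>x. k x * (f x + g x) \<partial>M)"
    using integrable_Cc_mult[OF k f p] integrable_Cc_mult[OF k g p]
    by (simp only: phi_apply k distrib_left Bochner_Integration.integral_add)
qed

lemma phi_scale: "vscale Cc_dual a (phi M f) = phi M (\<lambda>x. a * f x)"
  unfolding Cc_dual_simps
  by (subst (2) phi_def, rule restrict_ext)
    (simp add: phi_apply mult.left_commute del: Cc_simps)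

lemma phi_zero: "vzero Cc_dual = phi M (\<lambda>x. 0)"
  by (simp add: Cc_dual_simps phi_def del: Cc_simps)

lemma phi_uminus: "vminus Cc_dual (phi M f) = phi M (\<lambda>x. - f x)"
  by (simp add: vminus_def phi_scale)

lemma phi_cong:
  assumes f: "f \<in> Lp_fun M p" and g: "g \<in> Lp_fun M p" and eq: "AE x in M. f x = g x"
  shows "phi M f = phi M g"
  unfolding phi_def
proof (rule restrict_ext)
  fix k :: "'a \<Rightarrow> real" assume k: "k \<in> vcarrier Cc"
  note [measurable] = Cc_measurable_M[OF k] Lp_fun_measurable[OF f] Lp_fun_measurable[OF g]
  show "(\<integral>x. k x * f x \<partial>M) = (\<integral>x. k x * g x \<partial>M)"
    by (rule integral_cong_AE) (use eq in auto)
qed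

text \<open>
  The key estimate: a positive test function \<open>k\<close> is split as \<open>k s + k (1 - s)\<close>, where \<open>s\<close> is
  continuous with compact support and close to the indicator of \<open>{f > g}\<close>.
\<close>

lemma phi_max_le:
  assumes \<psi>: "\<psi> \<in> vcarrier Cc_dual" and f: "f \<in> Lp_fun M p" and g: "g \<in> Lp_fun M p"
    and le: "vle Cc_dual (phi M f) \<psi>" "vle Cc_dual (phi M g) \<psi>"
  shows "vle Cc_dual (phi M (\<lambda>x. max (f x) (g x))) \<psi>"
  unfolding Cc_dual_simps
proof (intro ballI impI)
  fix k :: "'a \<Rightarrow> real" assume k: "k \<in> vcarrier Cc" "\<forall>x. 0 \<le> k x"
  note [measurable] = Cc_measurable_M[OF k(1)] Lp_fun_measurable[OF f] Lp_fun_measurable[OF g]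
  have fsk: "compact (fsupp k)" "fsupp k \<in> sets M"
    using Cc_compact[OF k(1)] by (auto simp: borel_compact)
  \<comment> \<open>Intersecting with the support of \<open>k\<close> gives the set finite measure
    and loses nothing, since \<open>k\<close> vanishes elsewhere.\<close>
  define A where "A = fsupp k \<inter> {x. g x < f x}"
  have "{x \<in> space M. g x < f x} \<in> sets M"
    by measurable
  then have A: "A \<in> sets M"
    using fsk by (auto simp: A_def)
  have "emeasure M A \<le> emeasure M (fsupp k)"
    using fsk by (intro emeasure_mono) (auto simp: A_def)
  then have Afin: "emeasure M A < \<infinity>"
    using emeasure_compact_finite[OF fsk(1)] by (rule le_less_trans)
  obtain s where s: "\<And>n. s n \<in> vcarrier Cc" "\<And>n x. 0 \<le> s n x" "\<And>n x. s n x \<le> 1"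
    "AE x in M. (\<lambda>n. s n x) \<longlonglongrightarrow> (indicator A x :: real)"
    using indicator_approx_AE[OF A Afin] by blast
  let ?h = "\<lambda>n x. k x * s n x * f x + (k x - k x * s n x) * g x"
  have ks: "(\<lambda>x. k x * s n x) \<in> vcarrier Cc" for n
    using Cc_mult[OF k(1) Cc_continuous[OF s(1)]] .
  have kks: "(\<lambda>x. k x - k x * s n x) \<in> vcarrier Cc" for n
    by (rule Cc_diff[OF k(1) ks])
  \<comment> \<open>Both \<open>k s\<close> and \<open>k (1 - s)\<close> are positive test
    functions: on the first \<psi> dominates \<open>phi M f\<close>, on the second it dominates
    \<open>phi M g\<close>, and the two values of \<psi> add up to \<open>\<psi> k\<close>.\<close>
  have bound: "(\<integral>x. ?h n x \<partial>M) \<le> \<psi> k" for n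
  proof -
    have 1: "0 \<le> k x * s n x" "0 \<le> k x - k x * s n x" for x
      using k(2) s(2,3)[where n=n and x=x] by (auto simp: mult_left_le)
    have "(\<integral>x. ?h n x \<partial>M) = phi M f (\<lambda>x. k x * s n x) + phi M g (\<lambda>x. k x - k x * s n x)"
      using integrable_Cc_mult[OF ks f p] integrable_Cc_mult[OF kks g p]
      by (simp only: phi_apply ks kks Bochner_Integration.integral_add)
    also have "\<dots> \<le> \<psi> (\<lambda>x. k x * s n x) + \<psi> (\<lambda>x. k x - k x * s n x)"
      using le 1 ks kks by (intro add_mono) (auto simp: Cc_dual_simps simp del: Cc_simps)
    also have "\<dots> = \<psi> k"
      using Cc_dual_add[OF \<psi> ks kks, of n n] by simp
    finally show ?thesis .
  qed
  have "(\<lambda>n. \<integral>x. ?h n x \<partial>M) \<longlonglongrightarrow> (\<integral>x. k x * max (f x) (g x) \<partial>M)"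
  proof (rule integral_dominated_convergence)
    show "?h n \<in> borel_measurable M" for n
      using Cc_measurable_M[OF s(1)] by measurable
    show "integrable M (\<lambda>x. k x * \<bar>f x\<bar> + k x * \<bar>g x\<bar>)"
      using integrable_Cc_mult[OF k(1) Lp_fun_abs[OF f] p] integrable_Cc_mult[OF k(1) Lp_fun_abs[OF g] p]
      by (rule Bochner_Integration.integrable_add)
    show "AE x in M. (\<lambda>n. ?h n x) \<longlonglongrightarrow> k x * max (f x) (g x)"
      using s(4)
    proof eventually_elim
      case (elim x)
      have "(\<lambda>n. ?h n x) \<longlonglongrightarrow> k x * indicator A x * f x + (k x - k x * indicator A x) * g x"
        by (intro tendsto_intros elim)
      also have "k x * indicator A x * f x + (k x - k x * indicator A x) * g x = k x * max (f x) (g x)"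
        using fsupp_zero[of x k] by (cases "x \<in> fsupp k") (auto simp: A_def indicator_def max_def)
      finally show ?case .
    qed
    show "AE x in M. norm (?h n x) \<le> k x * \<bar>f x\<bar> + k x * \<bar>g x\<bar>" for n
    proof (rule AE_I2)
      fix x
      have ks: "0 \<le> k x * s n x" "k x * s n x \<le> k x"
        using k(2) s(2,3)[of n x] by (auto simp: mult_left_le)
      have "norm (?h n x) \<le> \<bar>k x * s n x\<bar> * \<bar>f x\<bar> + \<bar>k x - k x * s n x\<bar> * \<bar>g x\<bar>"
        unfolding real_norm_def by (metis abs_mult abs_triangle_ineq)
      also have "\<dots> \<le> k x * \<bar>f x\<bar> + k x * \<bar>g x\<bar>"
        using ks by (intro add_mono mult_right_mono) auto
      finally show "norm (?h n x) \<le> k x * \<bar>f x\<bar> + k x * \<bar>g x\<bar>" .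
    qed
  qed simp
  then have "(\<integral>x. k x * max (f x) (g x) \<partial>M) \<le> \<psi> k"
    using bound by (intro LIMSEQ_le_const2) auto
  then show "phi M (\<lambda>x. max (f x) (g x)) k \<le> \<psi> k"
    by (simp only: phi_apply k)
qed

section \<open>Order and suprema under \<open>phi\<close>\<close>

lemma phi_mono:
  assumes f: "f \<in> Lp_fun M p" and g: "g \<in> Lp_fun M p" and le: "AE x in M. f x \<le> g x"
  shows "vle Cc_dual (phi M f) (phi M g)"
  unfolding Cc_dual_simps
proof (intro ballI impI)
  fix k :: "'a \<Rightarrow> real" assume k: "k \<in> vcarrier Cc" "\<forall>x. 0 \<le> k x"
  show "phi M f k \<le> phi M g k"
    unfolding phi_apply[OF k(1)]
  proof (rule integral_mono_AE)
    show "AE x in M. k x * f x \<le> k x * g x"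
      using le by eventually_elim (use k(2) in \<open>auto intro: mult_left_mono\<close>)
  qed (rule integrable_Cc_mult[OF k(1) f p] integrable_Cc_mult[OF k(1) g p])+
qed

text \<open>With \<open>phi M g\<close> as the upper bound in \<open>phi_max_le\<close>, the
  nonnegative function \<open>max f g - g\<close> has integral at most 0 against every positive test
  function. Test functions equal to 1 on a compact set show that it vanishes almost everywhere
  there, and \<open>AE_eq_0I\<close> passes to the whole space.\<close>

lemma phi_le_iff:
  assumes f: "f \<in> Lp_fun M p" and g: "g \<in> Lp_fun M p"
  shows "vle Cc_dual (phi M f) (phi M g) \<longleftrightarrow> (AE x in M. f x \<le> g x)"
proof
  assume le: "vle Cc_dual (phi M f) (phi M g)"
  let ?m = "\<lambda>x. max (f x) (g x)"
  let ?d = "\<lambda>x. ?m x - g x"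
  have m: "?m \<in> Lp_fun M p"
    using f g by (intro Lp_intros)
  have d: "?d \<in> Lp_fun M p"
    using Lp_fun_diff[OF m g p0(1)] .
  have "vle Cc_dual (phi M g) (phi M g)"
    by (simp add: Cc_dual_simps del: Cc_simps)
  then have le': "vle Cc_dual (phi M ?m) (phi M g)"
    by (rule phi_max_le[OF phi_in_dual[OF g] f g le])
  have "AE x in M. ?d x = 0"
  proof (rule AE_eq_0I[OF d p0(2)])
    fix K :: "'a set" assume K: "compact K"
    obtain k where k: "k \<in> vcarrier Cc" "\<And>x. 0 \<le> k x" "\<And>x. k x \<le> 1" "\<And>x. x \<in> K \<Longrightarrow> k x = 1"
      using Urysohn_Cc[OF lc K, of UNIV] by auto
    have int: "integrable M (\<lambda>x. k x * ?d x)"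
      by (rule integrable_Cc_mult[OF k(1) d p])
    have nn: "AE x in M. 0 \<le> k x * ?d x"
      using k(2) by (auto intro!: mult_nonneg_nonneg)
    have "(\<integral>x. k x * ?d x \<partial>M) = phi M ?m k - phi M g k"
      using integrable_Cc_mult[OF k(1) m p] integrable_Cc_mult[OF k(1) g p]
      by (simp only: phi_apply k right_diff_distrib Bochner_Integration.integral_diff)
    also have "\<dots> \<le> 0"
      using le' k by (simp add: Cc_dual_simps del: Cc_simps)
    finally have "(\<integral>x. k x * ?d x \<partial>M) = 0"
      using integral_nonneg_AE[OF nn] by linarith
    then have "AE x in M. k x * ?d x = 0"
      using integral_nonneg_eq_0_iff_AE[OF int nn] by blast
    then show "AE x in M. x \<in> K \<longrightarrow> ?d x = 0"
      by eventually_elim (use k(4) in auto)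
  qed
  then show "AE x in M. f x \<le> g x"
    by eventually_elim (simp add: max_def split: if_splits)
qed (rule phi_mono[OF f g])

text \<open>The competing bound \<open>u\<close> ranges over the whole dual, which
  \<open>phi_max_le\<close> allows. So the suprema agree with those of the dual and not merely with
  those inside the image.\<close>

lemma phi_sup:
  assumes f: "f \<in> Lp_fun M p" and g: "g \<in> Lp_fun M p"
  shows "is_sup_in Cc_dual {phi M f, phi M g} (phi M (\<lambda>x. max (f x) (g x)))"
  unfolding is_sup_in_def
proof (intro conjI ballI impI)
  have m: "(\<lambda>x. max (f x) (g x)) \<in> Lp_fun M p"
    using f g by (intro Lp_intros)
  show "phi M (\<lambda>x. max (f x) (g x)) \<in> vcarrier Cc_dual"
    by (rule phi_in_dual[OF m])
  show "vle Cc_dual a (phi M (\<lambda>x. max (f x) (g x)))" if "a \<in> {phi M f, phi M g}" for a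
    using that f g m by (auto simp: phi_le_iff simp del: Cc_simps)
  show "vle Cc_dual (phi M (\<lambda>x. max (f x) (g x))) u"
    if "u \<in> vcarrier Cc_dual" "\<forall>a\<in>{phi M f, phi M g}. vle Cc_dual a u" for u
    using that f g by (intro phi_max_le) auto
qed

lemma vsup_phi:
  assumes f: "f \<in> Lp_fun M p" and g: "g \<in> Lp_fun M p"
  shows "vsup Cc_dual (phi M f) (phi M g) = phi M (\<lambda>x. max (f x) (g x))"
proof -
  interpret vector_lattice "Cc_dual :: (('a \<Rightarrow> real) \<Rightarrow> real) ovs"
    by (rule vector_lattice_Cc_dual)
  show ?thesis
    unfolding vsup_def
  proof (rule the_equality[where P="is_sup_in Cc_dual {phi M f, phi M g}", OF phi_sup[OF f g]])
    show "s = phi M (\<lambda>x. max (f x) (g x))" if "is_sup_in Cc_dual {phi M f, phi M g} s" for s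
      using that phi_sup[OF f g] unfolding is_sup_in_def by (intro le_antisym) blast+
  qed
qed

lemma vabs_phi: "f \<in> Lp_fun M p \<Longrightarrow> vabs Cc_dual (phi M f) = phi M (\<lambda>x. \<bar>f x\<bar>)"
  by (simp add: vabs_def phi_uminus vsup_phi Lp_fun_uminus abs_real_def max_def)
    (intro arg_cong[where f="phi M"] ext, auto)

lemma pos_part_phi: "f \<in> Lp_fun M p \<Longrightarrow> pos_part Cc_dual (phi M f) = phi M (\<lambda>x. max (f x) 0)"
  by (simp add: pos_part_def phi_zero vsup_phi Lp_fun_zero)

lemma neg_part_phi: "f \<in> Lp_fun M p \<Longrightarrow> neg_part Cc_dual (phi M f) = phi M (\<lambda>x. max (- f x) 0)"
  by (simp add: neg_part_def phi_zero phi_uminus vsup_phi Lp_fun_zero Lp_fun_uminus)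

section \<open>Passage to classes and to the image\<close>

lemma Phi_Lp_class:
  assumes g: "g \<in> Lp_fun M p"
  shows "Phi M (Lp_class M p g) = phi M g"
proof -
  have "(SOME h. h \<in> Lp_class M p g) \<in> Lp_class M p g"
    by (rule someI[of "\<lambda>h. h \<in> Lp_class M p g", OF Lp_class_self[OF g]])
  then show ?thesis
    unfolding Phi_def using g by (intro phi_cong) (auto dest: Lp_classD)
qed

sublocale Lp: Lp_model "Lp M p" M p "Lp_class M p"
  by (rule Lp_model_Lp[OF p])

lemma phi_eq_iff:
  assumes f: "f \<in> Lp_fun M p" and g: "g \<in> Lp_fun M p"
  shows "phi M f = phi M g \<longleftrightarrow> (AE x in M. f x = g x)"
proof
  assume eq: "phi M f = phi M g"
  have "AE x in M. f x \<le> g x" "AE x in M. g x \<le> f x"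
    using phi_le_iff[OF f g] phi_le_iff[OF g f] eq phi_le_iff[OF f f] by auto
  then show "AE x in M. f x = g x"
    by eventually_elim simp
qed (rule phi_cong[OF f g])

lemma Phi_norm_phi:
  assumes g: "g \<in> Lp_fun M p"
  shows "Phi_norm M p (phi M g) = Lp_norm M p g"
proof -
  define h where "h = (SOME h. h \<in> Lp_fun M p \<and> phi M h = phi M g)"
  have "h \<in> Lp_fun M p \<and> phi M h = phi M g"
    unfolding h_def by (rule someI[of _ g]) (simp add: g)
  then have h: "h \<in> Lp_fun M p" "AE x in M. h x = g x"
    using phi_eq_iff g by blast+
  show ?thesis
    unfolding Phi_norm_def h_def[symmetric] by (rule Lp_norm_cong_AE[OF h(1) g h(2)])
qed

text \<open>The image carries the order of the dual. \<open>phi_le_iff\<close> identifies that order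
  with the almost everywhere order, so the Banach lattice structure and Dedekind completeness are
  those of the model.\<close>

sublocale image: Lp_normed_model "Phi_image M p" M p "phi M" "Phi_norm M p"
proof
  show "1 \<le> p" by (rule p)
  show "vcarrier (Phi_image M p) = phi M ` Lp_fun M p"
    by (auto simp: Phi_image_def Lp.carrier Phi_Lp_class image_iff)
  show "vzero (Phi_image M p) = phi M (\<lambda>x. 0)"
    by (simp add: Phi_image_def phi_zero)
qed (simp_all add: Phi_image_def phi_add phi_scale phi_le_iff phi_eq_iff Phi_norm_phi)

lemma lattice_hom_Phi: "lattice_hom (Lp M p) Cc_dual (Phi M)"
proof -
  interpret D: vector_lattice "Cc_dual :: (('a \<Rightarrow> real) \<Rightarrow> real) ovs"
    by (rule vector_lattice_Cc_dual)
  show ?thesis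
  proof
    fix x assume "x \<in> vcarrier (Lp M p)"
    then obtain f where f: "f \<in> Lp_fun M p" "x = Lp_class M p f"
      by (auto simp: Lp.carrier)
    show "Phi M x \<in> vcarrier Cc_dual"
      using f by (simp add: Phi_Lp_class phi_in_dual)
    show "Phi M (vscale (Lp M p) a x) = vscale Cc_dual a (Phi M x)" for a
      using f by (simp add: Phi_Lp_class Lp.R_scale phi_scale Lp_intros)
    show "vabs Cc_dual (Phi M x) = Phi M (vabs (Lp M p) x)"
      using f by (simp add: Phi_Lp_class Lp.R_abs vabs_phi Lp_intros)
    fix y assume "y \<in> vcarrier (Lp M p)"
    then obtain g where g: "g \<in> Lp_fun M p" "y = Lp_class M p g"
      by (auto simp: Lp.carrier)
    show "Phi M (vadd (Lp M p) x y) = vadd Cc_dual (Phi M x) (Phi M y)"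
      using f g by (simp add: Phi_Lp_class Lp.R_add phi_add Lp_intros)
  qed
qed

lemma inj_on_Phi: "inj_on (Phi M) (vcarrier (Lp M p))"
  by (auto simp: inj_on_def Lp.carrier Phi_Lp_class phi_eq_iff Lp.R_eq_iff)

section \<open>Dense sets\<close>

text \<open>This inclusion gives both properties of the second dense set: a closed subset of a
  compact set is compact, and subsets of disjoint sets are disjoint.\<close>

lemma dsupp_phi_subset: "dsupp (phi M g) \<subseteq> fsupp g"
proof -
  have "vanishes_on (phi M g) (- fsupp g)"
    unfolding vanishes_on_def
  proof (intro ballI impI)
    fix f :: "'a \<Rightarrow> real" assume f: "f \<in> vcarrier Cc" "fsupp f \<subseteq> - fsupp g"
    have "(\<lambda>x. f x * g x) = (\<lambda>x. 0)"
      using f(2) fsupp_zero[of _ f] fsupp_zero[of _ g] by fastforce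
    then show "phi M g f = 0"
      by (simp add: phi_apply[OF f(1)])
  qed
  moreover have "open (- fsupp g)"
    by (simp add: fsupp_def open_Compl)
  ultimately show ?thesis
    unfolding dsupp_def by blast
qed

lemma compact_dsupp_phi:
  assumes "g \<in> vcarrier Cc"
  shows "compact (dsupp (phi M g))"
  by (rule compact_closed_subset[OF Cc_compact[OF assms] _ dsupp_phi_subset])
    (auto simp: dsupp_def)

lemma pos_neg_part_Cc:
  fixes g :: "'a \<Rightarrow> real"
  assumes "g \<in> vcarrier Cc"
  shows "pos_part Cc g = (\<lambda>x. max (g x) 0)" "neg_part Cc g = (\<lambda>x. max (- g x) 0)"
  using vsup_Cc[OF assms Cc_zero] vsup_Cc[OF Cc_uminus[OF assms] Cc_zero]
  by (simp_all add: pos_part_def neg_part_def)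

lemma dense_disjoint_supports:
  "norm_dense (Phi_image M p) (Phi_norm M p)
    {phi M g |g. g \<in> vcarrier Cc \<and> fsupp (pos_part Cc g) \<inter> fsupp (neg_part Cc g) = {}}"
proof (rule image.norm_denseI)
  show "{phi M g |g. g \<in> vcarrier Cc \<and> fsupp (pos_part Cc g) \<inter> fsupp (neg_part Cc g) = {}}
      \<subseteq> vcarrier (Phi_image M p)"
    using Cc_Lp_fun[OF _ p0(1)] image.R_carrier by blast
next
  fix f and e :: real assume f: "f \<in> Lp_fun M p" and e: "0 < e"
  obtain g where g: "g \<in> vcarrier Cc" "Lp_norm M p (\<lambda>x. f x - g x) < e / 2"
    using Cc_dense_Lp[OF f p, of "e / 2"] e by auto
  \<comment> \<open>Truncation will change \<open>g\<close> by at most \<open>d\<close>, and only on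
    its support; \<open>u\<close> is a p-integrable function that dominates the indicator of this
    support.\<close>
  obtain u where u: "u \<in> vcarrier Cc" "\<And>x. 0 \<le> u x" "\<And>x. x \<in> fsupp g \<Longrightarrow> u x = 1"
    using Urysohn_Cc[OF lc Cc_compact[OF g(1)], of UNIV] by (metis open_UNIV subset_UNIV)
  \<comment> \<open>Makes \<open>d\<close> times the norm of \<open>u\<close> smaller than e / 2;
    the + 1 gives strictness even if that norm is 0.\<close>
  define d where "d = e / (2 * (Lp_norm M p u + 1))"
  have d: "0 < d"
    using e Lp_norm_nonneg[of M p u] by (simp add: d_def add_nonneg_pos)
  define h where "h x = max (g x - d) 0 - max (- g x - d) 0" for x
  have h: "h \<in> vcarrier Cc"
  proof (rule Cc_combine[OF g(1) g(1)])
    show "continuous_on UNIV h"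
      unfolding h_def using Cc_continuous[OF g(1)] by (intro continuous_intros)
  qed (use d in \<open>auto simp: h_def\<close>)
  note Lp = Cc_Lp_fun[OF h p0(1)] Cc_Lp_fun[OF g(1) p0(1)] Cc_Lp_fun[OF u(1) p0(1)]
  have "\<bar>g x - h x\<bar> \<le> \<bar>d * u x\<bar>" for x
    using u(3)[of x] fsupp_zero[of x g] d
    by (cases "x \<in> fsupp g") (auto simp: h_def)
  then have "Lp_norm M p (\<lambda>x. g x - h x) \<le> Lp_norm M p (\<lambda>x. d * u x)"
    using Lp p0 by (intro Lp_norm_mono Lp_intros) auto
  also have "\<dots> = d * Lp_norm M p u"
    using Lp_norm_scale[OF p0(2), of M d u] d by simp
  also have "\<dots> < e / 2"
    using e Lp_norm_nonneg[of M p u] by (simp add: d_def field_simps add_pos_nonneg)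
  finally have "Lp_norm M p (\<lambda>x. f x - h x) < e"
    using Lp_norm_diff_triangle[OF f Lp(2,1) p] g(2) by linarith
  \<comment> \<open>Closures could make the supports touch. The threshold prevents this: they lie in
    the closed sets where g \<ge> d and where g \<le> - d.\<close>
  moreover have "fsupp (pos_part Cc h) \<inter> fsupp (neg_part Cc h) = {}"
  proof -
    have cont: "continuous_on UNIV g"
      by (rule Cc_continuous[OF g(1)])
    have "fsupp (pos_part Cc h) \<subseteq> {x. d \<le> g x}"
      unfolding fsupp_def pos_neg_part_Cc[OF h]
      by (rule closure_minimal) (use d in \<open>auto simp: h_def intro!: closed_Collect_le continuous_intros cont\<close>)
    moreover have "fsupp (neg_part Cc h) \<subseteq> {x. g x \<le> - d}"
      unfolding fsupp_def pos_neg_part_Cc[OF h]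
      by (rule closure_minimal) (use d in \<open>auto simp: h_def intro!: closed_Collect_le continuous_intros cont\<close>)
    ultimately show ?thesis
      using d by fastforce
  qed
  ultimately show "\<exists>h\<in>Lp_fun M p. phi M h \<in> {phi M g |g. g \<in> vcarrier Cc \<and>
      fsupp (pos_part Cc g) \<inter> fsupp (neg_part Cc g) = {}} \<and> Lp_norm M p (\<lambda>x. f x - h x) < e"
    using h Lp(1) by (intro bexI[of _ h]) auto
qed

text \<open>This set contains the previous dense set: positive and negative parts of
  \<open>phi M g\<close> in the dual come from those of \<open>g\<close>, so their supports are
  inside the disjoint supports of the latter.\<close>

lemma dense_disjoint_dual_supports:
  "norm_dense (Phi_image M p) (Phi_norm M p)
    {\<phi> \<in> vcarrier (Phi_image M p). compact (dsupp \<phi>) \<and>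
      dsupp (pos_part Cc_dual \<phi>) \<inter> dsupp (neg_part Cc_dual \<phi>) = {}}"
proof (rule image.norm_dense_mono[OF dense_disjoint_supports])
  show "{phi M g |g. g \<in> vcarrier Cc \<and> fsupp (pos_part Cc g) \<inter> fsupp (neg_part Cc g) = {}}
    \<subseteq> {\<phi> \<in> vcarrier (Phi_image M p). compact (dsupp \<phi>) \<and>
      dsupp (pos_part Cc_dual \<phi>) \<inter> dsupp (neg_part Cc_dual \<phi>) = {}}"
  proof clarify
    fix g :: "'a \<Rightarrow> real" assume g: "g \<in> vcarrier Cc" "fsupp (pos_part Cc g) \<inter> fsupp (neg_part Cc g) = {}"
    have Lp: "g \<in> Lp_fun M p"
      by (rule Cc_Lp_fun[OF g(1) p0(1)])
    have "dsupp (pos_part Cc_dual (phi M g)) \<subseteq> fsupp (pos_part Cc g)"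
      "dsupp (neg_part Cc_dual (phi M g)) \<subseteq> fsupp (neg_part Cc g)"
      unfolding pos_part_phi[OF Lp] neg_part_phi[OF Lp] pos_neg_part_Cc[OF g(1)]
      by (rule dsupp_phi_subset)+
    then show "phi M g \<in> vcarrier (Phi_image M p) \<and> compact (dsupp (phi M g)) \<and>
        dsupp (pos_part Cc_dual (phi M g)) \<inter> dsupp (neg_part Cc_dual (phi M g)) = {}"
      using g compact_dsupp_phi[OF g(1)] image.R_carrier[OF Lp] by blast
  qed
qed auto

end

section \<open>Variations of a signed measure\<close>

text \<open>\<open>ennreal\<close> cuts off negative values, so it is subadditive on all reals and
  additive only on nonnegative ones.\<close>

lemma ennreal_add_le: "ennreal (a + b) \<le> ennreal a + ennreal b"
proof (cases "0 \<le> a \<and> 0 \<le> b")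
  case False
  then consider "a < 0" | "b < 0"
    by fastforce
  then show ?thesis
  proof cases
    case 1
    then have "ennreal (a + b) \<le> ennreal b"
      by (intro ennreal_leI) simp
    then show ?thesis
      by (simp add: add_increasing)
  next
    case 2
    then have "ennreal (a + b) \<le> ennreal a"
      by (intro ennreal_leI) simp
    then show ?thesis
      by (simp add: add_increasing2)
  qed
qed simp

lemma ennreal_sum_le: "ennreal (\<Sum>i\<in>I. f i) \<le> (\<Sum>i\<in>I. ennreal (f i))"
proof (induction I rule: infinite_finite_induct)
  case (insert i I)
  then show ?case
    using ennreal_add_le[of "f i" "\<Sum>i\<in>I. f i"] by (simp add: order_trans add_left_mono)
qed auto

locale signed_measure =
  fixes S :: "'a::topological_space set" and \<nu> :: "'a set \<Rightarrow> real"
  assumes empty: "\<nu> {} = 0"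
    and sums: "\<And>A :: nat \<Rightarrow> 'a set. \<lbrakk>range A \<subseteq> borel_sets_on S; disjoint_family A\<rbrakk> \<Longrightarrow>
      (\<lambda>n. \<nu> (A n)) sums \<nu> (\<Union>n. A n)"
begin

lemma Un:
  assumes "A \<in> borel_sets_on S" "B \<in> borel_sets_on S" "A \<inter> B = {}"
  shows "\<nu> (A \<union> B) = \<nu> A + \<nu> B"
proof -
  have "(\<lambda>n. \<nu> (binaryset A B n)) sums \<nu> (\<Union>n. binaryset A B n)"
    using assms
    by (intro sums) (auto simp: range_binaryset_eq disjoint_family_on_def binaryset_def)
  then have "(\<lambda>n. \<nu> (binaryset A B n)) sums \<nu> (A \<union> B)"
    by (simp add: UN_binaryset_eq)
  then show ?thesis
    using binaryset_sums[of \<nu> A B, OF empty] by (rule sums_unique2)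
qed

lemma Diff:
  assumes "A \<in> borel_sets_on S" "B \<in> borel_sets_on S" "B \<subseteq> A"
  shows "\<nu> (A - B) = \<nu> A - \<nu> B"
proof -
  have "B \<union> (A - B) = A"
    using assms(3) by blast
  then show ?thesis
    using Un[of B "A - B"] assms by (simp add: sets.Diff)
qed

lemma uminus: "signed_measure S (\<lambda>A. - \<nu> A)"
  by unfold_locales (simp_all add: empty sums sums_minus)

lemma sets_pos_variation: "sets (pos_variation S \<nu>) = borel_sets_on S"
proof -
  have "borel_sets_on S \<subseteq> Pow S"
    using sets.sets_into_space[of _ "restrict_space borel S"] by (auto simp: space_restrict_space)
  moreover have "sigma_sets S (borel_sets_on S) = borel_sets_on S"
    using sets.sigma_sets_eq[of "restrict_space borel S"] by (simp add: space_restrict_space)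
  ultimately show ?thesis
    unfolding pos_variation_def by (simp add: sets_measure_of)
qed

text \<open>\<open>pos_variation\<close> is made by \<open>measure_of\<close>, so it takes the value
  of the supremum only once that supremum is known to be a measure. Unions of competitors give
  superadditivity on disjoint sets, hence one half of countable additivity; cutting a competitor
  along the sets \<open>A i\<close> gives the other half.\<close>

lemma emeasure_pos_variation:
  assumes A: "A \<in> borel_sets_on S"
  shows "emeasure (pos_variation S \<nu>) A = (SUP B\<in>{B \<in> borel_sets_on S. B \<subseteq> A}. ennreal (\<nu> B))"
proof -
  define P where "P A = (SUP B\<in>{B \<in> borel_sets_on S. B \<subseteq> A}. ennreal (\<nu> B))" for A
  have P_ge: "ennreal (\<nu> B) \<le> P A" if "B \<in> borel_sets_on S" "B \<subseteq> A" for A B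
    unfolding P_def using that by (intro SUP_upper) auto
  have P_least: "P A \<le> c" if "\<And>B. B \<in> borel_sets_on S \<Longrightarrow> B \<subseteq> A \<Longrightarrow> ennreal (\<nu> B) \<le> c" for A c
    unfolding P_def using that by (intro SUP_least) auto
  have P_mono: "P A \<le> P B" if "A \<subseteq> B" for A B
    using that by (intro P_least P_ge) auto
  have P_empty: "P {} = 0"
    by (rule antisym[OF P_least]) (auto simp: empty)
  have super: "P A + P B \<le> P (A \<union> B)" if "A \<inter> B = {}" for A B
  proof -
    \<comment> \<open>If both values are nonnegative, the union competes for
      \<open>A \<union> B\<close>. A negative value is sent to 0, and the other set competes
      alone.\<close>
    have 1: "ennreal (\<nu> C) + ennreal (\<nu> D) \<le> P (A \<union> B)"
      if C: "C \<in> borel_sets_on S" "C \<subseteq> A" and D: "D \<in> borel_sets_on S" "D \<subseteq> B" for C D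
    proof (cases "0 \<le> \<nu> C \<and> 0 \<le> \<nu> D")
      case True
      have "C \<inter> D = {}"
        using C D \<open>A \<inter> B = {}\<close> by blast
      then have "\<nu> (C \<union> D) = \<nu> C + \<nu> D"
        using C D by (intro Un)
      then have "ennreal (\<nu> C) + ennreal (\<nu> D) = ennreal (\<nu> (C \<union> D))"
        using True by (simp add: ennreal_plus)
      also have "\<dots> \<le> P (A \<union> B)"
        using C D by (intro P_ge sets.Un) auto
      finally show ?thesis .
    next
      case False
      then consider "ennreal (\<nu> C) = 0" | "ennreal (\<nu> D) = 0"
        by (meson ennreal_neg linear)
      then show ?thesis
        using P_ge[of C "A \<union> B"] P_ge[of D "A \<union> B"] C D by cases auto
    qed
    have ne: "{B' \<in> borel_sets_on S. B' \<subseteq> X} \<noteq> {}" for X :: "'a set"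
      using sets.empty_sets[of "restrict_space borel S"] by blast
    have 2: "P A + ennreal (\<nu> D) \<le> P (A \<union> B)" if D: "D \<in> borel_sets_on S" "D \<subseteq> B" for D
    proof -
      have "P A + ennreal (\<nu> D) = (SUP C\<in>{C \<in> borel_sets_on S. C \<subseteq> A}. ennreal (\<nu> C) + ennreal (\<nu> D))"
        unfolding P_def[of A] by (rule ennreal_SUP_add_left[OF ne, symmetric])
      also have "\<dots> \<le> P (A \<union> B)"
        by (rule SUP_least) (use 1 D in blast)
      finally show ?thesis .
    qed
    have "P B + P A = (SUP D\<in>{D \<in> borel_sets_on S. D \<subseteq> B}. ennreal (\<nu> D) + P A)"
      unfolding P_def[of B] by (rule ennreal_SUP_add_left[OF ne, symmetric])
    also have "\<dots> \<le> P (A \<union> B)"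
      by (rule SUP_least) (use 2 in \<open>auto simp: add.commute\<close>)
    finally show ?thesis
      by (simp add: add.commute)
  qed
  have ca: "countably_additive (sets (pos_variation S \<nu>)) P"
    unfolding countably_additive_def sets_pos_variation
  proof (intro allI impI)
    fix A :: "nat \<Rightarrow> 'a set"
    assume A: "range A \<subseteq> borel_sets_on S" "disjoint_family A" "(\<Union>i. A i) \<in> borel_sets_on S"
    show "(\<Sum>i. P (A i)) = P (\<Union>i. A i)"
    proof (rule antisym)
      have "(\<Sum>i<n. P (A i)) \<le> P (\<Union>i<n. A i)" for n
      proof (induction n)
        case (Suc n)
        have "(\<Union>i<n. A i) \<inter> A n = {}"
        proof -
          have "A i \<inter> A n = {}" if "i < n" for i
            using disjoint_family_onD[OF A(2), of i n] that by simp
          then show ?thesis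
            by blast
        qed
        then have "P (\<Union>i<n. A i) + P (A n) \<le> P ((\<Union>i<n. A i) \<union> A n)"
          by (rule super)
        also have "(\<Union>i<n. A i) \<union> A n = (\<Union>i<Suc n. A i)"
          by (auto simp: lessThan_Suc)
        finally show ?case
          using order_trans[OF add_right_mono[OF Suc]] by simp
      qed (simp add: P_empty)
      then have "(\<Sum>i<n. P (A i)) \<le> P (\<Union>i. A i)" for n
        by (rule order_trans) (intro P_mono UN_mono; simp)
      then show "(\<Sum>i. P (A i)) \<le> P (\<Union>i. A i)"
        unfolding suminf_eq_SUP by (intro SUP_least)
    next
      show "P (\<Union>i. A i) \<le> (\<Sum>i. P (A i))"
      proof (rule P_least)
        fix B assume B: "B \<in> borel_sets_on S" "B \<subseteq> (\<Union>i. A i)"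
        have BA: "B \<inter> A i \<in> borel_sets_on S" for i
          using B A by (intro sets.Int) auto
        have "(\<lambda>n. \<nu> (B \<inter> A n)) sums \<nu> (\<Union>n. B \<inter> A n)"
          using A(2) BA by (intro sums) (auto simp: disjoint_family_on_def)
        also have "(\<Union>n. B \<inter> A n) = B"
          using B by blast
        finally have "(\<lambda>n. ennreal (\<Sum>i<n. \<nu> (B \<inter> A i))) \<longlonglongrightarrow> ennreal (\<nu> B)"
          by (intro tendsto_ennrealI) (simp add: sums_def)
        then show "ennreal (\<nu> B) \<le> (\<Sum>i. P (A i))"
        proof (rule LIMSEQ_le_const2, intro exI allI impI)
          fix n
          have "ennreal (\<Sum>i<n. \<nu> (B \<inter> A i)) \<le> (\<Sum>i<n. ennreal (\<nu> (B \<inter> A i)))"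
            by (rule ennreal_sum_le)
          also have "\<dots> \<le> (\<Sum>i<n. P (A i))"
            using BA by (intro sum_mono P_ge) auto
          also have "\<dots> \<le> (\<Sum>i. P (A i))"
            by (rule sum_le_suminf) auto
          finally show "ennreal (\<Sum>i<n. \<nu> (B \<inter> A i)) \<le> (\<Sum>i. P (A i))" .
        qed
      qed
    qed
  qed
  have "borel_sets_on S \<subseteq> Pow S"
    using sets.sets_into_space[of _ "restrict_space borel S"] by (auto simp: space_restrict_space)
  moreover have "positive (sets (pos_variation S \<nu>)) P"
    by (simp add: positive_def P_empty)
  ultimately have "emeasure (pos_variation S \<nu>) A = P A"
    using A ca
    by (intro emeasure_measure_of[OF pos_variation_def[of S \<nu>, folded P_def]])
      (auto simp: sets_pos_variation)
  then show ?thesis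
    by (simp add: P_def)
qed

text \<open>The map B \<mapsto> A - B permutes the Borel subsets of \<open>A\<close>, and \<nu> B =
  \<nu> A - \<nu> (A - B). Taking suprema on both sides shows that the positive variation of
  \<open>A\<close> is \<nu> A plus the negative variation; finiteness permits the
  subtraction.\<close>

lemma Jordan_decomposition:
  assumes fin: "finite_measure (pos_variation S \<nu>)" "finite_measure (neg_variation S \<nu>)"
    and A: "A \<in> borel_sets_on S"
  shows "\<nu> A = measure (pos_variation S \<nu>) A - measure (neg_variation S \<nu>) A"
proof -
  interpret n: signed_measure S "\<lambda>A. - \<nu> A"
    by (rule uminus)
  define a b where "a = measure (pos_variation S \<nu>) A" and "b = measure (neg_variation S \<nu>) A"
  have nn: "0 \<le> a" "0 \<le> b"
    by (simp_all add: a_def b_def)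
  have ea: "ennreal a = (SUP B\<in>{B \<in> borel_sets_on S. B \<subseteq> A}. ennreal (\<nu> B))"
    using emeasure_pos_variation[OF A] finite_measure.emeasure_eq_measure[OF fin(1), of A]
    by (simp add: a_def)
  have eb: "ennreal b = (SUP B\<in>{B \<in> borel_sets_on S. B \<subseteq> A}. ennreal (- \<nu> B))"
    using n.emeasure_pos_variation[OF A] finite_measure.emeasure_eq_measure[OF fin(2), of A]
    by (simp add: b_def neg_variation_def)
  have a_ge: "\<nu> B \<le> a" and b_ge: "- \<nu> B \<le> b" if B: "B \<in> borel_sets_on S" "B \<subseteq> A" for B
  proof -
    have "ennreal (\<nu> B) \<le> ennreal a" "ennreal (- \<nu> B) \<le> ennreal b"
      unfolding ea eb using B by (intro SUP_upper; auto)+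
    then show "\<nu> B \<le> a" "- \<nu> B \<le> b"
      using nn by (simp_all add: ennreal_le_iff)
  qed
  have AB: "A - B \<in> borel_sets_on S" "\<nu> B = \<nu> A - \<nu> (A - B)" if "B \<in> borel_sets_on S" "B \<subseteq> A" for B
    using that A Diff[OF A that] by (auto intro: sets.Diff)
  have "ennreal a \<le> ennreal (\<nu> A + b)"
    unfolding ea
  proof (intro SUP_least ennreal_leI)
    fix B assume "B \<in> {B \<in> borel_sets_on S. B \<subseteq> A}"
    then show "\<nu> B \<le> \<nu> A + b"
      using AB[of B] b_ge[of "A - B"] by auto
  qed
  moreover have "0 \<le> \<nu> A + b"
    using b_ge[of A] A by simp
  moreover have "ennreal b \<le> ennreal (a - \<nu> A)"
    unfolding eb
  proof (intro SUP_least ennreal_leI)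
    fix B assume "B \<in> {B \<in> borel_sets_on S. B \<subseteq> A}"
    then show "- \<nu> B \<le> a - \<nu> A"
      using AB[of B] a_ge[of "A - B"] by auto
  qed
  moreover have "0 \<le> a - \<nu> A"
    using a_ge[of A] A by simp
  ultimately have "a \<le> \<nu> A + b" "b \<le> a - \<nu> A"
    by (simp_all add: ennreal_le_iff)
  then show ?thesis
    by (simp add: a_def b_def)
qed

end

lemma signed_measure_diff:
  assumes P: "finite_measure P" "sets P = borel_sets_on S"
    and Q: "finite_measure Q" "sets Q = borel_sets_on S"
    and \<nu>: "\<And>A. A \<in> borel_sets_on S \<Longrightarrow> \<nu> A = measure P A - measure Q A"
  shows "signed_measure S \<nu>"
proof
  show "\<nu> {} = 0"
    by (simp add: \<nu>)
next
  fix A :: "nat \<Rightarrow> 'a set" assume A: "range A \<subseteq> borel_sets_on S" "disjoint_family A"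
  have U: "(\<Union>n. A n) \<in> borel_sets_on S"
    using A(1) by (intro sets.countable_UN) auto
  have "(\<lambda>n. measure P (A n) - measure Q (A n)) sums (measure P (\<Union>n. A n) - measure Q (\<Union>n. A n))"
    using finite_measure.finite_measure_UNION[OF P(1), of A]
      finite_measure.finite_measure_UNION[OF Q(1), of A] A P(2) Q(2)
    by (intro sums_diff) auto
  moreover have "A n \<in> borel_sets_on S" for n
    using A(1) by blast
  ultimately show "(\<lambda>n. \<nu> (A n)) sums \<nu> (\<Union>n. A n)"
    using U by (simp add: \<nu>)
qed

text \<open>\<open>D\<close> is a Hahn set: \<open>P\<close> lives on it and \<open>Q\<close> does
  not charge it. So the supremum over subsets of \<open>A\<close> is attained at
  \<open>A \<inter> D\<close>, where \<nu> equals \<open>P\<close>.\<close>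

lemma pos_variation_diff:
  assumes P: "finite_measure P" "sets P = borel_sets_on S"
    and Q: "finite_measure Q" "sets Q = borel_sets_on S"
    and \<nu>: "\<And>A. A \<in> borel_sets_on S \<Longrightarrow> \<nu> A = measure P A - measure Q A"
    and D: "D \<in> borel_sets_on S" "emeasure P (S - D) = 0" "emeasure Q D = 0"
  shows "pos_variation S \<nu> = P"
proof -
  interpret signed_measure S \<nu>
    by (rule signed_measure_diff[OF P Q \<nu>])
  interpret P: finite_measure P by fact
  interpret Q: finite_measure Q by fact
  have S: "S \<in> borel_sets_on S"
    using sets.top[of "restrict_space borel S"] by (simp add: space_restrict_space)
  show ?thesis
  proof (rule measure_eqI)
    show "sets (pos_variation S \<nu>) = sets P"
      by (simp add: sets_pos_variation P)
    fix A assume "A \<in> sets (pos_variation S \<nu>)"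
    then have A: "A \<in> borel_sets_on S"
      by (simp add: sets_pos_variation)
    show "emeasure (pos_variation S \<nu>) A = emeasure P A"
      unfolding emeasure_pos_variation[OF A]
    proof (intro antisym SUP_least)
      fix B assume "B \<in> {B \<in> borel_sets_on S. B \<subseteq> A}"
      then have B: "B \<in> borel_sets_on S" "B \<subseteq> A"
        by auto
      have "\<nu> B \<le> measure P B"
        using B by (simp add: \<nu>)
      then have "ennreal (\<nu> B) \<le> emeasure P B"
        by (simp add: P.emeasure_eq_measure ennreal_leI)
      also have "\<dots> \<le> emeasure P A"
        using A B P by (intro emeasure_mono) auto
      finally show "ennreal (\<nu> B) \<le> emeasure P A" .
    next
      have AD: "A \<inter> D \<in> borel_sets_on S" "A - D \<in> borel_sets_on S"
        using A D by (auto intro: sets.Int sets.Diff)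
      have "A \<subseteq> S"
        using sets.sets_into_space[OF A] by (simp add: space_restrict_space)
      have "emeasure P (A - D) \<le> emeasure P (S - D)"
        using \<open>A \<subseteq> S\<close> D S P by (intro emeasure_mono) (auto intro: sets.Diff)
      then have "emeasure P (A - D) = 0"
        using D by simp
      moreover have "emeasure Q (A \<inter> D) \<le> emeasure Q D"
        using D Q by (intro emeasure_mono) auto
      then have "emeasure Q (A \<inter> D) = 0"
        using D by simp
      moreover have "emeasure P A = emeasure P (A \<inter> D) + emeasure P (A - D)"
        using AD P by (subst plus_emeasure) (auto intro!: arg_cong[where f="emeasure P"])
      moreover have "measure Q (A \<inter> D) = 0"
        using \<open>emeasure Q (A \<inter> D) = 0\<close> by (simp add: measure_def)
      ultimately have "emeasure P A = ennreal (\<nu> (A \<inter> D))"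
        unfolding \<nu>[OF AD(1)] by (simp add: P.emeasure_eq_measure)
      also have "\<dots> \<le> (SUP B\<in>{B \<in> borel_sets_on S. B \<subseteq> A}. ennreal (\<nu> B))"
        using AD by (intro SUP_upper) auto
      finally show "emeasure P A \<le> (SUP B\<in>{B \<in> borel_sets_on S. B \<subseteq> A}. ennreal (\<nu> B))" .
    qed
  qed
qed

section \<open>Uniqueness of the local measure\<close>

locale finite_regular_measure = finite_measure N for N :: "'a::t2_space measure" +
  fixes U :: "'a set"
  assumes open_U: "open U" and regular: "regular_borel_measure U N"
begin

lemma sets_N: "sets N = borel_sets_on U"
  using regular by (simp add: regular_borel_measure_def)

lemma borel_subset_sets: "A \<in> sets borel \<Longrightarrow> A \<subseteq> U \<Longrightarrow> A \<in> sets N"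
  unfolding sets_N sets_restrict_space by (auto intro!: image_eqI[of _ _ A])

lemma openin_U_iff: "openin (top_of_set U) V \<longleftrightarrow> open V \<and> V \<subseteq> U"
  using open_U by (rule openin_open_eq)

lemma inner_approx:
  assumes V: "open V" "V \<subseteq> U" and e: "0 < e"
  obtains K where "compact K" "K \<subseteq> V" "measure N V < measure N K + e"
proof (cases "measure N V < e")
  case True
  then show ?thesis
    by (intro that[of "{}"]) auto
next
  case False
  have "\<forall>V. openin (top_of_set U) V \<longrightarrow> emeasure N V = (SUP K\<in>{K. compact K \<and> K \<subseteq> V}. emeasure N K)"
    using regular unfolding regular_borel_measure_def by blast
  then have "emeasure N V = (SUP K\<in>{K. compact K \<and> K \<subseteq> V}. emeasure N K)"
    using V by (simp add: openin_U_iff)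
  moreover have "ennreal (measure N V - e) < emeasure N V"
    using False e by (simp add: emeasure_eq_measure ennreal_less_iff)
  ultimately obtain K where "compact K" "K \<subseteq> V" "ennreal (measure N V - e) < emeasure N K"
    by (auto simp: less_SUP_iff)
  then show ?thesis
    using False by (intro that[of K]) (auto simp: emeasure_eq_measure ennreal_less_iff)
qed

lemma outer_approx:
  assumes A: "A \<in> borel_sets_on U" and e: "0 < e"
  obtains V where "open V" "A \<subseteq> V" "V \<subseteq> U" "measure N V < measure N A + e"
proof -
  have "\<forall>A\<in>borel_sets_on U. emeasure N A = (INF V\<in>{V. openin (top_of_set U) V \<and> A \<subseteq> V}. emeasure N V)"
    using regular unfolding regular_borel_measure_def by blast
  then have "(INF V\<in>{V. openin (top_of_set U) V \<and> A \<subseteq> V}. emeasure N V) = emeasure N A"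
    using A by simp
  also have "emeasure N A < ennreal (measure N A + e)"
    using e by (simp add: emeasure_eq_measure ennreal_less_iff del: ennreal_plus)
  finally obtain V where "open V" "V \<subseteq> U" "A \<subseteq> V" "emeasure N V < ennreal (measure N A + e)"
    by (auto simp: INF_less_iff openin_U_iff)
  then show ?thesis
    by (intro that[of V]) (auto simp: emeasure_eq_measure ennreal_less_iff simp del: ennreal_plus)
qed

lemma integrable_bounded:
  assumes f: "f \<in> borel_measurable borel" and C: "\<And>x. \<bar>f x\<bar> \<le> C"
  shows "integrable N (f :: _ \<Rightarrow> real)"
proof (rule integrable_const_bound[of _ C])
  show "f \<in> borel_measurable N"
    using measurable_restrict_space1[OF f, of U] measurable_cong_sets[OF sets_N refl] by blast
qed (use C in simp)

lemma measure_le_integral: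
  assumes K: "compact K" "K \<subseteq> U" and f: "integrable N f" "\<And>x. x \<in> K \<Longrightarrow> f x = 1" "\<And>x. 0 \<le> f x"
  shows "measure N K \<le> (\<integral>x. f x \<partial>N)"
proof -
  have K': "K \<in> sets N"
    using K by (simp add: borel_subset_sets borel_compact)
  then have "measure N K = (\<integral>x. indicator K x \<partial>N)"
    by simp
  also have "\<dots> \<le> (\<integral>x. f x \<partial>N)"
  proof (rule integral_mono)
    show "integrable N (indicator K :: _ \<Rightarrow> real)"
      using K' by (simp add: integrable_indicator_iff emeasure_eq_measure)
  qed (use f in \<open>auto simp: indicator_def\<close>)
  finally show ?thesis .
qed

lemma integral_le_measure:
  assumes V: "open V" "V \<subseteq> U" and f: "integrable N f" "\<And>x. x \<notin> V \<Longrightarrow> f x = 0" "\<And>x. f x \<le> 1"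
  shows "(\<integral>x. f x \<partial>N) \<le> measure N V"
proof -
  have V': "V \<in> sets N"
    using V by (simp add: borel_subset_sets)
  then have "(\<integral>x. f x \<partial>N) \<le> (\<integral>x. indicator V x \<partial>N)"
  proof (intro integral_mono)
    show "integrable N (indicator V :: _ \<Rightarrow> real)"
      using V' by (simp add: integrable_indicator_iff emeasure_eq_measure)
  qed (use f in \<open>auto simp: indicator_def\<close>)
  also have "\<dots> = measure N V"
    using V' by simp
  finally show ?thesis .
qed

end

text \<open>Stated for pairs because an equation between signed integrals becomes one between sums
  of two positive integrals. One Urysohn function, equal to 1 on the union of the two inner compact
  sets, bounds both measures on the left at once.\<close>

lemma regular_measures_le_open:
  fixes U :: "'a::t2_space set"
  assumes lc: "locally_compact_space (euclidean :: 'a topology)"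
    and A: "finite_regular_measure A U" and B: "finite_regular_measure B U"
    and C: "finite_regular_measure C U" and D: "finite_regular_measure D U"
    and le: "\<And>f. \<lbrakk>f \<in> vcarrier Cc; fsupp f \<subseteq> U\<rbrakk> \<Longrightarrow>
      (\<integral>x. f x \<partial>A) + (\<integral>x. f x \<partial>B) \<le> (\<integral>x. f x \<partial>C) + (\<integral>x. f x \<partial>D)"
    and V: "open V" "V \<subseteq> U"
  shows "measure A V + measure B V \<le> measure C V + measure D V"
proof -
  interpret A: finite_regular_measure A U by fact
  interpret B: finite_regular_measure B U by fact
  interpret C: finite_regular_measure C U by fact
  interpret D: finite_regular_measure D U by fact
  show ?thesis
  proof (rule field_le_epsilon)
    fix e :: real assume "0 < e"
    then have e: "0 < e / 2" by simp
    obtain K where K: "compact K" "K \<subseteq> V" "measure A V < measure A K + e / 2"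
      using A.inner_approx[OF V e] by blast
    obtain L where L: "compact L" "L \<subseteq> V" "measure B V < measure B L + e / 2"
      using B.inner_approx[OF V e] by blast
    have KL: "compact (K \<union> L)" "K \<union> L \<subseteq> V"
      using K L by auto
    obtain f where f: "f \<in> vcarrier Cc" "\<And>x. 0 \<le> f x" "\<And>x. f x \<le> 1" "\<And>x. x \<in> K \<union> L \<Longrightarrow> f x = 1" "fsupp f \<subseteq> V"
      using Urysohn_Cc[OF lc KL(1) V(1) KL(2)] by blast
    have f1: "\<bar>f x\<bar> \<le> 1" for x
      using f(2,3)[of x] by simp
    note int = A.integrable_bounded[OF Cc_measurable[OF f(1)] f1]
      B.integrable_bounded[OF Cc_measurable[OF f(1)] f1]
      C.integrable_bounded[OF Cc_measurable[OF f(1)] f1]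
      D.integrable_bounded[OF Cc_measurable[OF f(1)] f1]
    have f0: "f x = 0" if "x \<notin> V" for x
      using that f(5) fsupp_zero[of x f] by blast
    have "measure A K \<le> (\<integral>x. f x \<partial>A)"
      using K V f by (intro A.measure_le_integral int) auto
    moreover have "measure B L \<le> (\<integral>x. f x \<partial>B)"
      using L V f by (intro B.measure_le_integral int) auto
    moreover have "(\<integral>x. f x \<partial>A) + (\<integral>x. f x \<partial>B) \<le> (\<integral>x. f x \<partial>C) + (\<integral>x. f x \<partial>D)"
      using f V by (intro le) auto
    moreover have "(\<integral>x. f x \<partial>C) \<le> measure C V" "(\<integral>x. f x \<partial>D) \<le> measure D V"
      using V f0 f(3) by (intro C.integral_le_measure D.integral_le_measure int; blast)+
    ultimately show "measure A V + measure B V \<le> measure C V + measure D V + e"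
      using K(3) L(3) by linarith
  qed
qed

text \<open>Outer regularity of \<open>C\<close> and \<open>D\<close> extends the inequality from
  open sets to \<open>E\<close>: the intersection of the two approximating open sets is open,
  contains \<open>E\<close>, and is good for both. Equality follows by exchanging the two
  sides.\<close>

lemma regular_measures_eq:
  fixes U :: "'a::t2_space set"
  assumes lc: "locally_compact_space (euclidean :: 'a topology)"
    and A: "finite_regular_measure A U" and B: "finite_regular_measure B U"
    and C: "finite_regular_measure C U" and D: "finite_regular_measure D U"
    and eq: "\<And>f. \<lbrakk>f \<in> vcarrier Cc; fsupp f \<subseteq> U\<rbrakk> \<Longrightarrow>
      (\<integral>x. f x \<partial>A) + (\<integral>x. f x \<partial>B) = (\<integral>x. f x \<partial>C) + (\<integral>x. f x \<partial>D)"
    and E: "E \<in> borel_sets_on U"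
  shows "measure A E + measure B E = measure C E + measure D E"
proof -
  have le: "measure A E + measure B E \<le> measure C E + measure D E"
    if A: "finite_regular_measure A U" and B: "finite_regular_measure B U"
    and C: "finite_regular_measure C U" and D: "finite_regular_measure D U"
    and eq: "\<And>f. \<lbrakk>f \<in> vcarrier Cc; fsupp f \<subseteq> U\<rbrakk> \<Longrightarrow>
      (\<integral>x. f x \<partial>A) + (\<integral>x. f x \<partial>B) = (\<integral>x. f x \<partial>C) + (\<integral>x. f x \<partial>D)" for A B C D :: "'a measure"
  proof (rule field_le_epsilon)
    interpret A: finite_regular_measure A U by fact
    interpret B: finite_regular_measure B U by fact
    interpret C: finite_regular_measure C U by fact
    interpret D: finite_regular_measure D U by fact
    fix e :: real assume "0 < e"
    then have e: "0 < e / 2" by simp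
    obtain V where V: "open V" "E \<subseteq> V" "V \<subseteq> U" "measure C V < measure C E + e / 2"
      using C.outer_approx[OF E e] by blast
    obtain W where W: "open W" "E \<subseteq> W" "W \<subseteq> U" "measure D W < measure D E + e / 2"
      using D.outer_approx[OF E e] by blast
    have VW: "open (V \<inter> W)" "V \<inter> W \<subseteq> U" "E \<subseteq> V \<inter> W"
      using V W by auto
    have mono: "measure N X \<le> measure N Y" if "finite_regular_measure N U" "X \<subseteq> Y" "open Y" "Y \<subseteq> U"
      for N X Y
    proof -
      interpret N: finite_regular_measure N U by fact
      show ?thesis
        using that by (intro N.finite_measure_mono N.borel_subset_sets) auto
    qed
    have "measure A E + measure B E \<le> measure A (V \<inter> W) + measure B (V \<inter> W)"
      using VW A B by (intro add_mono mono)
    also have "\<dots> \<le> measure C (V \<inter> W) + measure D (V \<inter> W)"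
      using VW eq by (intro regular_measures_le_open[OF lc A B C D]) auto
    also have "\<dots> \<le> measure C V + measure D W"
      using V W C D by (intro add_mono mono) auto
    finally show "measure A E + measure B E \<le> measure C E + measure D E + e"
      using V(4) W(4) by linarith
  qed
  show ?thesis
    by (rule antisym[OF le[OF A B C D eq] le[OF C D A B eq[symmetric]]])
qed

lemma finite_signed_regular_measureD:
  assumes "finite_signed_regular_measure U \<nu>" "open U"
  shows "\<nu> \<in> extensional (borel_sets_on U)" "signed_measure U \<nu>"
    "finite_regular_measure (pos_variation U \<nu>) U" "finite_regular_measure (neg_variation U \<nu>) U"
  using assms
  by (auto simp: finite_signed_regular_measure_def finite_regular_measure_def
    finite_regular_measure_axioms_def intro!: signed_measure.intro)

text \<open>The hypothesis is rearranged as \<nu>^+ + \<nu>'^- = \<nu>'^+ + \<nu>^- for integrals of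
  test functions, hence for sets, and the Jordan decomposition turns this back into \<nu> =
  \<nu>'.\<close>

lemma finite_signed_regular_measure_unique:
  fixes U :: "'a::t2_space set"
  assumes lc: "locally_compact_space (euclidean :: 'a topology)" and U: "open U"
    and \<nu>: "finite_signed_regular_measure U \<nu>" and \<nu>': "finite_signed_regular_measure U \<nu>'"
    and eq: "\<And>k. \<lbrakk>k \<in> vcarrier Cc; fsupp k \<subseteq> U\<rbrakk> \<Longrightarrow> signed_integral U \<nu> k = signed_integral U \<nu>' k"
  shows "\<nu> = \<nu>'"
proof (rule extensionalityI)
  note D = finite_signed_regular_measureD[OF \<nu> U] and D' = finite_signed_regular_measureD[OF \<nu>' U]
  show "\<nu> \<in> extensional (borel_sets_on U)" "\<nu>' \<in> extensional (borel_sets_on U)"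
    by (fact D D')+
  fix A assume A: "A \<in> borel_sets_on U"
  have "measure (pos_variation U \<nu>) A + measure (neg_variation U \<nu>') A
      = measure (pos_variation U \<nu>') A + measure (neg_variation U \<nu>) A"
  proof (rule regular_measures_eq[OF lc D(3) D'(4) D'(3) D(4) _ A])
    fix f :: "'a \<Rightarrow> real" assume "f \<in> vcarrier Cc" "fsupp f \<subseteq> U"
    from eq[OF this] show "(\<integral>x. f x \<partial>pos_variation U \<nu>) + (\<integral>x. f x \<partial>neg_variation U \<nu>')
        = (\<integral>x. f x \<partial>pos_variation U \<nu>') + (\<integral>x. f x \<partial>neg_variation U \<nu>)"
      by (simp add: signed_integral_def)
  qed
  moreover have "\<nu> A = measure (pos_variation U \<nu>) A - measure (neg_variation U \<nu>) A"
    using D A by (intro signed_measure.Jordan_decomposition finite_regular_measure.axioms(1))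
  moreover have "\<nu>' A = measure (pos_variation U \<nu>') A - measure (neg_variation U \<nu>') A"
    using D' A by (intro signed_measure.Jordan_decomposition finite_regular_measure.axioms(1))
  ultimately show "\<nu> A = \<nu>' A"
    by simp
qed

text \<open>Absolute continuity of the integral: |g| is at most \<open>n\<close> plus the excess
  \<open>t n\<close>, whose integral is small for large \<open>n\<close>; on a small set the
  constant \<open>n\<close> contributes little too.\<close>

lemma integral_small_on_small_sets:
  assumes g: "integrable M (g :: _ \<Rightarrow> real)" and e: "0 < e"
  obtains d where "0 < d" "\<And>E. \<lbrakk>E \<in> sets M; emeasure M E < ennreal d\<rbrakk> \<Longrightarrow>
    (\<integral>\<^sup>+x. ennreal \<bar>g x\<bar> * indicator E x \<partial>M) < ennreal e"
proof -
  have [measurable]: "g \<in> borel_measurable M"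
    using g by simp
  define t where "t n x = max (\<bar>g x\<bar> - real n) 0" for n x
  have "(\<lambda>n. \<integral>x. t n x \<partial>M) \<longlonglongrightarrow> (\<integral>x. 0 \<partial>M)"
  proof (rule integral_dominated_convergence[where w="\<lambda>x. \<bar>g x\<bar>"])
    show "AE x in M. (\<lambda>n. t n x) \<longlonglongrightarrow> 0"
    proof (rule AE_I2)
      fix x
      obtain N where "\<bar>g x\<bar> \<le> real N"
        using real_arch_simple by blast
      then have "t n x = 0" if "N \<le> n" for n
        using that by (auto simp: t_def)
      then show "(\<lambda>n. t n x) \<longlonglongrightarrow> 0"
        by (intro tendsto_eventually) (auto simp: eventually_sequentially)
    qed
  qed (use g in \<open>auto simp: t_def[abs_def]\<close>)
  then have "\<forall>\<^sub>F n in sequentially. (\<integral>x. t n x \<partial>M) < e / 2"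
    by (rule order_tendstoD(2)) (use e in simp)
  then obtain n where n: "(\<integral>x. t n x \<partial>M) < e / 2"
    by (auto simp: eventually_sequentially)
  have t_int: "integrable M (t n)"
    by (rule Bochner_Integration.integrable_bound[OF g]) (auto simp: t_def[abs_def])
  \<comment> \<open>Ensures n d \<le> e / 2, complementing the excess below e / 2; the + 1 covers n
    = 0.\<close>
  define d where "d = e / (2 * (real n + 1))"
  have d: "0 < d"
    using e by (simp add: d_def)
  show ?thesis
  proof (rule that[OF d])
    fix E assume E: "E \<in> sets M" "emeasure M E < ennreal d"
    have "ennreal \<bar>g x\<bar> * indicator E x \<le> ennreal (t n x) + ennreal (real n) * indicator E x" for x
      by (auto simp: indicator_def t_def ennreal_plus[symmetric] simp del: ennreal_plus intro!: ennreal_leI)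
    then have "(\<integral>\<^sup>+x. ennreal \<bar>g x\<bar> * indicator E x \<partial>M)
        \<le> (\<integral>\<^sup>+x. ennreal (t n x) + ennreal (real n) * indicator E x \<partial>M)"
      by (intro nn_integral_mono)
    also have "\<dots> = (\<integral>\<^sup>+x. ennreal (t n x) \<partial>M) + ennreal (real n) * emeasure M E"
      using E by (subst nn_integral_add) (auto simp: t_def[abs_def] nn_integral_cmult)
    also have "(\<integral>\<^sup>+x. ennreal (t n x) \<partial>M) = ennreal (\<integral>x. t n x \<partial>M)"
      by (rule nn_integral_eq_integral[OF t_int]) (simp add: t_def)
    also have "ennreal (\<integral>x. t n x \<partial>M) + ennreal (real n) * emeasure M E
        \<le> ennreal (\<integral>x. t n x \<partial>M) + ennreal (real n) * ennreal d"
      using E by (intro add_left_mono mult_left_mono) auto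
    also have "\<dots> = ennreal ((\<integral>x. t n x \<partial>M) + real n * d)"
      using d by (simp add: ennreal_mult t_def)
    also have "\<dots> < ennreal e"
    proof (rule ennreal_lessI[OF e])
      have "real n * d \<le> e / 2"
        using e by (simp add: d_def field_simps)
      then show "(\<integral>x. t n x \<partial>M) + real n * d < e"
        using n by linarith
    qed
    finally show "(\<integral>\<^sup>+x. ennreal \<bar>g x\<bar> * indicator E x \<partial>M) < ennreal e" .
  qed
qed

section \<open>The local measures of \<open>\<phi>\<^sub>g\<close>\<close>

context radon_Lp
begin

text \<open>The measure \<open>g\<^sup>+ \<mu>\<close> on \<open>U\<close>. The negative part of
  \<open>g\<close> is covered by applying it to \<open>\<lambda>x. - g x\<close>.\<close>

definition part :: "'a set \<Rightarrow> ('a \<Rightarrow> real) \<Rightarrow> 'a measure" where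
  "part U g = density (restrict_space M U) (\<lambda>x. ennreal (max (g x) 0))"

lemma sets_part: "sets (part U g) = borel_sets_on U"
  unfolding part_def sets_density by (rule sets_restrict_space_cong[OF sets_M])

lemma borel_sets_on_open_iff:
  assumes "open U"
  shows "A \<in> borel_sets_on U \<longleftrightarrow> A \<in> sets M \<and> A \<subseteq> U"
proof -
  have "U \<inter> space borel \<in> sets borel"
    using assms by simp
  from sets_restrict_space_iff[OF this] show ?thesis
    by auto
qed

section \<open>The measure \<open>part U g\<close> is finite and regular\<close>

context
  fixes U :: "'a set" and g :: "'a \<Rightarrow> real"
  assumes U: "open U" "compact (closure U)" and g: "g \<in> Lp_fun M p"
begin

lemma measurable_restrict:
  assumes "f \<in> borel_measurable M"
  shows "f \<in> borel_measurable (restrict_space M U)"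
  using assms by (rule measurable_restrict_space1)

lemma U_sets: "U \<inter> space M \<in> sets M"
  using U by simp

lemma emeasure_U_finite: "emeasure M U < \<infinity>"
proof -
  have "emeasure M U \<le> emeasure M (closure U)"
    by (intro emeasure_mono) (auto simp: closure_subset)
  then show ?thesis
    using emeasure_compact_finite[OF U(2)] by (rule le_less_trans)
qed

text \<open>Relative compactness gives \<open>U\<close> finite measure, and |g| \<le> 1 + |g|^p then
  makes \<open>g\<close> integrable over \<open>U\<close>, although it need not be integrable over
  the whole space.\<close>

lemma integrable_on_U: "integrable M (\<lambda>x. indicator U x * g x)"
proof -
  have "integrable M (\<lambda>x. indicator U x + \<bar>g x\<bar> powr p)"
    using U(1) emeasure_U_finite
    by (intro Bochner_Integration.integrable_add Lp_fun_integrable[OF g]) (simp add: integrable_indicator_iff)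
  then show ?thesis
  proof (rule Bochner_Integration.integrable_bound)
    have "(indicator U :: _ \<Rightarrow> real) \<in> borel_measurable M"
      using U(1) by (intro borel_measurable_indicator) simp
    then show "(\<lambda>x. indicator U x * g x) \<in> borel_measurable M"
      using Lp_fun_measurable[OF g] by (rule borel_measurable_times)
    show "AE x in M. norm (indicator U x * g x) \<le> norm (indicator U x + \<bar>g x\<bar> powr p)"
    proof (rule AE_I2)
      fix x
      have "\<bar>g x\<bar> \<le> 1 + \<bar>g x\<bar> powr p"
        using powr_mono[of 1 p "\<bar>g x\<bar>"] p by (cases "\<bar>g x\<bar> \<le> 1") (auto simp: add_increasing2)
      then show "norm (indicator U x * g x) \<le> norm (indicator U x + \<bar>g x\<bar> powr p)"
        by (auto simp: indicator_def)
    qed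
  qed
qed

lemma emeasure_part:
  assumes A: "A \<in> borel_sets_on U"
  shows "emeasure (part U g) A = (\<integral>\<^sup>+x. ennreal (max (g x) 0) * indicator A x \<partial>M)"
proof -
  note [measurable] = Lp_fun_measurable[OF g]
  have "A \<subseteq> U"
    using A U by (simp add: borel_sets_on_open_iff)
  have m: "(\<lambda>x. ennreal (max (g x) 0)) \<in> borel_measurable (restrict_space M U)"
    by (rule measurable_restrict) measurable
  have "emeasure (part U g) A = (\<integral>\<^sup>+x. ennreal (max (g x) 0) * indicator A x \<partial>restrict_space M U)"
    unfolding part_def
    using A m sets_restrict_space_cong[OF sets_M, of U] by (intro emeasure_density) auto
  also have "\<dots> = (\<integral>\<^sup>+x. ennreal (max (g x) 0) * indicator A x * indicator U x \<partial>M)"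
    by (rule nn_integral_restrict_space[OF U_sets])
  also have "\<dots> = (\<integral>\<^sup>+x. ennreal (max (g x) 0) * indicator A x \<partial>M)"
    using \<open>A \<subseteq> U\<close> by (intro nn_integral_cong) (auto simp: indicator_def)
  finally show ?thesis .
qed

lemma emeasure_part_le:
  assumes "A \<in> borel_sets_on U"
  shows "emeasure (part U g) A \<le> (\<integral>\<^sup>+x. ennreal \<bar>indicator U x * g x\<bar> * indicator A x \<partial>M)"
  unfolding emeasure_part[OF assms]
  using assms U by (intro nn_integral_mono) (auto simp: indicator_def borel_sets_on_open_iff intro!: ennreal_leI)

lemma finite_measure_part: "finite_measure (part U g)"
proof
  have sp: "space (part U g) = U"
    using sets_eq_imp_space_eq[OF sets_part] by (simp add: space_restrict_space)
  have "U \<in> borel_sets_on U"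
    using U by (simp add: borel_sets_on_open_iff)
  then have "emeasure (part U g) U \<le> (\<integral>\<^sup>+x. ennreal \<bar>indicator U x * g x\<bar> * indicator U x \<partial>M)"
    by (rule emeasure_part_le)
  also have "\<dots> \<le> (\<integral>\<^sup>+x. ennreal \<bar>indicator U x * g x\<bar> \<partial>M)"
    by (intro nn_integral_mono) (auto simp: indicator_def)
  also have "\<dots> < \<infinity>"
    using integrable_on_U unfolding integrable_iff_bounded by simp
  finally show "emeasure (part U g) (space (part U g)) \<noteq> \<infinity>"
    by (simp add: sp)
qed

text \<open>The sandwich for \<open>M\<close> carries over by absolute continuity of the integral of
  |g| over \<open>U\<close>; the outer set is cut down to \<open>V \<inter> U\<close>, still open
  because \<open>U\<close> is.\<close>

lemma part_sandwich:
  assumes A: "A \<in> borel_sets_on U" and e: "0 < e"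
  obtains K V where "compact K" "open V" "K \<subseteq> A" "A \<subseteq> V" "V \<subseteq> U"
    "emeasure (part U g) (V - K) < ennreal e"
proof -
  have A': "A \<in> sets M" "A \<subseteq> U"
    using A U by (auto simp: borel_sets_on_open_iff)
  have "emeasure M A \<le> emeasure M U"
    using A' U by (intro emeasure_mono) auto
  then have Af: "emeasure M A < \<infinity>"
    using emeasure_U_finite by (rule le_less_trans)
  obtain d where d: "0 < d" "\<And>E. \<lbrakk>E \<in> sets M; emeasure M E < ennreal d\<rbrakk> \<Longrightarrow>
      (\<integral>\<^sup>+x. ennreal \<bar>indicator U x * g x\<bar> * indicator E x \<partial>M) < ennreal e"
    using integral_small_on_small_sets[OF integrable_on_U e] by blast
  obtain K V where KV: "compact K" "open V" "K \<subseteq> A" "A \<subseteq> V" "emeasure M (V - K) < ennreal d"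
    using compact_open_sandwich[OF A'(1) Af d(1)] by blast
  let ?E = "(V \<inter> U) - K"
  have VK: "V - K \<in> sets M" "V \<inter> U - K \<in> sets M"
    using KV U by (simp_all add: borel_compact sets.Diff open_Int)
  have "emeasure M ?E \<le> emeasure M (V - K)"
    using VK by (intro emeasure_mono) auto
  then have "emeasure M ?E < ennreal d"
    using KV(5) by (rule le_less_trans)
  then have "(\<integral>\<^sup>+x. ennreal \<bar>indicator U x * g x\<bar> * indicator ?E x \<partial>M) < ennreal e"
    by (rule d(2)[OF VK(2)])
  moreover have "?E \<in> borel_sets_on U"
    using VK U by (auto simp: borel_sets_on_open_iff)
  ultimately have "emeasure (part U g) ?E < ennreal e"
    using emeasure_part_le le_less_trans by blast
  then show ?thesis
    using KV A' U by (intro that[of K "V \<inter> U"]) auto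
qed

text \<open>Both regularity conditions come from the same sandwich: \<open>V\<close> is contained in
  \<open>A\<close> together with the small set \<open>V - K\<close>, and an open set is contained in
  \<open>K\<close> together with the small set \<open>W - K\<close>.\<close>

lemma finite_regular_measure_part: "finite_regular_measure (part U g) U"
proof -
  interpret P: finite_measure "part U g"
    by (rule finite_measure_part)
  let ?P = "part U g"
  have setsP: "X \<in> sets ?P" if "X \<in> borel_sets_on U" for X
    using that by (simp add: sets_part)
  have open_sets: "V \<in> borel_sets_on U" if "open V" "V \<subseteq> U" for V
    using that U by (simp add: borel_sets_on_open_iff)
  have compact_sets: "K \<in> borel_sets_on U" if "compact K" "K \<subseteq> U" for K
    using that U by (simp add: borel_sets_on_open_iff borel_compact)
  have "regular_borel_measure U ?P"
    unfolding regular_borel_measure_def openin_open_eq[OF U(1)]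
  proof (intro conjI allI ballI impI)
    show "sets ?P = borel_sets_on U"
      by (rule sets_part)
    show "emeasure ?P K < \<infinity>" for K
      by (simp add: P.emeasure_eq_measure)
  next
    fix A assume A: "A \<in> borel_sets_on U"
    show "emeasure ?P A = (INF V\<in>{V. (open V \<and> V \<subseteq> U) \<and> A \<subseteq> V}. emeasure ?P V)"
    proof (rule antisym)
      show "emeasure ?P A \<le> (INF V\<in>{V. (open V \<and> V \<subseteq> U) \<and> A \<subseteq> V}. emeasure ?P V)"
        using open_sets setsP by (intro INF_greatest emeasure_mono) auto
      show "(INF V\<in>{V. (open V \<and> V \<subseteq> U) \<and> A \<subseteq> V}. emeasure ?P V) \<le> emeasure ?P A"
      proof (rule ennreal_le_epsilon)
        fix e :: real assume e: "0 < e"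
        obtain K V where KV: "compact K" "open V" "K \<subseteq> A" "A \<subseteq> V" "V \<subseteq> U" "emeasure ?P (V - K) < ennreal e"
          using part_sandwich[OF A e] by blast
        have "K \<subseteq> U"
          using KV by blast
        then have sets: "K \<in> sets ?P" "V \<in> sets ?P" "A \<in> sets ?P"
          using KV A open_sets compact_sets setsP by blast+
        have "(INF V\<in>{V. (open V \<and> V \<subseteq> U) \<and> A \<subseteq> V}. emeasure ?P V) \<le> emeasure ?P V"
          using KV by (intro INF_lower) auto
        also have "\<dots> \<le> emeasure ?P (A \<union> (V - K))"
          by (rule emeasure_mono) (use KV(3,4) sets in \<open>blast, simp add: sets.Un sets.Diff\<close>)
        also have "\<dots> \<le> emeasure ?P A + emeasure ?P (V - K)"
          using sets by (intro emeasure_subadditive sets.Diff)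
        also have "\<dots> \<le> emeasure ?P A + ennreal e"
          using KV by (intro add_left_mono) auto
        finally show "(INF V\<in>{V. (open V \<and> V \<subseteq> U) \<and> A \<subseteq> V}. emeasure ?P V) \<le> emeasure ?P A + ennreal e" .
      qed
    qed
  next
    fix V assume V: "open V \<and> V \<subseteq> U"
    show "emeasure ?P V = (SUP K\<in>{K. compact K \<and> K \<subseteq> V}. emeasure ?P K)"
    proof (rule antisym)
      show "(SUP K\<in>{K. compact K \<and> K \<subseteq> V}. emeasure ?P K) \<le> emeasure ?P V"
        using open_sets setsP V by (intro SUP_least emeasure_mono) auto
      show "emeasure ?P V \<le> (SUP K\<in>{K. compact K \<and> K \<subseteq> V}. emeasure ?P K)"
      proof (rule ennreal_le_epsilon)
        fix e :: real assume e: "0 < e"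
        obtain K W where K: "compact K" "open W" "K \<subseteq> V" "V \<subseteq> W" "W \<subseteq> U" "emeasure ?P (W - K) < ennreal e"
          using part_sandwich[OF open_sets e, of V] V by blast
        have "K \<subseteq> U"
          using K by blast
        then have sets: "K \<in> sets ?P" "W \<in> sets ?P"
          using K open_sets compact_sets setsP by blast+
        have "emeasure ?P V \<le> emeasure ?P (K \<union> (W - K))"
          by (rule emeasure_mono) (use K(4) sets in \<open>blast, simp add: sets.Un sets.Diff\<close>)
        also have "\<dots> \<le> emeasure ?P K + emeasure ?P (W - K)"
          using sets by (intro emeasure_subadditive sets.Diff)
        also have "\<dots> \<le> (SUP K\<in>{K. compact K \<and> K \<subseteq> V}. emeasure ?P K) + ennreal e"
          using K by (intro add_mono SUP_upper) auto
        finally show "emeasure ?P V \<le> (SUP K\<in>{K. compact K \<and> K \<subseteq> V}. emeasure ?P K) + ennreal e" .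
      qed
    qed
  qed
  then show ?thesis
    using U by unfold_locales auto
qed

lemma integrable_bounded_mult:
  assumes k: "k \<in> borel_measurable borel" "\<And>x. \<bar>k x\<bar> \<le> C" "\<And>x. x \<notin> U \<Longrightarrow> k x = 0"
  shows "integrable M (\<lambda>x. k x * g x)"
proof -
  have [measurable]: "k \<in> borel_measurable M"
    using k(1) measurable_cong_sets[OF sets_M refl] by blast
  note [measurable] = Lp_fun_measurable[OF g]
  have "integrable M (\<lambda>x. C * (indicator U x * g x))"
    using integrable_on_U by (rule integrable_mult_right)
  then show ?thesis
  proof (rule Bochner_Integration.integrable_bound)
    show "AE x in M. norm (k x * g x) \<le> norm (C * (indicator U x * g x))"
    proof (rule AE_I2)
      fix x
      have "\<bar>k x\<bar> * \<bar>g x\<bar> \<le> \<bar>C\<bar> * \<bar>g x\<bar>"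
        using k(2)[of x] by (intro mult_right_mono) auto
      then show "norm (k x * g x) \<le> norm (C * (indicator U x * g x))"
        using k(3)[of x] by (cases "x \<in> U") (auto simp: abs_mult)
    qed
  qed measurable
qed

lemma integral_part:
  assumes k: "k \<in> borel_measurable borel" "\<And>x. x \<notin> U \<Longrightarrow> k x = 0"
  shows "(\<integral>x. k x \<partial>part U g) = (\<integral>x. k x * max (g x) 0 \<partial>M)"
proof -
  have k': "k \<in> borel_measurable M"
    using k(1) measurable_cong_sets[OF sets_M refl] by blast
  note [measurable] = Lp_fun_measurable[OF g] k'
  have "(\<integral>x. k x \<partial>part U g) = (\<integral>x. max (g x) 0 *\<^sub>R k x \<partial>restrict_space M U)"
    unfolding part_def
  proof (rule integral_density)
    show "k \<in> borel_measurable (restrict_space M U)"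
      by (rule measurable_restrict[OF k'])
    show "(\<lambda>x. max (g x) 0) \<in> borel_measurable (restrict_space M U)"
      by (rule measurable_restrict) measurable
  qed simp
  also have "\<dots> = (\<integral>x. indicator U x *\<^sub>R (max (g x) 0 *\<^sub>R k x) \<partial>M)"
    by (rule integral_restrict_space[OF U_sets])
  also have "\<dots> = (\<integral>x. k x * max (g x) 0 \<partial>M)"
    using k(2) by (intro Bochner_Integration.integral_cong) (auto simp: indicator_def)
  finally show ?thesis .
qed

end

section \<open>The signed measure of density \<open>g\<close> and the local representation of
  \<open>phi\<close>\<close>

context
  fixes U :: "'a set" and g :: "'a \<Rightarrow> real"
  assumes U: "open U" "compact (closure U)" and g: "g \<in> Lp_fun M p"
begin

text \<open>The signed measure \<open>g \<mu>\<close> on \<open>U\<close>. The restricted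
  abstraction makes it extensional, as the uniqueness in \<open>local_measure\<close>
  requires.\<close>

definition "gmeasure = (\<lambda>A\<in>borel_sets_on U. measure (part U g) A - measure (part U (\<lambda>x. - g x)) A)"

text \<open>The part of \<open>U\<close> where \<open>g\<close> is nonnegative is a Hahn set, so the
  variations, defined as suprema, are identified with the two densities.\<close>

lemma gmeasure_variations:
  "pos_variation U gmeasure = part U g" "neg_variation U gmeasure = part U (\<lambda>x. - g x)"
  and signed_measure_gmeasure: "signed_measure U gmeasure"
proof -
  note g' = Lp_fun_uminus[OF g]
  define D where "D = U \<inter> {x. 0 \<le> g x}"
  note [measurable] = Lp_fun_measurable[OF g]
  have "g -` {0..} \<inter> space M \<in> sets M"
    by (rule measurable_sets[OF Lp_fun_measurable[OF g]]) simp
  moreover have "g -` {0..} \<inter> space M = {x. 0 \<le> g x}"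
    by auto
  ultimately have pos: "{x. 0 \<le> g x} \<in> sets M"
    by metis
  have UM: "U \<in> sets M"
    using U(1) by simp
  have DM: "D \<in> sets M"
    unfolding D_def by (rule sets.Int[OF UM pos])
  have DU: "D \<subseteq> U"
    by (simp add: D_def)
  have D: "D \<in> borel_sets_on U"
    unfolding borel_sets_on_open_iff[OF U(1)] using DM DU ..
  have UD: "U - D \<in> borel_sets_on U"
    unfolding borel_sets_on_open_iff[OF U(1)] using sets.Diff[OF UM DM] Diff_subset ..
  have P0: "emeasure (part U g) (U - D) = 0"
  proof -
    have "(\<lambda>x. ennreal (max (g x) 0) * indicator (U - D) x) = (\<lambda>x. 0)"
      by (rule ext) (auto simp: D_def indicator_def max_def)
    then show ?thesis
      unfolding emeasure_part[OF U g UD] by (simp only: nn_integral_const mult_zero_left)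
  qed
  have Q0: "emeasure (part U (\<lambda>x. - g x)) D = 0"
  proof -
    have "(\<lambda>x. ennreal (max (- g x) 0) * indicator D x) = (\<lambda>x. 0)"
      by (rule ext) (auto simp: D_def indicator_def max_def)
    then show ?thesis
      unfolding emeasure_part[OF U g' D] by (simp only: nn_integral_const mult_zero_left)
  qed
  note fin = finite_measure_part[OF U g] finite_measure_part[OF U g']
  note eq = restrict_apply'[of _ "borel_sets_on U" "\<lambda>A. measure (part U g) A - measure (part U (\<lambda>x. - g x)) A",
      folded gmeasure_def]
  show "pos_variation U gmeasure = part U g"
    by (rule pos_variation_diff[OF fin(1) sets_part fin(2) sets_part eq D P0 Q0])
  \<comment> \<open>For the negative variation the roles are exchanged: \<open>U - D\<close> is the
    Hahn set, and the nullity of its complement is the nullity of \<open>D\<close>.\<close>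
  have "U - (U - D) = D"
    by (auto simp: D_def)
  then show "neg_variation U gmeasure = part U (\<lambda>x. - g x)"
    unfolding neg_variation_def using Q0 P0
    by (intro pos_variation_diff[OF fin(2) sets_part fin(1) sets_part _ UD]) (simp_all only: eq minus_diff_eq)
  show "signed_measure U gmeasure"
    by (rule signed_measure_diff[OF fin(1) sets_part fin(2) sets_part eq])
qed

lemma finite_signed_regular_gmeasure: "finite_signed_regular_measure U gmeasure"
proof -
  interpret signed_measure U gmeasure
    by (rule signed_measure_gmeasure)
  interpret P: finite_regular_measure "part U g" U
    by (rule finite_regular_measure_part[OF U g])
  interpret Q: finite_regular_measure "part U (\<lambda>x. - g x)" U
    by (rule finite_regular_measure_part[OF U Lp_fun_uminus[OF g]])
  show ?thesis
    unfolding finite_signed_regular_measure_def gmeasure_variations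
    using empty sums P.finite_measure_axioms Q.finite_measure_axioms P.regular Q.regular
    by (auto simp: gmeasure_def)
qed

text \<open>Bounded Borel functions vanishing off \<open>U\<close> include both the test functions,
  which give the representation of \<open>phi M g\<close>, and their products with a bounded Borel
  function.\<close>

lemma signed_integral_gmeasure:
  assumes k: "k \<in> borel_measurable borel" "\<And>x. \<bar>k x\<bar> \<le> C" "\<And>x. x \<notin> U \<Longrightarrow> k x = 0"
  shows "signed_integral U gmeasure k = (\<integral>x. k x * g x \<partial>M)"
proof -
  have max_Lp: "(\<lambda>x. max (g x) 0) \<in> Lp_fun M p" "(\<lambda>x. max (- g x) 0) \<in> Lp_fun M p"
    by (rule Lp_fun_max[OF g Lp_fun_zero p0(1)] Lp_fun_max[OF Lp_fun_uminus[OF g] Lp_fun_zero p0(1)])+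
  have "signed_integral U gmeasure k = (\<integral>x. k x * max (g x) 0 \<partial>M) - (\<integral>x. k x * max (- g x) 0 \<partial>M)"
    unfolding signed_integral_def gmeasure_variations
    using integral_part[OF U g k(1,3)] integral_part[OF U Lp_fun_uminus[OF g] k(1,3)] by simp
  also have "\<dots> = (\<integral>x. k x * max (g x) 0 - k x * max (- g x) 0 \<partial>M)"
    using integrable_bounded_mult[OF U max_Lp(1) k] integrable_bounded_mult[OF U max_Lp(2) k]
    by (rule Bochner_Integration.integral_diff[symmetric])
  also have "\<dots> = (\<integral>x. k x * g x \<partial>M)"
    by (intro Bochner_Integration.integral_cong) (auto simp: max_def)
  finally show ?thesis .
qed

lemma local_measure_phi: "local_measure (phi M g) U = gmeasure"
  unfolding local_measure_def
proof (rule the_equality)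
  have *: "phi M g k = signed_integral U gmeasure k" if k: "k \<in> vcarrier Cc" "fsupp k \<subseteq> U" for k
  proof -
    obtain C where C: "\<And>x. \<bar>k x\<bar> \<le> C"
      using Cc_bounded[OF k(1)] by blast
    have "k x = 0" if "x \<notin> U" for x
      using that k(2) fsupp_zero[of x k] by blast
    then show ?thesis
      using signed_integral_gmeasure[OF Cc_measurable[OF k(1)] C] phi_apply[OF k(1)] by simp
  qed
  then show "finite_signed_regular_measure U gmeasure \<and>
      (\<forall>k\<in>vcarrier Cc. fsupp k \<subseteq> U \<longrightarrow> phi M g k = signed_integral U gmeasure k)"
    using finite_signed_regular_gmeasure by blast
  fix \<nu>
  assume \<nu>: "finite_signed_regular_measure U \<nu> \<and>
      (\<forall>k\<in>vcarrier Cc. fsupp k \<subseteq> U \<longrightarrow> phi M g k = signed_integral U \<nu> k)"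
  show "\<nu> = gmeasure"
  proof (rule finite_signed_regular_measure_unique[OF lc U(1)])
    show "signed_integral U \<nu> k = signed_integral U gmeasure k"
      if "k \<in> vcarrier Cc" "fsupp k \<subseteq> U" for k
      using \<nu> *[OF that] that by metis
  qed (use \<nu> finite_signed_regular_gmeasure in auto)
qed

end

section \<open>Products with bounded Borel functions\<close>

lemma Lp_fun_bounded_mult:
  assumes h: "h \<in> borel_measurable borel" "bounded (range h)" and g: "g \<in> Lp_fun M p"
  shows "(\<lambda>x. h x * g x) \<in> Lp_fun M p"
proof -
  obtain C where C: "\<And>x. \<bar>h x\<bar> \<le> C"
    using h(2) by (auto simp: bounded_iff)
  have hM: "h \<in> borel_measurable M"
    using h(1) measurable_cong_sets[OF sets_M refl] by blast
  show ?thesis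
  proof (rule Lp_fun_bound[OF Lp_fun_scale[OF g, of C]])
    show "(\<lambda>x. h x * g x) \<in> borel_measurable M"
      using hM Lp_fun_measurable[OF g] by (rule borel_measurable_times)
    show "AE x in M. \<bar>h x * g x\<bar> \<le> \<bar>C * g x\<bar>"
    proof (rule AE_I2)
      fix x
      show "\<bar>h x * g x\<bar> \<le> \<bar>C * g x\<bar>"
        using C[of x] unfolding abs_mult by (intro mult_right_mono) auto
    qed
  qed (rule p0)
qed

text \<open>Whichever \<open>U\<close> the choice in \<open>bounded_mult\<close> picks, the local
  measure on it is \<open>g \<mu>\<close>, and integrating \<open>f h\<close> against that gives the
  integral of \<open>f h g\<close>.\<close>

lemma bounded_mult_phi:
  assumes h: "h \<in> borel_measurable borel" "bounded (range h)" and g: "g \<in> Lp_fun M p"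
  shows "phi M (\<lambda>x. h x * g x) = bounded_mult h (phi M g)"
  unfolding phi_def[of M "\<lambda>x. h x * g x"] bounded_mult_def
proof (rule restrict_ext)
  fix f :: "'a \<Rightarrow> real" assume f: "f \<in> vcarrier Cc"
  define Q where "Q U \<longleftrightarrow> U \<noteq> {} \<and> open U \<and> compact (closure U) \<and> fsupp f \<subseteq> U" for U :: "'a set"
  define U where "U = (SOME U. Q U)"
  have "\<exists>U. Q U"
  proof -
    \<comment> \<open>The support of \<open>f\<close> may be empty; an arbitrary point of the space
      is added so that the neighbourhood is not empty.\<close>
    obtain a :: 'a where True by simp
    have "compact (insert a (fsupp f))"
      using Cc_compact[OF f] by simp
    then obtain W where "open W" "compact (closure W)" "insert a (fsupp f) \<subseteq> W"
      by (rule open_relatively_compact_between[OF lc _ open_UNIV subset_UNIV])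
    then show ?thesis
      unfolding Q_def by blast
  qed
  then have "Q U"
    unfolding U_def by (rule someI_ex)
  then have U: "open U" "compact (closure U)" "fsupp f \<subseteq> U"
    by (simp_all add: Q_def)
  obtain C where C: "0 \<le> C" "\<And>x. \<bar>f x\<bar> \<le> C"
    using Cc_bounded[OF f] by blast
  obtain B where B: "\<And>x. \<bar>h x\<bar> \<le> B"
    using h(2) by (auto simp: bounded_iff)
  have fh: "\<bar>f x * h x\<bar> \<le> C * B" for x
    unfolding abs_mult using C B[of x] by (intro mult_mono) auto
  have f0: "f x * h x = 0" if "x \<notin> U" for x
    using that U(3) fsupp_zero[of x f] by auto
  have "signed_integral U (local_measure (phi M g) U) (\<lambda>x. f x * h x) = (\<integral>x. f x * h x * g x \<partial>M)"
    unfolding local_measure_phi[OF U(1,2) g]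
    by (rule signed_integral_gmeasure[OF U(1,2) g borel_measurable_times[OF Cc_measurable[OF f] h(1)] fh f0])
  then show "(\<integral>x. f x * (h x * g x) \<partial>M) =
      (let U = (SOME U. U \<noteq> {} \<and> open U \<and> compact (closure U) \<and> fsupp f \<subseteq> U)
       in signed_integral U (local_measure (phi M g) U) (\<lambda>x. f x * h x))"
    unfolding Q_def[symmetric] U_def[symmetric] Let_def by (simp add: mult.assoc)
qed

end

theorem theorem7p5:
  fixes \<mu> :: "'a::t2_space measure" and p :: real
  assumes "locally_compact_space (euclidean :: 'a topology)"
    and "regular_borel_measure UNIV \<mu>"
    and "1 \<le> p"
  shows "(\<forall>g\<in>Lp_fun \<mu> p.
            (\<forall>f\<in>vcarrier Cc. integrable \<mu> (\<lambda>x. f x * g x)) \<and>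
            phi \<mu> g \<in> vcarrier Cc_dual \<and>
            Phi \<mu> (Lp_class \<mu> p g) = phi \<mu> g)
       \<and> lattice_hom (Lp \<mu> p) Cc_dual (Phi \<mu>)
       \<and> inj_on (Phi \<mu>) (vcarrier (Lp \<mu> p))
       \<and> (\<forall>h\<in>borel_measurable borel. bounded (range h) \<longrightarrow>
            (\<forall>g\<in>Lp_fun \<mu> p. (\<lambda>x. h x * g x) \<in> Lp_fun \<mu> p \<and>
               phi \<mu> (\<lambda>x. h x * g x) = bounded_mult h (phi \<mu> g)))
       \<and> (\<forall>g\<in>Lp_fun \<mu> p. Phi_norm \<mu> p (phi \<mu> g) = Lp_norm \<mu> p g)
       \<and> banach_lattice (Phi_image \<mu> p) (Phi_norm \<mu> p)
       \<and> dedekind_complete (Phi_image \<mu> p)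
       \<and> norm_dense (Phi_image \<mu> p) (Phi_norm \<mu> p)
            {phi \<mu> g |g. g \<in> vcarrier Cc \<and>
               fsupp (pos_part Cc g) \<inter> fsupp (neg_part Cc g) = {}}
       \<and> norm_dense (Phi_image \<mu> p) (Phi_norm \<mu> p)
            {\<phi> \<in> vcarrier (Phi_image \<mu> p). compact (dsupp \<phi>) \<and>
               dsupp (pos_part Cc_dual \<phi>) \<inter> dsupp (neg_part Cc_dual \<phi>) = {}}"
proof -
  interpret radon_Lp \<mu> p
    using assms by unfold_locales
  show ?thesis
    using integrable_Cc_mult[OF _ _ p] phi_in_dual Phi_Lp_class lattice_hom_Phi inj_on_Phi
      Lp_fun_bounded_mult bounded_mult_phi Phi_norm_phi image.banach_lattice_axioms
      image.dedekind_complete dense_disjoint_supports dense_disjoint_dual_supports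
    by blast
qed

end
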